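(* There is an injection from Teichmüller space of $\Sigma$ into the moduli space $\hat{\mathcal{T}}^n$ of $n$-complex structures on $\Sigma$.
   Context: $\Sigma$ is a smooth closed connected oriented surface of genus $g\geq 2$ with a reference complex coordinate $z$; $p,\bar p$ are the induced linear coordinates on the fibers of $T^{*\mathbb{C}}\Sigma=T^*\Sigma\otimes\mathbb{C}$. Teichmüller space is the space of complex structures on $\Sigma$ compatible with the orientation (encoded by Beltrami differentials $\mu_2$ with $|\mu_2|<1$) modulo diffeomorphisms isotopic to the identity. $\mathrm{Hilb}^n_0(\mathbb{C}^2)$ is the set of ideals of $\mathbb{C}[x,y]$ of codimension $n$ supported at the origin; $\mathrm{Hilb}^n_0(T^{*\mathbb{C}}\Sigma)$ is the bundle obtained by applying it fiberwise. An $n$-complex structure is a section $I$ of $\mathrm{Hilb}^n_0(T^{*\mathbb{C}}\Sigma)$ with $I(z)+\overline I(z)=\langle p,\bar p\rangle$ for all $z$. It is compatible if $I=\langle p^n,-\bar p+\mu_2p+\dots+\mu_np^{n-1}\rangle$ with $\mu_2\bar\mu_2<1$. A higher diffeomorphism is a hamiltonian diffeomorphism of $T^*\Sigma$ preserving the zero-section setwise; they form the group $\mathrm{Symp}_0(T^*\Sigma)$. A Hamiltonian $H$ (vanishing on the zero-section) acts infinitesimally on $I=\langle f_1,\dots,f_r\rangle$ by $f_i\mapsto f_i+\varepsilon\{H,f_i\}\bmod I$, with $\{H,f\}=\partial_pH\,\partial f-\partial H\,\partial_pf+\partial_{\bar p}H\,\bar\partial f-\bar\partial H\,\partial_{\bar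 p}f$. The moduli space $\hat{\mathcal T}^n$ is the space of compatible $n$-complex structures modulo $\mathrm{Symp}_0(T^*\Sigma)$. *)

theory Defs
  imports
    "HOL-Analysis.Analysis"
    "HOL-Computational_Algebra.Polynomial"
    "HOL-Homology.Homology"
begin

section \<open>Smooth manifolds given by atlases\<close>

primrec Ck_on :: "nat \<Rightarrow> 'a::real_normed_vector set \<Rightarrow> ('a \<Rightarrow> 'b::real_normed_vector) \<Rightarrow> bool" where
  "Ck_on 0 S f \<longleftrightarrow> continuous_on S f"
| "Ck_on (Suc k) S f \<longleftrightarrow>
     (\<forall>x\<in>S. f differentiable (at x)) \<and> (\<forall>v. Ck_on k S (\<lambda>x. frechet_derivative f (at x) v))"

text \<open>Only meant for open sets; it is applied only to such sets.\<close>

definition smooth_on :: "'a::real_normed_vector set \<Rightarrow> ('a \<Rightarrow> 'b::real_normed_vector) \<Rightarrow> bool" where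
  "smooth_on S f \<longleftrightarrow> (\<forall>k. Ck_on k S f)"

text \<open>A chart is a domain together with a coordinate map, which is relevant on the domain only.\<close>

type_synonym ('m, 'e) chart = "'m set \<times> ('m \<Rightarrow> 'e)"

definition points :: "('m, 'e) chart set \<Rightarrow> 'm set" where
  "points M = (\<Union>c\<in>M. fst c)"

abbreviation param :: "('m, 'e) chart \<Rightarrow> 'e \<Rightarrow> 'm" where
  "param c \<equiv> inv_into (fst c) (snd c)"

text \<open>Openness, in all charts, of the sets \<open>U \<inter> f\<^sup>-\<^sup>1(V)\<close> expresses continuity of \<open>f\<close> for the
  topologies defined by the atlases.\<close>

definition smooth_map ::
    "('m, 'e::real_normed_vector) chart set \<Rightarrow> ('n, 'f::real_normed_vector) chart set \<Rightarrow> ('m \<Rightarrow> 'n) \<Rightarrow> bool" where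
  "smooth_map M N f \<longleftrightarrow> f ` points M \<subseteq> points N \<and>
     (\<forall>c\<in>M. \<forall>d\<in>N. let W = snd c ` (fst c \<inter> f -` fst d) in
        open W \<and> smooth_on W (snd d \<circ> f \<circ> param c))"

definition diffeomorphism :: "('m, 'e::real_normed_vector) chart set \<Rightarrow> ('m \<Rightarrow> 'm) \<Rightarrow> bool" where
  "diffeomorphism M f \<longleftrightarrow> bij_betw f (points M) (points M) \<and>
     smooth_map M M f \<and> smooth_map M M (inv_into (points M) f)"

definition vector_atlas :: "('e, 'e::real_normed_vector) chart set" where
  "vector_atlas = {(UNIV, id)}"

definition time_atlas :: "('m, 'e::real_normed_vector) chart set \<Rightarrow> (real \<times> 'm, real \<times> 'e) chart set" where
  "time_atlas M = (\<lambda>c. (UNIV \<times> fst c, \<lambda>(t, x). (t, snd c x))) ` M"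

text \<open>Isotopies are parametrised by the whole real line, which avoids boundaries. This is no
  restriction for an isotopy over \<open>[0,1]\<close>: reparametrise time so that it is stationary near the
  ends.\<close>

definition isotopy :: "('m, 'e::real_normed_vector) chart set \<Rightarrow> (real \<Rightarrow> 'm \<Rightarrow> 'm) \<Rightarrow> bool" where
  "isotopy M \<Phi> \<longleftrightarrow> smooth_map (time_atlas M) M (\<lambda>(t, x). \<Phi> t x) \<and>
     (\<forall>x\<in>points M. \<Phi> 0 x = x) \<and> (\<forall>t. diffeomorphism M (\<Phi> t))"

definition diffeos_isotopic_to_id :: "('m, 'e::real_normed_vector) chart set \<Rightarrow> ('m \<Rightarrow> 'm) set" where
  "diffeos_isotopic_to_id M = {\<Phi> 1 | \<Phi>. isotopy M \<Phi>}"


section \<open>The surface\<close>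

text \<open>The smooth structure and the orientation of the surface are those of a complex atlas, which
  also supplies the reference complex coordinates. Every closed oriented smooth surface arises in
  this way. A compact space with such an atlas is automatically second countable.\<close>

type_synonym 'a cchart = "('a, complex) chart"

definition trans_deriv :: "'a cchart \<Rightarrow> 'a cchart \<Rightarrow> 'a \<Rightarrow> complex" where
  "trans_deriv c d x = deriv (snd d \<circ> param c) (snd c x)"
  \<comment> \<open>\<open>dz\<^sub>d / dz\<^sub>c\<close> at \<open>x\<close>\<close>

definition complex_atlas :: "('a::topological_space) cchart set \<Rightarrow> bool" where
  "complex_atlas A \<longleftrightarrow> points A = UNIV \<and>
     (\<forall>c\<in>A. open (fst c) \<and> open (snd c ` fst c) \<and>
        homeomorphism (fst c) (snd c ` fst c) (snd c) (param c)) \<and>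
     (\<forall>c\<in>A. \<forall>d\<in>A. (snd d \<circ> param c) holomorphic_on snd c ` (fst c \<inter> fst d))"

text \<open>For a closed connected oriented surface, \<open>H\<^sub>1\<close> is free abelian of rank \<open>2g\<close>, \<open>g\<close> the genus.\<close>

definition closed_surface :: "('a::t2_space) cchart set \<Rightarrow> nat \<Rightarrow> bool" where
  "closed_surface A g \<longleftrightarrow> complex_atlas A \<and>
     compact (UNIV :: 'a set) \<and> connected (UNIV :: 'a set) \<and>
     homology_group 1 (euclidean :: 'a topology) \<cong> free_Abelian_group {..<2 * g}"


section \<open>Wirtinger derivatives\<close>

text \<open>Derivatives with respect to one complex variable \<open>w\<close>, and its conjugate, of a function on a
  space in which that variable is embedded by \<open>e\<close>.\<close>

definition wirt :: "(complex \<Rightarrow> 'v::real_normed_vector) \<Rightarrow> ('v \<Rightarrow> complex) \<Rightarrow> 'v \<Rightarrow> complex" where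
  "wirt e F x = (frechet_derivative F (at x) (e 1) - \<i> * frechet_derivative F (at x) (e \<i>)) / 2"

definition wirt_bar :: "(complex \<Rightarrow> 'v::real_normed_vector) \<Rightarrow> ('v \<Rightarrow> complex) \<Rightarrow> 'v \<Rightarrow> complex" where
  "wirt_bar e F x = (frechet_derivative F (at x) (e 1) + \<i> * frechet_derivative F (at x) (e \<i>)) / 2"

abbreviation z_dir :: "complex \<Rightarrow> complex \<times> complex" where
  "z_dir \<equiv> \<lambda>w. (w, 0)"

abbreviation p_dir :: "complex \<Rightarrow> complex \<times> complex" where
  "p_dir \<equiv> \<lambda>w. (0, w)"


section \<open>Teichmueller space\<close>

text \<open>A complex structure compatible with the orientation is encoded by its Beltrami differential
  \<open>\<mu> d\<bar>z/dz\<close> with \<open>|\<mu>| < 1\<close>: its local holomorphic functions are the solutions of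
  \<open>\<partial>\<^sub>\<bar>z w = \<mu> \<partial>\<^sub>z w\<close>. A Beltrami differential is the family of its coefficients in the charts, set to
  \<open>0\<close> where a chart is not defined.\<close>

definition smooth_coeff :: "'a cchart \<Rightarrow> ('a \<Rightarrow> complex) \<Rightarrow> bool" where
  "smooth_coeff c u \<longleftrightarrow> smooth_on (snd c ` fst c) (u \<circ> param c)"

definition beltrami_differentials :: "'a cchart set \<Rightarrow> ('a cchart \<Rightarrow> 'a \<Rightarrow> complex) set" where
  "beltrami_differentials A = {\<mu>.
     (\<forall>c x. c \<notin> A \<or> x \<notin> fst c \<longrightarrow> \<mu> c x = 0) \<and>
     (\<forall>c\<in>A. smooth_coeff c (\<mu> c) \<and> (\<forall>x\<in>fst c. cmod (\<mu> c x) < 1)) \<and>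
     (\<forall>c\<in>A. \<forall>d\<in>A. \<forall>x\<in>fst c \<inter> fst d.
        \<mu> c x = \<mu> d x * cnj (trans_deriv c d x) / trans_deriv c d x)}"

text \<open>\<open>\<nu>\<close> is the complex structure \<open>\<mu>\<close> pulled back along \<open>f\<close>: if \<open>w\<close> is holomorphic for \<open>\<mu>\<close>, then
  \<open>w \<circ> f\<close> is holomorphic for \<open>\<nu>\<close>. With \<open>F\<close> the local expression of \<open>f\<close>, the formula is
  \<open>\<nu> = \<partial>\<^sub>\<bar>z (w \<circ> F) / \<partial>\<^sub>z (w \<circ> F)\<close>.\<close>

definition beltrami_pullback ::
    "'a cchart set \<Rightarrow> ('a \<Rightarrow> 'a) \<Rightarrow> ('a cchart \<Rightarrow> 'a \<Rightarrow> complex) \<Rightarrow> ('a cchart \<Rightarrow> 'a \<Rightarrow> complex) \<Rightarrow> bool" where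
  "beltrami_pullback A f \<mu> \<nu> \<longleftrightarrow>
     (\<forall>c\<in>A. \<forall>d\<in>A. \<forall>x\<in>fst c. f x \<in> fst d \<longrightarrow>
        (let F = snd d \<circ> f \<circ> param c;
             a = wirt (\<lambda>w. w) F (snd c x);
             b = wirt_bar (\<lambda>w. w) F (snd c x);
             m = \<mu> d (f x)
         in \<nu> c x = (b + m * cnj a) / (a + m * cnj b)))"

definition teichmueller_rel :: "'a cchart set \<Rightarrow> ('a cchart \<Rightarrow> 'a \<Rightarrow> complex) rel" where
  "teichmueller_rel A = {(\<mu>, \<nu>). \<mu> \<in> beltrami_differentials A \<and> \<nu> \<in> beltrami_differentials A \<and>
     (\<exists>f\<in>diffeos_isotopic_to_id A. beltrami_pullback A f \<mu> \<nu>)}"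

definition teichmueller_space :: "'a cchart set \<Rightarrow> ('a cchart \<Rightarrow> 'a \<Rightarrow> complex) set set" where
  "teichmueller_space A = beltrami_differentials A // teichmueller_rel A"


section \<open>The cotangent bundle\<close>

text \<open>A real covector \<open>p dz + \<bar>p d\<bar>z\<close> at \<open>x\<close> is given by the family of its coordinates \<open>p\<close> in the
  charts around \<open>x\<close>, set to \<open>0\<close> for all other charts.\<close>

type_synonym 'a covector = "'a \<times> ('a cchart \<Rightarrow> complex)"

definition cotangent :: "'a cchart set \<Rightarrow> 'a covector set" where
  "cotangent A = {(x, \<xi>).
     (\<forall>c. c \<notin> A \<or> x \<notin> fst c \<longrightarrow> \<xi> c = 0) \<and>
     (\<forall>c\<in>A. \<forall>d\<in>A. x \<in> fst c \<inter> fst d \<longrightarrow> \<xi> c = trans_deriv c d x * \<xi> d)}"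

definition cot_chart :: "'a cchart set \<Rightarrow> 'a cchart \<Rightarrow> ('a covector, complex \<times> complex) chart" where
  "cot_chart A c = ({m \<in> cotangent A. fst m \<in> fst c}, \<lambda>(x, \<xi>). (snd c x, \<xi> c))"

definition cot_atlas :: "'a cchart set \<Rightarrow> ('a covector, complex \<times> complex) chart set" where
  "cot_atlas A = cot_chart A ` A"

definition zero_section :: "'a cchart set \<Rightarrow> 'a covector set" where
  "zero_section A = {m \<in> cotangent A. snd m = (\<lambda>c. 0)}"


section \<open>Higher diffeomorphisms\<close>

definition poisson ::
    "(complex \<times> complex \<Rightarrow> complex) \<Rightarrow> (complex \<times> complex \<Rightarrow> complex) \<Rightarrow> complex \<times> complex \<Rightarrow> complex" where
  "poisson H f q =
     wirt p_dir H q * wirt z_dir f q - wirt z_dir H q * wirt p_dir f q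
     + wirt_bar p_dir H q * wirt_bar z_dir f q - wirt_bar z_dir H q * wirt_bar p_dir f q"

text \<open>\<open>\<Phi>\<close> is the flow of the time-dependent real Hamiltonian \<open>H\<close>: the coordinate functions \<open>z\<close> and
  \<open>p\<close> evolve along it by \<open>f' = {H\<^sub>t, f}\<close>.\<close>

definition hamiltonian_isotopy ::
    "'a cchart set \<Rightarrow> (real \<Rightarrow> 'a covector \<Rightarrow> real) \<Rightarrow> (real \<Rightarrow> 'a covector \<Rightarrow> 'a covector) \<Rightarrow> bool" where
  "hamiltonian_isotopy A H \<Phi> \<longleftrightarrow>
     isotopy (cot_atlas A) \<Phi> \<and>
     smooth_map (time_atlas (cot_atlas A)) vector_atlas (\<lambda>(t, m). H t m) \<and>
     (\<forall>t. \<forall>C\<in>cot_atlas A. \<forall>m\<in>cotangent A. \<Phi> t m \<in> fst C \<longrightarrow>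
        (let K = complex_of_real \<circ> H t \<circ> param C; q = snd C (\<Phi> t m)
         in ((\<lambda>s. snd C (\<Phi> s m)) has_vector_derivative (poisson K fst q, poisson K snd q)) (at t)))"

text \<open>The group \<open>Symp\<^sub>0(T\<^sup>*\<Sigma>)\<close>. The flow, and not just its time-one map, is required to preserve the
  zero-section; equivalently each \<open>H\<^sub>t\<close> is constant on the zero-section, so that after subtracting a
  function of \<open>t\<close> the Hamiltonians are those vanishing on the zero-section.\<close>

definition higher_diffeos :: "'a cchart set \<Rightarrow> ('a covector \<Rightarrow> 'a covector) set" where
  "higher_diffeos A = {\<Phi> 1 | \<Phi>. (\<exists>H. hamiltonian_isotopy A H \<Phi>) \<and>
     (\<forall>t. \<Phi> t ` zero_section A = zero_section A)}"


section \<open>Punctual Hilbert schemes\<close>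

text \<open>\<open>\<complex>[p, \<bar>p]\<close> is the type \<open>complex poly poly\<close>, polynomials in \<open>\<bar>p\<close> over \<open>\<complex>[p]\<close>. Ideals of a
  commutative ring are its submodules.\<close>

abbreviation is_ideal :: "'r::comm_ring_1 set \<Rightarrow> bool" where
  "is_ideal \<equiv> module.subspace (*)"

abbreviation ideal_gen :: "'r::comm_ring_1 set \<Rightarrow> 'r set" where
  "ideal_gen \<equiv> module.span (*)"

definition pvar :: "complex poly poly" where
  "pvar = [:[:0, 1:]:]"

definition pbar :: "complex poly poly" where
  "pbar = [:0, 1:]"

definition const2 :: "complex \<Rightarrow> complex poly poly" where
  "const2 a = [:[:a:]:]"

definition eval2 :: "complex poly poly \<Rightarrow> complex \<Rightarrow> complex \<Rightarrow> complex" where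
  "eval2 f a b = poly (poly f [:b:]) a"

text \<open>\<open>f(a p, b \<bar>p)\<close>\<close>

definition scale2 :: "complex \<Rightarrow> complex \<Rightarrow> complex poly poly \<Rightarrow> complex poly poly" where
  "scale2 a b f = pcompose (map_poly (\<lambda>q. pcompose q [:0, a:]) f) [:0, [:b:]:]"

text \<open>Complex conjugation: \<open>\<Sum> a\<^sub>i\<^sub>j p\<^sup>j \<bar>p\<^sup>i\<close> becomes \<open>\<Sum> cnj a\<^sub>i\<^sub>j p\<^sup>i \<bar>p\<^sup>j\<close>.\<close>

definition conj2 :: "complex poly poly \<Rightarrow> complex poly poly" where
  "conj2 f = (\<Sum>i\<le>Polynomial.degree f. \<Sum>j\<le>Polynomial.degree (Polynomial.coeff f i).
     const2 (cnj (Polynomial.coeff (Polynomial.coeff f i) j)) * pvar ^ i * pbar ^ j)"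

text \<open>The classes of the elements of some \<open>n\<close>-element set \<open>B\<close> form a basis of \<open>\<complex>[p, \<bar>p] / I\<close>.\<close>

definition codimension :: "complex poly poly set \<Rightarrow> nat \<Rightarrow> bool" where
  "codimension I n \<longleftrightarrow> (\<exists>B. finite B \<and> card B = n \<and>
     (\<forall>f. \<exists>!a. (\<forall>b. b \<notin> B \<longrightarrow> a b = 0) \<and> f - (\<Sum>b\<in>B. const2 (a b) * b) \<in> I))"

definition supported_at_origin :: "complex poly poly set \<Rightarrow> bool" where
  "supported_at_origin I \<longleftrightarrow> {(a, b). \<forall>f\<in>I. eval2 f a b = 0} = {(0, 0)}"

definition hilb0 :: "nat \<Rightarrow> complex poly poly set set" where
  "hilb0 n = {I. is_ideal I \<and> codimension I n \<and> supported_at_origin I}"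


section \<open>Higher complex structures\<close>

text \<open>A section of \<open>Hilb\<^sup>n\<^sub>0(T\<^sup>*\<^sup>\<complex>\<Sigma>)\<close> assigns to every chart and every point of its domain an ideal
  in the linear fibre coordinates \<open>p, \<bar>p\<close> of that chart; where the chart is not defined, the value
  is set to the empty set. Under a change of charts, \<open>p\<^sub>d = (dz\<^sub>c/dz\<^sub>d) p\<^sub>c\<close>.\<close>

type_synonym 'a ideal_field = "'a cchart \<Rightarrow> 'a \<Rightarrow> complex poly poly set"

definition hilb_sections :: "'a cchart set \<Rightarrow> nat \<Rightarrow> 'a ideal_field set" where
  "hilb_sections A n = {I.
     (\<forall>c x. c \<notin> A \<or> x \<notin> fst c \<longrightarrow> I c x = {}) \<and>
     (\<forall>c\<in>A. \<forall>x\<in>fst c. I c x \<in> hilb0 n) \<and>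
     (\<forall>c\<in>A. \<forall>d\<in>A. \<forall>x\<in>fst c \<inter> fst d.
        I c x = scale2 (trans_deriv d c x) (cnj (trans_deriv d c x)) ` I d x)}"

definition n_complex_structures :: "'a cchart set \<Rightarrow> nat \<Rightarrow> 'a ideal_field set" where
  "n_complex_structures A n = {I \<in> hilb_sections A n.
     \<forall>c\<in>A. \<forall>x\<in>fst c. {f + conj2 g | f g. f \<in> I c x \<and> g \<in> I c x} = ideal_gen {pvar, pbar}}"

text \<open>The coefficients \<open>\<mu>\<^sub>2, \<dots>, \<mu>\<^sub>n\<close> are coordinates on the open set of ideals of the displayed form,
  so their smoothness is the smoothness of the section.\<close>

definition compatible_structures :: "'a cchart set \<Rightarrow> nat \<Rightarrow> 'a ideal_field set" where
  "compatible_structures A n = {I \<in> n_complex_structures A n.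
     \<forall>c\<in>A. \<exists>\<mu> :: nat \<Rightarrow> 'a \<Rightarrow> complex.
       (\<forall>k\<in>{2..n}. smooth_coeff c (\<mu> k)) \<and>
       (\<forall>x\<in>fst c. cmod (\<mu> 2 x) < 1 \<and>
          I c x = ideal_gen {pvar ^ n, - pbar + (\<Sum>k=2..n. const2 (\<mu> k x) * pvar ^ (k - 1))})}"

text \<open>The Taylor polynomial of degree \<open>n - 1\<close> along the fibre at the zero-section, for a function of
  \<open>(z, p)\<close>.\<close>

definition fibre_jet :: "nat \<Rightarrow> (complex \<times> complex \<Rightarrow> complex) \<Rightarrow> complex \<Rightarrow> complex poly poly" where
  "fibre_jet n G z = (\<Sum>(k, l)\<in>{(k, l). k + l < n}.
     const2 ((wirt p_dir ^^ k) ((wirt_bar p_dir ^^ l) G) (z, 0) / (fact k * fact l)) * pvar ^ k * pbar ^ l)"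

text \<open>The smooth functions on \<open>T\<^sup>*\<Sigma>\<close> whose restrictions to the fibres lie in \<open>I\<close>. An ideal of
  codimension \<open>n\<close> supported at the origin contains all monomials of degree at least \<open>n\<close>, so Taylor
  polynomials of degree \<open>n - 1\<close> suffice.\<close>

definition ideal_functions :: "'a cchart set \<Rightarrow> nat \<Rightarrow> 'a ideal_field \<Rightarrow> ('a covector \<Rightarrow> complex) set" where
  "ideal_functions A n I = {f. smooth_map (cot_atlas A) vector_atlas f \<and>
     (\<forall>c\<in>A. \<forall>x\<in>fst c. fibre_jet n (f \<circ> param (cot_chart A c)) (snd c x) \<in> I c x)}"

text \<open>\<open>J\<close> is obtained from \<open>I\<close> by the action of \<open>\<phi>\<close>: the functions in \<open>J\<close> are the \<open>f \<circ> \<phi>\<close> with \<open>f\<close>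
  in \<open>I\<close>. Along the flow of \<open>H\<close> the derivative of \<open>f \<circ> \<Phi>\<^sub>\<epsilon>\<close> at \<open>\<epsilon> = 0\<close> is \<open>{H, f}\<close>, so this
  integrates the infinitesimal action \<open>f \<mapsto> f + \<epsilon> {H, f} mod I\<close>.\<close>

definition acts_to ::
    "'a cchart set \<Rightarrow> nat \<Rightarrow> ('a covector \<Rightarrow> 'a covector) \<Rightarrow> 'a ideal_field \<Rightarrow> 'a ideal_field \<Rightarrow> bool" where
  "acts_to A n \<phi> I J \<longleftrightarrow>
     (\<forall>f. smooth_map (cot_atlas A) vector_atlas f \<longrightarrow>
        (f \<in> ideal_functions A n I \<longleftrightarrow> f \<circ> \<phi> \<in> ideal_functions A n J))"

definition moduli_rel :: "'a cchart set \<Rightarrow> nat \<Rightarrow> 'a ideal_field rel" where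
  "moduli_rel A n = {(I, J). I \<in> compatible_structures A n \<and> J \<in> compatible_structures A n \<and>
     (\<exists>\<phi>\<in>higher_diffeos A. acts_to A n \<phi> I J)}"

definition moduli_space :: "'a cchart set \<Rightarrow> nat \<Rightarrow> 'a ideal_field set set" where
  "moduli_space A n = compatible_structures A n // moduli_rel A n"

end

theory Submission
  imports Defs "HOL-Complex_Analysis.Complex_Analysis"
begin

text \<open>A Beltrami differential \<open>\<mu>\<close> yields the compatible structure \<open>I\<^sub>\<mu> = \<langle>p\<^sup>n, -\<bar>p + \<mu> p\<rangle>\<close>. If a higher
  diffeomorphism \<open>\<phi>\<close> takes \<open>I\<^sub>\<mu>\<close> to \<open>I\<^sub>\<nu>\<close>, its restriction \<open>f\<close> to the zero-section is isotopic to the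
  identity, and since \<open>\<phi>\<close> is symplectic and preserves the zero-section, it acts on fibre coordinates to
  first order as the inverse transpose of \<open>df\<close>. Comparing the linear parts of \<open>I\<^sub>\<mu>\<close> and \<open>I\<^sub>\<nu>\<close> shows
  that \<open>\<nu>\<close> is the pullback of \<open>\<mu>\<close> along \<open>f\<close>. Hence choosing a representative \<open>\<mu>\<close> in each
  Teichmueller class and taking the class of \<open>I\<^sub>\<mu>\<close> is injective; no lifting of isotopies to the
  cotangent bundle is needed. That the Teichmueller relation is symmetric and transitive relies on
  diffeomorphisms isotopic to the identity preserving orientation: otherwise the denominator of the
  pullback formula could vanish.\<close>

section \<open>Smooth calculus\<close>

text \<open>The obstacle is that \<open>acts_to\<close> speaks of globally defined functions,
  whereas \<mu> and \<nu> have to be compared point by point. A bump function bridges the two: it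
  extends a local multiple of the generator \<open>- pbar + const2 m * pvar\<close> to a global
  function of the ideal that is real-linear along the fibres. Composed with a higher diffeomorphism,
  its fibre derivatives at the zero-section see only the p-component w \<mapsto> \<alpha> w +
  \<beta> cnj w of the fibre derivative, and the coefficient of p on the line pbar = \<nu> p gives
  one equation between \<alpha>, \<beta>, \<mu> and \<nu>. The other relation, between \<alpha>,
  \<beta> and the derivative of the base map, is the invariance of the symplectic form, tested on
  one vertical and one horizontal vector. It is derived in charts from Hamilton's equations: along
  the flow the form has derivative zero because the Hessian of the Hamiltonian is symmetric. Since a
  trajectory may leave every chart, the target chart has to change along the way; this is harmless
  because cotangent lifts of holomorphic transitions preserve the form.\<close>

lemma Ck_on_cong:
  assumes "open S" "\<And>x. x \<in> S \<Longrightarrow> f x = g x" "Ck_on k S f"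
  shows "Ck_on k S g"
  using assms(2,3)
proof (induction k arbitrary: f g)
  case 0
  then show ?case by (simp cong: continuous_on_cong)
next
  case (Suc k)
  have *: "frechet_derivative f (at x) = frechet_derivative g (at x)" if "x \<in> S" for x
    using Suc.prems that \<open>open S\<close> by (intro frechet_derivative_transform_within_open[of _ _ S]) auto
  have "g differentiable (at x)" if "x \<in> S" for x
    using Suc.prems that \<open>open S\<close>
    by (metis Ck_on.simps(2) differentiable_def has_derivative_transform_within_open)
  with Suc.prems(2) * show ?case
    by (auto intro: Suc.IH[of "\<lambda>x. frechet_derivative f (at x) v" "\<lambda>x. frechet_derivative g (at x) v" for v])
qed

text \<open>\<open>frechet_derivative\<close> is a choice operator. Here any known derivative may
  replace it, so the inductions below can work with explicit derivative formulas.\<close>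

lemma Ck_on_SucI:
  assumes "open S" "\<And>x. x \<in> S \<Longrightarrow> (f has_derivative f' x) (at x)" "\<And>v. Ck_on k S (\<lambda>x. f' x v)"
  shows "Ck_on (Suc k) S f"
proof -
  have "Ck_on k S (\<lambda>x. frechet_derivative f (at x) v)" for v
    using assms(3) by (rule Ck_on_cong[OF assms(1), rotated]) (simp add: frechet_derivative_at[OF assms(2), symmetric])
  with assms(2) show ?thesis by (auto simp: differentiable_def)
qed

lemma Ck_on_subset: "Ck_on k S f \<Longrightarrow> T \<subseteq> S \<Longrightarrow> Ck_on k T f"
  by (induction k arbitrary: f) (auto intro: continuous_on_subset)

lemma Ck_on_Suc_imp: "Ck_on (Suc k) S f \<Longrightarrow> Ck_on k S f"
proof (induction k arbitrary: f)
  case 0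
  then show ?case
    by (auto intro!: continuous_at_imp_continuous_on differentiable_imp_continuous_within)
next
  case (Suc k)
  then show ?case by (metis Ck_on.simps(2))
qed

text \<open>Every clause of \<open>Ck_on\<close> can be tested on an open neighbourhood of each
  point. This allows smoothness to be proved chart by chart, or separately on overlapping pieces of
  one chart.\<close>

lemma Ck_on_local:
  assumes "\<And>x. x \<in> S \<Longrightarrow> \<exists>U. open U \<and> x \<in> U \<and> Ck_on k U f"
  shows "Ck_on k S f"
  using assms
proof (induction k arbitrary: f)
  case 0
  then show ?case
    by (metis Ck_on.simps(1) continuous_at_imp_continuous_on continuous_on_eq_continuous_at)
next
  case (Suc k)
  show ?case
    unfolding Ck_on.simps
  proof (intro conjI ballI allI)
    fix x assume "x \<in> S"
    then show "f differentiable (at x)" using Suc.prems by force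
  next
    fix v show "Ck_on k S (\<lambda>x. frechet_derivative f (at x) v)"
      using Suc.prems by (intro Suc.IH) (metis Ck_on.simps(2))
  qed
qed

lemma Ck_on_const: "open S \<Longrightarrow> Ck_on k S (\<lambda>x. c)"
proof (induction k arbitrary: c)
  case (Suc k)
  then show ?case by (intro Ck_on_SucI[OF _ has_derivative_const]) auto
qed simp

lemma Ck_on_linear_compose:
  assumes "bounded_linear h" "open S" "Ck_on k S f"
  shows "Ck_on k S (\<lambda>x. h (f x))"
  using assms(3)
proof (induction k arbitrary: f)
  case 0
  then show ?case using assms(1) by (auto intro: bounded_linear.continuous_on)
next
  case (Suc k)
  show ?case
  proof (rule Ck_on_SucI[OF \<open>open S\<close>])
    fix x assume "x \<in> S"
    then have "(f has_derivative frechet_derivative f (at x)) (at x)"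
      using Suc.prems by (auto intro: frechet_derivative_works[THEN iffD1])
    then show "((\<lambda>x. h (f x)) has_derivative (\<lambda>v. h (frechet_derivative f (at x) v))) (at x)"
      using assms(1) by (rule bounded_linear.has_derivative[rotated])
  qed (use Suc in auto)
qed

lemma Ck_on_linear: "bounded_linear h \<Longrightarrow> open S \<Longrightarrow> Ck_on k S h"
proof (cases k)
  case (Suc j)
  assume "bounded_linear h" "open S"
  then show ?thesis unfolding Suc
    by (intro Ck_on_SucI[where f' = "\<lambda>_. h"] Ck_on_const bounded_linear_imp_has_derivative)
qed (simp add: linear_continuous_on)

lemma Ck_on_add:
  assumes "open S" "Ck_on k S f" "Ck_on k S g"
  shows "Ck_on k S (\<lambda>x. f x + g x)"
  using assms(2,3)
proof (induction k arbitrary: f g)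
  case 0
  then show ?case by (auto intro: continuous_on_add)
next
  case (Suc k)
  show ?case
    by (rule Ck_on_SucI[OF \<open>open S\<close> has_derivative_add[OF
        frechet_derivative_works[THEN iffD1] frechet_derivative_works[THEN iffD1]]])
      (use Suc in auto)
qed

lemma Ck_on_sum:
  assumes "open S" "\<And>i. i \<in> I \<Longrightarrow> Ck_on k S (f i)"
  shows "Ck_on k S (\<lambda>x. \<Sum>i\<in>I. f i x)"
proof (cases "finite I")
  case True
  then show ?thesis using assms(2)
    by (induction I) (auto intro!: Ck_on_add Ck_on_const assms(1))
qed (auto intro: Ck_on_const assms(1))

lemma Ck_on_bilinear:
  assumes "bounded_bilinear h" "open S" "Ck_on k S f" "Ck_on k S g"
  shows "Ck_on k S (\<lambda>x. h (f x) (g x))"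
  using assms(3,4)
proof (induction k arbitrary: f g)
  case 0
  then show ?case using assms(1) by (auto intro: bounded_bilinear.continuous_on)
next
  case (Suc k)
  show ?case
  proof (rule Ck_on_SucI[OF \<open>open S\<close>])
    fix x assume "x \<in> S"
    then have "(f has_derivative frechet_derivative f (at x)) (at x)"
      "(g has_derivative frechet_derivative g (at x)) (at x)"
      using Suc.prems by (auto intro: frechet_derivative_works[THEN iffD1])
    then show "((\<lambda>x. h (f x) (g x)) has_derivative
       (\<lambda>v. h (f x) (frechet_derivative g (at x) v) + h (frechet_derivative f (at x) v) (g x))) (at x)"
      by (rule bounded_bilinear.FDERIV[OF assms(1)])
  qed (use Suc Ck_on_Suc_imp[OF Suc.prems(1)] Ck_on_Suc_imp[OF Suc.prems(2)] in \<open>auto intro!: Ck_on_add \<open>open S\<close>\<close>)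
qed

lemma Ck_on_compose:
  fixes f :: "'a::real_normed_vector \<Rightarrow> 'b::euclidean_space" and g :: "'b \<Rightarrow> 'c::real_normed_vector"
  assumes "open S" "Ck_on k S f" "Ck_on k T g" "f ` S \<subseteq> T"
  shows "Ck_on k S (\<lambda>x. g (f x))"
  using assms(2-)
proof (induction k arbitrary: g)
  case 0
  then show ?case by (auto intro: continuous_on_compose2)
next
  case (Suc k)
  let ?Df = "\<lambda>x. frechet_derivative f (at x)" and ?Dg = "\<lambda>y. frechet_derivative g (at y)"
  have f: "Ck_on k S f" using Suc.prems(1) by (rule Ck_on_Suc_imp)
  have Dg: "(g has_derivative ?Dg (f x)) (at (f x))" if "x \<in> S" for x
    using that Suc.prems(2,3) frechet_derivative_works by (metis Ck_on.simps(2) image_subset_iff)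
  show ?case
  proof (rule Ck_on_SucI[OF \<open>open S\<close>])
    fix x assume "x \<in> S"
    then have "(f has_derivative ?Df x) (at x)"
      using Suc.prems by (auto intro: frechet_derivative_works[THEN iffD1])
    from has_derivative_compose[OF this Dg[OF \<open>x \<in> S\<close>]]
    show "((\<lambda>x. g (f x)) has_derivative (\<lambda>v. ?Dg (f x) (?Df x v))) (at x)" .
  next
    fix v
    \<comment> \<open>\<open>Ck_on\<close> differentiates in fixed directions, but in the chain rule
      the direction \<open>?Df x v\<close> moves with x. Expanding it in a basis leaves derivatives
      of g in fixed directions with smooth coefficients; this is why the middle space is
      Euclidean.\<close>
    have "Ck_on k S (\<lambda>x. \<Sum>b\<in>Basis. (?Df x v \<bullet> b) *\<^sub>R ?Dg (f x) b)"
    proof (intro Ck_on_sum \<open>open S\<close> Ck_on_bilinear[OF bounded_bilinear_scaleR])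
      fix b :: 'b assume "b \<in> Basis"
      show "Ck_on k S (\<lambda>x. ?Df x v \<bullet> b)"
        using Suc.prems(1) by (intro Ck_on_linear_compose[OF bounded_linear_inner_left \<open>open S\<close>]) auto
      show "Ck_on k S (\<lambda>x. ?Dg (f x) b)"
        using Suc.IH[OF f, of "\<lambda>y. ?Dg y b"] Suc.prems by simp
    qed
    then show "Ck_on k S (\<lambda>x. ?Dg (f x) (?Df x v))"
    proof (rule Ck_on_cong[OF \<open>open S\<close>, rotated])
      fix x assume "x \<in> S"
      then have lin: "linear (?Dg (f x))" using Dg has_derivative_linear by blast
      have "?Dg (f x) (?Df x v) = ?Dg (f x) (\<Sum>b\<in>Basis. (?Df x v \<bullet> b) *\<^sub>R b)"
        by (simp add: euclidean_representation)
      then show "(\<Sum>b\<in>Basis. (?Df x v \<bullet> b) *\<^sub>R ?Dg (f x) b) = ?Dg (f x) (?Df x v)"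
        by (simp add: linear_sum[OF lin] linear_cmul[OF lin])
    qed
  qed
qed

lemma Ck_on_holomorphic:
  assumes "open S" "f holomorphic_on S"
  shows "Ck_on k S f"
  using assms(2)
proof (induction k arbitrary: f)
  case 0
  then show ?case by (simp add: holomorphic_on_imp_continuous_on)
next
  case (Suc k)
  show ?case
  proof (rule Ck_on_SucI[OF \<open>open S\<close>])
    fix x assume "x \<in> S"
    then show "(f has_derivative (\<lambda>v. deriv f x * v)) (at x)"
      using Suc.prems \<open>open S\<close> holomorphic_derivI has_field_derivative_def by fastforce
  next
    fix v show "Ck_on k S (\<lambda>x. deriv f x * v)"
      using Suc.IH[OF holomorphic_deriv[OF Suc.prems \<open>open S\<close>]] \<open>open S\<close>
      by (intro Ck_on_linear_compose[OF bounded_linear_mult_left])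
  qed
qed

lemma smooth_on_cong: "open S \<Longrightarrow> (\<And>x. x \<in> S \<Longrightarrow> f x = g x) \<Longrightarrow> smooth_on S f \<Longrightarrow> smooth_on S g"
  unfolding smooth_on_def using Ck_on_cong by blast

lemma smooth_on_subset: "smooth_on S f \<Longrightarrow> T \<subseteq> S \<Longrightarrow> smooth_on T f"
  unfolding smooth_on_def using Ck_on_subset by blast

lemma smooth_on_local:
  assumes "\<And>x. x \<in> S \<Longrightarrow> \<exists>U. open U \<and> x \<in> U \<and> smooth_on U f"
  shows "smooth_on S f"
  unfolding smooth_on_def
proof (intro allI Ck_on_local)
  fix k x assume "x \<in> S"
  then show "\<exists>U. open U \<and> x \<in> U \<and> Ck_on k U f"
    using assms by (metis smooth_on_def)
qed

lemma smooth_on_const: "open S \<Longrightarrow> smooth_on S (\<lambda>x. c)"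
  by (simp add: smooth_on_def Ck_on_const)

lemma smooth_on_linear_compose:
  "bounded_linear h \<Longrightarrow> open S \<Longrightarrow> smooth_on S f \<Longrightarrow> smooth_on S (\<lambda>x. h (f x))"
  by (simp add: smooth_on_def Ck_on_linear_compose)

lemma smooth_on_linear: "bounded_linear h \<Longrightarrow> open S \<Longrightarrow> smooth_on S h"
  by (simp add: smooth_on_def Ck_on_linear)

lemma smooth_on_add: "open S \<Longrightarrow> smooth_on S f \<Longrightarrow> smooth_on S g \<Longrightarrow> smooth_on S (\<lambda>x. f x + g x)"
  by (simp add: smooth_on_def Ck_on_add)

lemma smooth_on_bilinear:
  "bounded_bilinear h \<Longrightarrow> open S \<Longrightarrow> smooth_on S f \<Longrightarrow> smooth_on S g \<Longrightarrow> smooth_on S (\<lambda>x. h (f x) (g x))"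
  by (simp add: smooth_on_def Ck_on_bilinear)

lemmas smooth_on_mult = smooth_on_bilinear[OF bounded_bilinear_mult]

lemma smooth_on_minus: "open S \<Longrightarrow> smooth_on S f \<Longrightarrow> smooth_on S (\<lambda>x. - f x)"
  by (intro smooth_on_linear_compose[OF bounded_linear_minus[OF bounded_linear_ident]])

lemma smooth_on_Pair:
  assumes "open S" "smooth_on S f" "smooth_on S g"
  shows "smooth_on S (\<lambda>x. (f x, g x))"
proof -
  have 1: "bounded_linear (\<lambda>u. (u, 0))" "bounded_linear (\<lambda>u. (0, u))"
    by (intro bounded_linear_Pair bounded_linear_ident bounded_linear_zero)+
  show ?thesis
    using smooth_on_add[OF assms(1) smooth_on_linear_compose[OF 1(1) assms(1,2)] smooth_on_linear_compose[OF 1(2) assms(1,3)]]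
    by simp
qed

lemma smooth_on_compose:
  fixes f :: "'a::real_normed_vector \<Rightarrow> 'b::euclidean_space" and g :: "'b \<Rightarrow> 'c::real_normed_vector"
  assumes "open S" "smooth_on S f" "smooth_on T g" "f ` S \<subseteq> T"
  shows "smooth_on S (\<lambda>x. g (f x))"
  using assms unfolding smooth_on_def by (blast intro: Ck_on_compose)

lemma smooth_on_holomorphic: "open S \<Longrightarrow> f holomorphic_on S \<Longrightarrow> smooth_on S f"
  by (simp add: smooth_on_def Ck_on_holomorphic)

lemma smooth_on_imp_continuous_on: "smooth_on S f \<Longrightarrow> continuous_on S f"
  unfolding smooth_on_def by (drule spec[of _ 0]) simp

lemma smooth_on_Suc: "smooth_on S f \<Longrightarrow> Ck_on (Suc k) S f"
  unfolding smooth_on_def by blast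

lemma smooth_on_imp_differentiable: "smooth_on S f \<Longrightarrow> x \<in> S \<Longrightarrow> f differentiable (at x)"
  using smooth_on_Suc[of S f 0] by simp

lemma smooth_on_imp_has_derivative:
  "smooth_on S f \<Longrightarrow> x \<in> S \<Longrightarrow> (f has_derivative frechet_derivative f (at x)) (at x)"
  using smooth_on_imp_differentiable frechet_derivative_works by blast

lemma smooth_on_frechet_derivative:
  assumes "smooth_on S f"
  shows "smooth_on S (\<lambda>x. frechet_derivative f (at x) v)"
  using smooth_on_Suc[OF assms] by (simp add: smooth_on_def)

section \<open>Symmetry of mixed second derivatives\<close>

text \<open>Both iterated derivatives are limits of the same second difference quotient.\<close>

lemma second_difference_eq:
  fixes f :: "'a::real_normed_vector \<Rightarrow> real"
  assumes f: "\<And>x. x \<in> S \<Longrightarrow> (f has_derivative f' x) (at x)"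
    and f': "\<And>x. x \<in> S \<Longrightarrow> ((\<lambda>x. f' x u) has_derivative f'' x) (at x)"
    and h: "0 < h"
    and S: "\<And>s t. 0 \<le> s \<Longrightarrow> s \<le> h \<Longrightarrow> 0 \<le> t \<Longrightarrow> t \<le> h \<Longrightarrow> x + s *\<^sub>R u + t *\<^sub>R v \<in> S"
  shows "\<exists>s t. 0 < s \<and> s < h \<and> 0 < t \<and> t < h \<and>
    f (x + h *\<^sub>R u + h *\<^sub>R v) - f (x + h *\<^sub>R u) - f (x + h *\<^sub>R v) + f x
      = h * h * f'' (x + s *\<^sub>R u + t *\<^sub>R v) v"
proof -
  let ?\<phi> = "\<lambda>s. f (x + s *\<^sub>R u + h *\<^sub>R v) - f (x + s *\<^sub>R u)"
  have D: "((\<lambda>s. f (x + s *\<^sub>R u + t *\<^sub>R v)) has_real_derivative f' (x + s *\<^sub>R u + t *\<^sub>R v) u) (at s)"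
    if "0 \<le> s" "s \<le> h" "0 \<le> t" "t \<le> h" for s t
  proof -
    note d = f[OF S[OF that]]
    have "((\<lambda>s. f (x + s *\<^sub>R u + t *\<^sub>R v)) has_derivative (\<lambda>r. f' (x + s *\<^sub>R u + t *\<^sub>R v) (r *\<^sub>R u))) (at s)"
      by (rule has_derivative_compose[where f = "\<lambda>s. x + s *\<^sub>R u + t *\<^sub>R v", OF _ d])
        (auto intro!: derivative_eq_intros)
    then show ?thesis
      by (rule has_derivative_imp_has_field_derivative)
        (simp add: linear_cmul[OF has_derivative_linear[OF d]] mult.commute)
  qed
  \<comment> \<open>The mean value theorem in direction u is applied to the increment of f in
    direction v; with s fixed it is then applied once more, in direction v.\<close>
  have "\<exists>s. 0 < s \<and> s < h \<and> ?\<phi> h - ?\<phi> 0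
      = (h - 0) * (f' (x + s *\<^sub>R u + h *\<^sub>R v) u - f' (x + s *\<^sub>R u) u)"
    by (rule MVT2[OF h]) (use D[of _ h] D[of _ 0] h in \<open>auto intro!: derivative_intros\<close>)
  then obtain s where s: "0 < s" "s < h" and
    1: "?\<phi> h - ?\<phi> 0 = h * (f' (x + s *\<^sub>R u + h *\<^sub>R v) u - f' (x + s *\<^sub>R u) u)" by auto
  let ?\<psi> = "\<lambda>t. f' (x + s *\<^sub>R u + t *\<^sub>R v) u"
  have D': "(?\<psi> has_real_derivative f'' (x + s *\<^sub>R u + t *\<^sub>R v) v) (at t)"
    if "0 \<le> t" "t \<le> h" for t
  proof -
    have "x + s *\<^sub>R u + t *\<^sub>R v \<in> S" using S s that by auto
    note d = f'[OF this]
    have "(?\<psi> has_derivative (\<lambda>r. f'' (x + s *\<^sub>R u + t *\<^sub>R v) (r *\<^sub>R v))) (at t)"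
      by (rule has_derivative_compose[where f = "\<lambda>t. x + s *\<^sub>R u + t *\<^sub>R v", OF _ d])
        (auto intro!: derivative_eq_intros)
    then show ?thesis
      by (rule has_derivative_imp_has_field_derivative)
        (simp add: linear_cmul[OF has_derivative_linear[OF d]] mult.commute)
  qed
  have "\<exists>t. 0 < t \<and> t < h \<and> ?\<psi> h - ?\<psi> 0 = (h - 0) * f'' (x + s *\<^sub>R u + t *\<^sub>R v) v"
    by (rule MVT2[OF h]) (use D' in auto)
  then obtain t where t: "0 < t" "t < h" and 2: "?\<psi> h - ?\<psi> 0 = h * f'' (x + s *\<^sub>R u + t *\<^sub>R v) v"
    by auto
  have "f (x + h *\<^sub>R u + h *\<^sub>R v) - f (x + h *\<^sub>R u) - f (x + h *\<^sub>R v) + f x = ?\<phi> h - ?\<phi> 0" by simp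
  also have "\<dots> = h * (?\<psi> h - ?\<psi> 0)" using 1 by simp
  also have "\<dots> = h * h * f'' (x + s *\<^sub>R u + t *\<^sub>R v) v" by (simp only: 2 mult.assoc)
  finally show ?thesis using s t by blast
qed

lemma smooth_on_mixed_derivative_real:
  fixes f :: "'a::real_normed_vector \<Rightarrow> real"
  assumes S: "open S" "x \<in> S" and f: "smooth_on S f"
  shows "frechet_derivative (\<lambda>y. frechet_derivative f (at y) u) (at x) v
       = frechet_derivative (\<lambda>y. frechet_derivative f (at y) v) (at x) u"
proof -
  define D2 where "D2 = (\<lambda>u v y. frechet_derivative (\<lambda>y. frechet_derivative f (at y) u) (at y) v)"
  have cont: "continuous (at x) (D2 u v)" for u v
    using smooth_on_imp_continuous_on[OF smooth_on_frechet_derivative[OF smooth_on_frechet_derivative[OF f]]] S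
    by (auto simp: D2_def continuous_on_eq_continuous_at)
  obtain r where r: "r > 0" "ball x r \<subseteq> S" using S by (meson open_contains_ball)
  \<comment> \<open>A parallelogram with sides h u and h v stays within distance
    \<open>h * M\<close> of its corner x. The summand 1 keeps M positive when both vectors
    vanish.\<close>
  define M where "M = norm u + norm v + 1"
  have M: "M > 0" by (auto simp: M_def add_nonneg_pos)
  have near: "dist x (x + s *\<^sub>R u + t *\<^sub>R v) < e"
    if "0 \<le> s" "s \<le> h" "0 \<le> t" "t \<le> h" "h * M < e" "0 < h" for s t h e
  proof -
    have "dist x (x + s *\<^sub>R u + t *\<^sub>R v) = norm (s *\<^sub>R u + t *\<^sub>R v)"
      by (metis add.assoc add_diff_cancel_left' dist_commute dist_norm)
    also have "\<dots> \<le> s * norm u + t * norm v"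
      using that norm_triangle_ineq[of "s *\<^sub>R u" "t *\<^sub>R v"] by simp
    also have "\<dots> \<le> h * norm u + h * norm v" using that by (intro add_mono mult_right_mono) auto
    also have "\<dots> \<le> h * M" using that by (simp add: M_def algebra_simps)
    finally show ?thesis using that by simp
  qed
  have key: "\<bar>D2 u v x - D2 v u x\<bar> \<le> e" if "e > 0" for e
  proof -
    obtain d1 where d1: "d1 > 0" "\<And>y. dist y x < d1 \<Longrightarrow> dist (D2 u v y) (D2 u v x) < e / 2"
      using cont[of u v] \<open>e > 0\<close> unfolding continuous_at_eps_delta by (metis half_gt_zero)
    obtain d2 where d2: "d2 > 0" "\<And>y. dist y x < d2 \<Longrightarrow> dist (D2 v u y) (D2 v u x) < e / 2"
      using cont[of v u] \<open>e > 0\<close> unfolding continuous_at_eps_delta by (metis half_gt_zero)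
    \<comment> \<open>Distance below d keeps points inside S and both second derivatives within e /
      2 of their values at x; the choice of h below gives \<open>h * M = d / 2\<close>.\<close>
    define d where "d = Min {r, d1, d2}"
    have d: "d > 0" "d \<le> r" "d \<le> d1" "d \<le> d2" using r d1 d2 by (auto simp: d_def)
    define h where "h = d / (2 * M)"
    have h: "h > 0" "h * M < d" using d M by (auto simp: h_def)
    note fd = smooth_on_imp_has_derivative[OF f]
      smooth_on_imp_has_derivative[OF smooth_on_frechet_derivative[OF f]]
    have in_S: "x + s *\<^sub>R u + t *\<^sub>R v \<in> S" if "0 \<le> s" "s \<le> h" "0 \<le> t" "t \<le> h" for s t
      using near[OF that, of d] h d r by (auto simp: subset_iff)
    then have in_S': "x + s *\<^sub>R v + t *\<^sub>R u \<in> S" if "0 \<le> s" "s \<le> h" "0 \<le> t" "t \<le> h" for s t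
      using that by (metis add.assoc add.commute)
    obtain s t where st: "0 < s" "s < h" "0 < t" "t < h" and
      1: "f (x + h *\<^sub>R u + h *\<^sub>R v) - f (x + h *\<^sub>R u) - f (x + h *\<^sub>R v) + f x
        = h * h * D2 u v (x + s *\<^sub>R u + t *\<^sub>R v)"
      using second_difference_eq[of S f "\<lambda>y. frechet_derivative f (at y)" u
        "\<lambda>y. frechet_derivative (\<lambda>y. frechet_derivative f (at y) u) (at y)" h x v] fd h in_S
      unfolding D2_def by blast
    obtain s' t' where st': "0 < s'" "s' < h" "0 < t'" "t' < h" and
      2: "f (x + h *\<^sub>R v + h *\<^sub>R u) - f (x + h *\<^sub>R v) - f (x + h *\<^sub>R u) + f x
        = h * h * D2 v u (x + s' *\<^sub>R v + t' *\<^sub>R u)"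
      using second_difference_eq[of S f "\<lambda>y. frechet_derivative f (at y)" v
        "\<lambda>y. frechet_derivative (\<lambda>y. frechet_derivative f (at y) v) (at y)" h x u] fd h in_S'
      unfolding D2_def by blast
    \<comment> \<open>Exchanging u and v permutes the corners of the parallelogram, so both uses of
      the mean value theorem evaluate the same second difference.\<close>
    have "h * h * D2 u v (x + s *\<^sub>R u + t *\<^sub>R v) = h * h * D2 v u (x + t' *\<^sub>R u + s' *\<^sub>R v)"
    proof -
      have "x + h *\<^sub>R v + h *\<^sub>R u = x + h *\<^sub>R u + h *\<^sub>R v"
        "x + s' *\<^sub>R v + t' *\<^sub>R u = x + t' *\<^sub>R u + s' *\<^sub>R v" by (simp_all add: algebra_simps)
      with 1 2 show ?thesis by (simp only:)
    qed
    then have eq: "D2 u v (x + s *\<^sub>R u + t *\<^sub>R v) = D2 v u (x + t' *\<^sub>R u + s' *\<^sub>R v)" using h by simp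
    have "dist (D2 u v (x + s *\<^sub>R u + t *\<^sub>R v)) (D2 u v x) < e / 2"
      using near[of s h t d] st h d by (intro d1) (auto simp: dist_commute)
    moreover have "dist (D2 v u (x + t' *\<^sub>R u + s' *\<^sub>R v)) (D2 v u x) < e / 2"
      using near[of t' h s' d] st' h d by (intro d2) (auto simp: dist_commute)
    ultimately show ?thesis unfolding eq dist_real_def by linarith
  qed
  have "\<bar>D2 u v x - D2 v u x\<bar> \<le> 0" by (rule field_le_epsilon) (simp add: key)
  then show ?thesis by (simp add: D2_def)
qed

lemma frechet_derivative_linear_compose:
  assumes "bounded_linear h" "f differentiable (at x)"
  shows "frechet_derivative (\<lambda>y. h (f y)) (at x) v = h (frechet_derivative f (at x) v)"
  using frechet_derivative_at[OF bounded_linear.has_derivative[OF assms(1)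
        assms(2)[THEN frechet_derivative_works[THEN iffD1]]]] by (metis (no_types))

text \<open>The mean value theorem behind the real case fails for vector values, so the claim is
  reduced to the components in a basis.\<close>

lemma smooth_on_mixed_derivative:
  fixes f :: "'a::real_normed_vector \<Rightarrow> 'b::euclidean_space"
  assumes S: "open S" "x \<in> S" and f: "smooth_on S f"
  shows "frechet_derivative (\<lambda>y. frechet_derivative f (at y) u) (at x) v
       = frechet_derivative (\<lambda>y. frechet_derivative f (at y) v) (at x) u"
proof (rule euclidean_eqI)
  fix b :: 'b
  have lin: "bounded_linear (\<lambda>y::'b. y \<bullet> b)" by (rule bounded_linear_inner_left)
  have *: "frechet_derivative (\<lambda>y. frechet_derivative f (at y) u) (at x) v \<bullet> b
      = frechet_derivative (\<lambda>y. frechet_derivative (\<lambda>y. f y \<bullet> b) (at y) u) (at x) v" for u v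
  proof -
    have "frechet_derivative (\<lambda>y. frechet_derivative f (at y) u) (at x) v \<bullet> b
      = frechet_derivative (\<lambda>y. frechet_derivative f (at y) u \<bullet> b) (at x) v"
      using smooth_on_imp_differentiable[OF smooth_on_frechet_derivative[OF f] S(2)]
      by (intro frechet_derivative_linear_compose[OF lin, symmetric])
    also have "frechet_derivative (\<lambda>y. frechet_derivative f (at y) u \<bullet> b) (at x)
       = frechet_derivative (\<lambda>y. frechet_derivative (\<lambda>y. f y \<bullet> b) (at y) u) (at x)"
    proof (rule frechet_derivative_transform_within_open[OF _ S])
      show "(\<lambda>y. frechet_derivative f (at y) u \<bullet> b) differentiable at x"
        using smooth_on_imp_differentiable[OF smooth_on_linear_compose[OF lin S(1) smooth_on_frechet_derivative[OF f]] S(2)] .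
      show "frechet_derivative f (at y) u \<bullet> b = frechet_derivative (\<lambda>y. f y \<bullet> b) (at y) u" if "y \<in> S" for y
        using frechet_derivative_linear_compose[OF lin smooth_on_imp_differentiable[OF f that]] by simp
    qed
    finally show ?thesis .
  qed
  show "frechet_derivative (\<lambda>y. frechet_derivative f (at y) u) (at x) v \<bullet> b
       = frechet_derivative (\<lambda>y. frechet_derivative f (at y) v) (at x) u \<bullet> b"
    unfolding * by (rule smooth_on_mixed_derivative_real[OF S smooth_on_linear_compose[OF lin S(1) f]])
qed

section \<open>Smooth maps and isotopies\<close>

text \<open>Injectivity makes \<open>param c\<close> undo the coordinate map. Stating it for
  arbitrary families of charts lets the same lemmas serve the surface, its cotangent bundle and
  their products with time.\<close>

definition inj_charts :: "('m, 'e) chart set \<Rightarrow> bool" where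
  "inj_charts M \<longleftrightarrow> (\<forall>c\<in>M. inj_on (snd c) (fst c))"

lemma inj_chartsD: "inj_charts M \<Longrightarrow> c \<in> M \<Longrightarrow> inj_on (snd c) (fst c)"
  by (simp add: inj_charts_def)

lemma points_vector_atlas [simp]: "points vector_atlas = UNIV"
  by (simp add: points_def vector_atlas_def)

lemma in_points: "c \<in> M \<Longrightarrow> x \<in> fst c \<Longrightarrow> x \<in> points M"
  by (auto simp: points_def)

lemma pointsE:
  assumes "x \<in> points M" obtains c where "c \<in> M" "x \<in> fst c"
  using assms by (auto simp: points_def)

lemma smooth_map_points: "smooth_map M N f \<Longrightarrow> x \<in> points M \<Longrightarrow> f x \<in> points N"
  by (auto simp: smooth_map_def)

lemma smooth_map_open:
  "smooth_map M N f \<Longrightarrow> c \<in> M \<Longrightarrow> d \<in> N \<Longrightarrow> open (snd c ` (fst c \<inter> f -` fst d))"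
  by (auto simp: smooth_map_def Let_def)

lemma smooth_map_smooth_on:
  "smooth_map M N f \<Longrightarrow> c \<in> M \<Longrightarrow> d \<in> N \<Longrightarrow>
    smooth_on (snd c ` (fst c \<inter> f -` fst d)) (snd d \<circ> f \<circ> param c)"
  by (auto simp: smooth_map_def Let_def)

lemma smooth_map_localI:
  assumes "f ` points M \<subseteq> points N"
    and loc: "\<And>c d x. c \<in> M \<Longrightarrow> d \<in> N \<Longrightarrow> x \<in> fst c \<Longrightarrow> f x \<in> fst d \<Longrightarrow>
      \<exists>U. open U \<and> snd c x \<in> U \<and> U \<subseteq> snd c ` (fst c \<inter> f -` fst d) \<and> smooth_on U (snd d \<circ> f \<circ> param c)"
  shows "smooth_map M N f"
  unfolding smooth_map_def Let_def
proof (intro conjI ballI assms(1))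
  fix c d assume cd: "c \<in> M" "d \<in> N"
  let ?W = "snd c ` (fst c \<inter> f -` fst d)"
  have *: "\<exists>U. open U \<and> y \<in> U \<and> U \<subseteq> ?W \<and> smooth_on U (snd d \<circ> f \<circ> param c)" if "y \<in> ?W" for y
    using that loc[OF cd] by auto
  show "open ?W" using * by (subst open_subopen) blast
  show "smooth_on ?W (snd d \<circ> f \<circ> param c)" using * by (intro smooth_on_local) blast
qed

lemma smooth_map_cong:
  assumes "smooth_map M N f" "\<And>x. x \<in> points M \<Longrightarrow> f x = g x"
  shows "smooth_map M N g"
  unfolding smooth_map_def Let_def
proof (intro conjI ballI)
  show "g ` points M \<subseteq> points N" using assms by (auto simp: smooth_map_def)
  fix c d assume cd: "c \<in> M" "d \<in> N"
  have eq: "fst c \<inter> g -` fst d = fst c \<inter> f -` fst d"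
    using assms(2) in_points[OF cd(1)] by auto
  show "open (snd c ` (fst c \<inter> g -` fst d))"
    unfolding eq by (rule smooth_map_open[OF assms(1) cd])
  show "smooth_on (snd c ` (fst c \<inter> g -` fst d)) (snd d \<circ> g \<circ> param c)"
    unfolding eq
  proof (rule smooth_on_cong[OF smooth_map_open[OF assms(1) cd] _ smooth_map_smooth_on[OF assms(1) cd]])
    fix y assume "y \<in> snd c ` (fst c \<inter> f -` fst d)"
    then have "param c y \<in> fst c" by (auto intro: inv_into_into)
    then show "(snd d \<circ> f \<circ> param c) y = (snd d \<circ> g \<circ> param c) y"
      using assms(2) in_points[OF cd(1)] by simp
  qed
qed

lemma smooth_map_compose:
  fixes M :: "('m, 'd::real_normed_vector) chart set" and N :: "('n, 'e::euclidean_space) chart set"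
    and P :: "('p, 'f::real_normed_vector) chart set"
  assumes inj: "inj_charts M" "inj_charts N" and f: "smooth_map M N f" and g: "smooth_map N P g"
  shows "smooth_map M P (\<lambda>x. g (f x))"
proof (rule smooth_map_localI)
  show "(\<lambda>x. g (f x)) ` points M \<subseteq> points P"
    using smooth_map_points[OF f] smooth_map_points[OF g] by auto
next
  fix c d x assume cd: "c \<in> M" "d \<in> P" "x \<in> fst c" "g (f x) \<in> fst d"
  have "f x \<in> points N" using smooth_map_points[OF f in_points[OF cd(1,3)]] .
  then obtain e where e: "e \<in> N" "f x \<in> fst e" by (rule pointsE)
  note injc = inj_chartsD[OF inj(1) cd(1)] and inje = inj_chartsD[OF inj(2) e(1)]
  define W1 F W2 G where "W1 = snd c ` (fst c \<inter> f -` fst e)" and "F = snd e \<circ> f \<circ> param c"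
    and "W2 = snd e ` (fst e \<inter> g -` fst d)" and "G = snd d \<circ> g \<circ> param e"
  have W: "open W1" "open W2" and FG: "smooth_on W1 F" "smooth_on W2 G"
    using smooth_map_open[OF f cd(1) e(1)] smooth_map_open[OF g e(1) cd(2)]
      smooth_map_smooth_on[OF f cd(1) e(1)] smooth_map_smooth_on[OF g e(1) cd(2)]
    by (auto simp: W1_def W2_def F_def G_def)
  \<comment> \<open>The part of the chart c that is routed through the intermediate chart e around f
    x. Injectivity of e identifies the point that witnesses membership in \<open>W2\<close> with the
    image under f.\<close>
  define U where "U = W1 \<inter> F -` W2"
  have U: "\<exists>x'. y = snd c x' \<and> x' \<in> fst c \<and> f x' \<in> fst e \<and> g (f x') \<in> fst d" if "y \<in> U" for y
  proof -
    from that obtain x' where x': "y = snd c x'" "x' \<in> fst c" "f x' \<in> fst e" "F y \<in> W2"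
      by (auto simp: U_def W1_def)
    then have "snd e (f x') \<in> W2" by (simp add: F_def injc)
    then obtain w where "snd e w = snd e (f x')" "w \<in> fst e" "g w \<in> fst d" by (auto simp: W2_def)
    with x' inje have "g (f x') \<in> fst d" by (metis inj_onD)
    with x' show ?thesis by blast
  qed
  show "\<exists>U. open U \<and> snd c x \<in> U \<and> U \<subseteq> snd c ` (fst c \<inter> (\<lambda>x. g (f x)) -` fst d) \<and>
      smooth_on U (snd d \<circ> (\<lambda>x. g (f x)) \<circ> param c)"
  proof (intro exI[of _ U] conjI)
    show "open U" unfolding U_def
      by (intro continuous_open_preimage smooth_on_imp_continuous_on FG W)
    then show "smooth_on U (snd d \<circ> (\<lambda>x. g (f x)) \<circ> param c)"
    proof (rule smooth_on_cong)
      show "smooth_on U (\<lambda>y. G (F y))"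
        by (rule smooth_on_compose[OF \<open>open U\<close> smooth_on_subset[OF FG(1)] FG(2)]) (auto simp: U_def)
      show "G (F y) = (snd d \<circ> (\<lambda>x. g (f x)) \<circ> param c) y" if "y \<in> U" for y
        using U[OF that] injc inje by (auto simp: G_def F_def)
    qed
    show "snd c x \<in> U" using cd e injc by (auto simp: U_def W1_def W2_def F_def)
    show "U \<subseteq> snd c ` (fst c \<inter> (\<lambda>x. g (f x)) -` fst d)" using U by fastforce
  qed
qed

section \<open>Composition and inversion of diffeomorphisms\<close>

lemma diffeomorphism_bij: "diffeomorphism M f \<Longrightarrow> bij_betw f (points M) (points M)"
  by (simp add: diffeomorphism_def)

lemma diffeomorphism_compose:
  fixes M :: "('m, 'e::euclidean_space) chart set"
  assumes M: "inj_charts M" and f: "diffeomorphism M f" and g: "diffeomorphism M g"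
  shows "diffeomorphism M (\<lambda>x. g (f x))"
proof -
  note bf = diffeomorphism_bij[OF f] and bg = diffeomorphism_bij[OF g]
  have bij: "bij_betw (\<lambda>x. g (f x)) (points M) (points M)"
    using bij_betw_trans[OF bf bg] by (simp add: o_def)
  have "inv_into (points M) f (inv_into (points M) g x) = inv_into (points M) (\<lambda>x. g (f x)) x"
    if "x \<in> points M" for x
  proof -
    have 1: "inv_into (points M) g x \<in> points M" "g (inv_into (points M) g x) = x"
      using that bg by (auto simp: bij_betw_def inv_into_into f_inv_into_f)
    then have 2: "inv_into (points M) f (inv_into (points M) g x) \<in> points M"
      "g (f (inv_into (points M) f (inv_into (points M) g x))) = x"
      using bf by (auto simp: bij_betw_def inv_into_into f_inv_into_f)
    show ?thesis
      by (rule inv_into_f_eq[symmetric]) (use bij 2 in \<open>auto simp: bij_betw_def\<close>)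
  qed
  with f g bij show ?thesis
    unfolding diffeomorphism_def
    by (auto intro: smooth_map_compose[OF M M] smooth_map_cong[OF smooth_map_compose[OF M M]])
qed

lemma diffeomorphism_inv:
  assumes "diffeomorphism M f"
  shows "diffeomorphism M (inv_into (points M) f)"
proof -
  note b = diffeomorphism_bij[OF assms]
  have "inv_into (points M) (inv_into (points M) f) x = f x" if "x \<in> points M" for x
    using inv_into_inv_into_eq[OF b that] .
  with assms b show ?thesis
    unfolding diffeomorphism_def by (auto intro: smooth_map_cong bij_betw_inv_into)
qed

text \<open>Smoothness of the identity expresses compatibility of the charts, a condition on the
  atlas. It is assumed here and verified separately for the surface and for its cotangent
  bundle.\<close>

lemma diffeomorphism_ident: "smooth_map M M (\<lambda>x. x) \<Longrightarrow> diffeomorphism M (\<lambda>x. x)"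
  unfolding diffeomorphism_def
  by (auto simp: bij_betw_def inj_on_def intro: smooth_map_cong inv_into_f_f[symmetric, of "\<lambda>x. x"])

section \<open>Products with time\<close>

definition time_chart :: "('m, 'e) chart \<Rightarrow> (real \<times> 'm, real \<times> 'e) chart" where
  "time_chart c = (UNIV \<times> fst c, \<lambda>(t, x). (t, snd c x))"

lemma time_atlas_eq: "time_atlas M = time_chart ` M"
  by (auto simp: time_atlas_def time_chart_def)

lemma fst_time_chart [simp]: "fst (time_chart c) = UNIV \<times> fst c"
  and snd_time_chart [simp]: "snd (time_chart c) p = (fst p, snd c (snd p))"
  by (auto simp: time_chart_def split_beta)

lemma time_chart_in: "c \<in> M \<Longrightarrow> time_chart c \<in> time_atlas M"
  by (simp add: time_atlas_eq)

lemma points_time_atlas [simp]: "points (time_atlas M) = UNIV \<times> points M"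
  by (auto simp: points_def time_atlas_eq)

lemma inj_on_time_chart: "inj_on (snd c) (fst c) \<Longrightarrow> inj_on (snd (time_chart c)) (UNIV \<times> fst c)"
  by (auto simp: inj_on_def)

lemma inj_charts_time_atlas: "inj_charts M \<Longrightarrow> inj_charts (time_atlas M)"
  by (auto simp: inj_charts_def time_atlas_eq inj_on_time_chart)

lemma param_time_chart:
  assumes "inj_on (snd c) (fst c)" "z \<in> snd c ` fst c"
  shows "param (time_chart c) (t, z) = (t, param c z)"
  by (rule inv_into_f_eq) (use assms in \<open>auto simp: inj_on_time_chart inv_into_into\<close>)

text \<open>Carrying the time along turns a time-dependent map into a map between products with
  time, so composing isotopies becomes ordinary composition. The reparametrisation \<tau> allows
  time to be reversed.\<close>

lemma smooth_map_time:
  fixes M :: "('m, 'd::euclidean_space) chart set"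
  assumes M: "inj_charts M" and f: "smooth_map (time_atlas M) N f" and \<tau>: "smooth_on UNIV \<tau>"
  shows "smooth_map (time_atlas M) (time_atlas N) (\<lambda>p. (\<tau> (fst p), f p))"
  unfolding smooth_map_def Let_def
proof (intro conjI ballI)
  show "(\<lambda>p. (\<tau> (fst p), f p)) ` points (time_atlas M) \<subseteq> points (time_atlas N)"
    using smooth_map_points[OF f] by auto
  fix c' d' assume "c' \<in> time_atlas M" "d' \<in> time_atlas N"
  then obtain c d where c: "c' = time_chart c" "c \<in> M" and d: "d' = time_chart d" "d \<in> N"
    by (auto simp: time_atlas_eq)
  note c' = time_chart_in[OF c(2)]
  let ?W = "snd (time_chart c) ` (fst (time_chart c) \<inter> f -` fst d)"
  have eq: "snd c' ` (fst c' \<inter> (\<lambda>p. (\<tau> (fst p), f p)) -` fst d') = ?W"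
    by (auto simp: c d)
  note W = smooth_map_open[OF f c' d(2)]
  show "open (snd c' ` (fst c' \<inter> (\<lambda>p. (\<tau> (fst p), f p)) -` fst d'))"
    unfolding eq by (rule W)
  show "smooth_on (snd c' ` (fst c' \<inter> (\<lambda>p. (\<tau> (fst p), f p)) -` fst d'))
      (snd d' \<circ> (\<lambda>p. (\<tau> (fst p), f p)) \<circ> param c')"
    unfolding eq
  proof (rule smooth_on_cong[OF W])
    show "smooth_on ?W (\<lambda>q. (\<tau> (fst q), (snd d \<circ> f \<circ> param (time_chart c)) q))"
      using smooth_on_compose[OF W smooth_on_linear[OF bounded_linear_fst W] \<tau>]
      by (intro smooth_on_Pair W smooth_map_smooth_on[OF f c' d(2)]) auto
    fix q assume "q \<in> ?W"
    then have "snd q \<in> snd c ` fst c" by auto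
    then show "(\<tau> (fst q), (snd d \<circ> f \<circ> param (time_chart c)) q)
        = (snd d' \<circ> (\<lambda>p. (\<tau> (fst p), f p)) \<circ> param c') q"
      using param_time_chart[OF inj_chartsD[OF M c(2)], of "snd q" "fst q"] by (simp add: c d)
  qed
qed

lemma smooth_map_snd:
  fixes M :: "('m, 'd::euclidean_space) chart set"
  assumes M: "inj_charts M" and f: "smooth_map M N f"
  shows "smooth_map (time_atlas M) N (\<lambda>p. f (snd p))"
  unfolding smooth_map_def Let_def
proof (intro conjI ballI)
  show "(\<lambda>p. f (snd p)) ` points (time_atlas M) \<subseteq> points N"
    using smooth_map_points[OF f] by auto
  fix c' d assume "c' \<in> time_atlas M" and d: "d \<in> N"
  then obtain c where c: "c' = time_chart c" "c \<in> M"
    by (auto simp: time_atlas_eq)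
  let ?W = "snd c ` (fst c \<inter> f -` fst d)"
  have eq: "snd c' ` (fst c' \<inter> (\<lambda>p. f (snd p)) -` fst d) = UNIV \<times> ?W"
    by (force simp: c)
  note W = open_Times[OF open_UNIV smooth_map_open[OF f c(2) d]]
  show "open (snd c' ` (fst c' \<inter> (\<lambda>p. f (snd p)) -` fst d))"
    unfolding eq by (rule W)
  show "smooth_on (snd c' ` (fst c' \<inter> (\<lambda>p. f (snd p)) -` fst d)) (snd d \<circ> (\<lambda>p. f (snd p)) \<circ> param c')"
    unfolding eq
  proof (rule smooth_on_cong[OF W])
    show "smooth_on (UNIV \<times> ?W) (\<lambda>q. (snd d \<circ> f \<circ> param c) (snd q))"
      by (rule smooth_on_compose[OF W smooth_on_linear[OF bounded_linear_snd W] smooth_map_smooth_on[OF f c(2) d]])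
        auto
    fix q :: "real \<times> 'd" assume "q \<in> UNIV \<times> ?W"
    then have "snd q \<in> snd c ` fst c" by auto
    then show "(snd d \<circ> f \<circ> param c) (snd q) = (snd d \<circ> (\<lambda>p. f (snd p)) \<circ> param c') q"
      using param_time_chart[OF inj_chartsD[OF M c(2)], of "snd q" "fst q"] by (simp add: c)
  qed
qed

section \<open>Isotopies\<close>

lemma isotopy_smooth: "isotopy M \<Phi> \<Longrightarrow> smooth_map (time_atlas M) M (\<lambda>p. \<Phi> (fst p) (snd p))"
  and isotopy_0: "isotopy M \<Phi> \<Longrightarrow> x \<in> points M \<Longrightarrow> \<Phi> 0 x = x"
  and isotopy_diffeomorphism: "isotopy M \<Phi> \<Longrightarrow> diffeomorphism M (\<Phi> t)"
  by (simp_all add: isotopy_def case_prod_unfold)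

lemma isotopyI:
  "smooth_map (time_atlas M) M (\<lambda>p. \<Phi> (fst p) (snd p)) \<Longrightarrow> (\<And>x. x \<in> points M \<Longrightarrow> \<Phi> 0 x = x) \<Longrightarrow>
    (\<And>t. diffeomorphism M (\<Phi> t)) \<Longrightarrow> isotopy M \<Phi>"
  by (simp add: isotopy_def case_prod_unfold)

lemma smooth_map_isotopy_compose:
  fixes M :: "('m, 'e::euclidean_space) chart set" and N :: "('n, 'f::euclidean_space) chart set"
  assumes "inj_charts M" "inj_charts N" "isotopy N \<Phi>" "smooth_map (time_atlas M) N f" "smooth_on UNIV \<tau>"
  shows "smooth_map (time_atlas M) N (\<lambda>p. \<Phi> (\<tau> (fst p)) (f p))"
  using smooth_map_compose[OF inj_charts_time_atlas inj_charts_time_atlas smooth_map_time isotopy_smooth,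
      OF assms(1,2,1,4,5,3)] by simp

lemma isotopy_ident:
  fixes M :: "('m, 'e::euclidean_space) chart set"
  assumes "inj_charts M" "smooth_map M M (\<lambda>x. x)"
  shows "isotopy M (\<lambda>t x. x)"
  by (intro isotopyI smooth_map_snd[OF assms] diffeomorphism_ident assms) auto

lemma smooth_on_ident: "smooth_on UNIV (\<lambda>x. x)"
  by (intro smooth_on_linear bounded_linear_ident open_UNIV)

lemma isotopy_compose:
  fixes M :: "('m, 'e::euclidean_space) chart set"
  assumes "inj_charts M" "isotopy M \<Phi>" "isotopy M \<Psi>"
  shows "isotopy M (\<lambda>t x. \<Phi> t (\<Psi> t x))"
proof (rule isotopyI)
  show "smooth_map (time_atlas M) M (\<lambda>p. \<Phi> (fst p) (\<Psi> (fst p) (snd p)))"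
    by (rule smooth_map_isotopy_compose[OF assms(1,1,2) isotopy_smooth[OF assms(3)] smooth_on_ident])
qed (use assms in \<open>auto simp: isotopy_0 intro: diffeomorphism_compose isotopy_diffeomorphism\<close>)

text \<open>Running the isotopy backwards avoids inverting it smoothly in time.\<close>

lemma isotopy_inv:
  fixes M :: "('m, 'e::euclidean_space) chart set"
  assumes "inj_charts M" "isotopy M \<Phi>"
  shows "isotopy M (\<lambda>t x. \<Phi> (1 - t) (inv_into (points M) (\<Phi> 1) x))"
proof (rule isotopyI)
  let ?h = "inv_into (points M) (\<Phi> 1)"
  have d: "diffeomorphism M (\<Phi> 1)" and h: "diffeomorphism M ?h"
    using isotopy_diffeomorphism[OF assms(2)] diffeomorphism_inv by auto
  have "smooth_on UNIV (\<lambda>t::real. 1 + (- t))"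
    by (intro smooth_on_add smooth_on_minus smooth_on_const smooth_on_ident open_UNIV)
  then show "smooth_map (time_atlas M) M (\<lambda>p. \<Phi> (1 - fst p) (?h (snd p)))"
    using h by (intro smooth_map_isotopy_compose[OF assms(1,1,2) smooth_map_snd[OF assms(1)], of ?h "\<lambda>t. 1 - t"])
      (simp_all add: diffeomorphism_def)
  show "\<Phi> (1 - 0) (?h x) = x" if "x \<in> points M" for x
    using diffeomorphism_bij[OF d] that by (simp add: bij_betw_def f_inv_into_f)
  show "diffeomorphism M (\<lambda>x. \<Phi> (1 - t) (?h x))" for t
    by (rule diffeomorphism_compose[OF assms(1) h isotopy_diffeomorphism[OF assms(2)]])
qed

section \<open>Surfaces and their cotangent bundles\<close>

locale atlas_surface =
  fixes A :: "('a::t2_space) cchart set"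
  assumes atlas: "complex_atlas A"
begin

lemma points_A [simp]: "points A = UNIV"
  using atlas by (simp add: complex_atlas_def)

lemma chart_homeomorphism:
  "c \<in> A \<Longrightarrow> homeomorphism (fst c) (snd c ` fst c) (snd c) (param c)"
  and open_chart: "c \<in> A \<Longrightarrow> open (fst c)"
  and open_chart_image: "c \<in> A \<Longrightarrow> open (snd c ` fst c)"
  using atlas by (auto simp: complex_atlas_def)

lemma chart_around: obtains c where "c \<in> A" "x \<in> fst c"
  using points_A by (metis UNIV_I pointsE)

lemma param_chart [simp]: "c \<in> A \<Longrightarrow> x \<in> fst c \<Longrightarrow> param c (snd c x) = x"
  using chart_homeomorphism by (simp add: homeomorphism_def)

lemma inj_charts_A: "inj_charts A"
  unfolding inj_charts_def by (meson inj_on_inverseI param_chart)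

lemma param_in_chart: "z \<in> snd c ` fst c \<Longrightarrow> param c z \<in> fst c"
  by (rule inv_into_into)

lemma chart_param: "z \<in> snd c ` fst c \<Longrightarrow> snd c (param c z) = z"
  by (rule f_inv_into_f)

lemma open_chart_map:
  assumes "c \<in> A" "open U"
  shows "open (snd c ` (fst c \<inter> U))"
proof -
  have "snd c ` (fst c \<inter> U) = snd c ` fst c \<inter> param c -` U"
    using assms(1) by (auto simp: image_iff)
  then show ?thesis
    using continuous_open_preimage[OF homeomorphism_cont2[OF chart_homeomorphism[OF assms(1)]]
        open_chart_image[OF assms(1)] assms(2)] by simp
qed

lemma open_overlap: "c \<in> A \<Longrightarrow> d \<in> A \<Longrightarrow> open (snd c ` (fst c \<inter> fst d))"
  by (simp add: open_chart_map open_chart)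

lemma transition_holomorphic:
  "c \<in> A \<Longrightarrow> d \<in> A \<Longrightarrow> (snd d \<circ> param c) holomorphic_on snd c ` (fst c \<inter> fst d)"
  using atlas by (simp add: complex_atlas_def)

lemma trans_deriv_has_derivative:
  assumes "c \<in> A" "d \<in> A" "x \<in> fst c" "x \<in> fst d"
  shows "((snd d \<circ> param c) has_field_derivative trans_deriv c d x) (at (snd c x))"
  unfolding trans_deriv_def
  by (rule holomorphic_derivI[OF transition_holomorphic open_overlap]) (use assms in auto)

lemma trans_deriv_chain:
  assumes "c \<in> A" "d \<in> A" "e \<in> A" "x \<in> fst c" "x \<in> fst d" "x \<in> fst e"
  shows "trans_deriv c e x = trans_deriv d e x * trans_deriv c d x"
proof (rule DERIV_unique)
  show "((snd e \<circ> param c) has_field_derivative trans_deriv c e x) (at (snd c x))"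
    using assms by (intro trans_deriv_has_derivative)
  have "((snd e \<circ> param d) has_field_derivative trans_deriv d e x) (at ((snd d \<circ> param c) (snd c x)))"
    using trans_deriv_has_derivative[of d e x] assms by simp
  from DERIV_chain[OF this trans_deriv_has_derivative[of c d x]] assms
  have *: "((snd e \<circ> param d \<circ> (snd d \<circ> param c)) has_field_derivative trans_deriv d e x * trans_deriv c d x) (at (snd c x))"
    by simp
  show "((snd e \<circ> param c) has_field_derivative trans_deriv d e x * trans_deriv c d x) (at (snd c x))"
    by (rule has_field_derivative_transform_within_open[OF * open_overlap[OF assms(1,2)]]) (use assms in auto)
qed

lemma trans_deriv_self [simp]:
  assumes "c \<in> A" "x \<in> fst c"
  shows "trans_deriv c c x = 1"
proof (rule DERIV_unique)
  show "((snd c \<circ> param c) has_field_derivative trans_deriv c c x) (at (snd c x))"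
    using assms by (intro trans_deriv_has_derivative)
  show "((snd c \<circ> param c) has_field_derivative 1) (at (snd c x))"
    by (rule has_field_derivative_transform_within_open[OF DERIV_ident open_chart_image[OF assms(1)]])
      (use assms in auto)
qed

lemma trans_deriv_inverse:
  assumes "c \<in> A" "d \<in> A" "x \<in> fst c" "x \<in> fst d"
  shows "trans_deriv d c x = inverse (trans_deriv c d x)" "trans_deriv c d x \<noteq> 0"
proof -
  have *: "trans_deriv d c x * trans_deriv c d x = 1"
    using trans_deriv_chain[of c d c x] assms by simp
  then show "trans_deriv d c x = inverse (trans_deriv c d x)" "trans_deriv c d x \<noteq> 0"
    by (metis inverse_unique mult.commute) (use * in auto)
qed

lemma smooth_map_A_ident: "smooth_map A A (\<lambda>x. x)"
  unfolding smooth_map_def Let_def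
proof (intro conjI ballI)
  fix c d assume cd: "c \<in> A" "d \<in> A"
  have eq: "fst c \<inter> (\<lambda>x. x) -` fst d = fst c \<inter> fst d" by auto
  show "open (snd c ` (fst c \<inter> (\<lambda>x. x) -` fst d))" unfolding eq by (rule open_overlap[OF cd])
  have "snd d \<circ> (\<lambda>x. x) \<circ> param c = snd d \<circ> param c" by auto
  then show "smooth_on (snd c ` (fst c \<inter> (\<lambda>x. x) -` fst d)) (snd d \<circ> (\<lambda>x. x) \<circ> param c)"
    unfolding eq by (metis smooth_on_holomorphic open_overlap[OF cd] transition_holomorphic[OF cd])
qed simp

section \<open>Coordinates on the cotangent bundle\<close>

definition cov :: "'a cchart \<Rightarrow> 'a \<Rightarrow> complex \<Rightarrow> 'a covector" where
  "cov c x p = (x, \<lambda>d. if d \<in> A \<and> x \<in> fst d then trans_deriv d c x * p else 0)"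

lemma fst_cov [simp]: "fst (cov c x p) = x"
  by (simp add: cov_def)

lemma snd_cov: "d \<in> A \<Longrightarrow> x \<in> fst d \<Longrightarrow> snd (cov c x p) d = trans_deriv d c x * p"
  by (simp add: cov_def)

lemma snd_cov_self [simp]: "c \<in> A \<Longrightarrow> x \<in> fst c \<Longrightarrow> snd (cov c x p) c = p"
  by (simp add: snd_cov)

lemma cov_in_cotangent: "c \<in> A \<Longrightarrow> x \<in> fst c \<Longrightarrow> cov c x p \<in> cotangent A"
proof -
  assume c: "c \<in> A" "x \<in> fst c"
  have "trans_deriv d c x * p = trans_deriv d e x * (trans_deriv e c x * p)"
    if de: "d \<in> A" "e \<in> A" "x \<in> fst d" "x \<in> fst e" for d e
    unfolding trans_deriv_chain[OF de(1,2) c(1) de(3,4) c(2)] by simp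
  then show ?thesis by (simp add: cov_def cotangent_def)
qed

lemma cotangent_eq_cov:
  assumes "m \<in> cotangent A" "c \<in> A" "fst m \<in> fst c"
  shows "m = cov c (fst m) (snd m c)"
proof (cases m)
  case (Pair x \<xi>)
  have *: "d \<notin> A \<or> x \<notin> fst d \<Longrightarrow> \<xi> d = 0"
    "d \<in> A \<Longrightarrow> x \<in> fst d \<Longrightarrow> \<xi> d = trans_deriv d c x * \<xi> c" for d
    using assms unfolding Pair cotangent_def mem_Collect_eq prod.case fst_conv by blast+
  have "\<xi> d = (if d \<in> A \<and> x \<in> fst d then trans_deriv d c x * \<xi> c else 0)" for d
  proof (cases "d \<in> A \<and> x \<in> fst d")
    case True
    then show ?thesis by (subst *(2)) auto
  qed (use *(1) in auto)
  then have "\<xi> = (\<lambda>d. if d \<in> A \<and> x \<in> fst d then trans_deriv d c x * \<xi> c else 0)" by (rule ext)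
  then show ?thesis unfolding Pair cov_def fst_conv snd_conv by simp
qed

lemma mem_cot_chart [simp]: "m \<in> fst (cot_chart A c) \<longleftrightarrow> m \<in> cotangent A \<and> fst m \<in> fst c"
  by (simp add: cot_chart_def)

lemma snd_cot_chart [simp]: "snd (cot_chart A c) m = (snd c (fst m), snd m c)"
  by (simp add: cot_chart_def split_beta)

lemma cot_chart_in [simp]: "c \<in> A \<Longrightarrow> cot_chart A c \<in> cot_atlas A"
  by (simp add: cot_atlas_def)

lemma points_cot_atlas [simp]: "points (cot_atlas A) = cotangent A"
proof -
  have "m \<in> points (cot_atlas A)" if "m \<in> cotangent A" for m
    using that chart_around[of "fst m"] by (metis cot_chart_in in_points mem_cot_chart)
  then show ?thesis by (auto simp: points_def cot_atlas_def)
qed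

lemma inj_on_cot_chart: "c \<in> A \<Longrightarrow> inj_on (snd (cot_chart A c)) (fst (cot_chart A c))"
proof (rule inj_onI)
  fix m m' assume c: "c \<in> A" and m: "m \<in> fst (cot_chart A c)" "m' \<in> fst (cot_chart A c)"
    and "snd (cot_chart A c) m = snd (cot_chart A c) m'"
  then have "fst m = fst m'" "snd m c = snd m' c"
    using inj_chartsD[OF inj_charts_A c] by (auto dest: inj_onD)
  with m c show "m = m'" by (metis cotangent_eq_cov mem_cot_chart)
qed

lemma inj_charts_cot_atlas: "inj_charts (cot_atlas A)"
  unfolding inj_charts_def cot_atlas_def by (auto intro: inj_on_cot_chart)

lemma cot_chart_image_Int:
  assumes "c \<in> A"
  shows "snd (cot_chart A c) ` (fst (cot_chart A c) \<inter> {m. fst m \<in> U}) = (snd c ` (fst c \<inter> U)) \<times> UNIV"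
proof -
  have "(snd c x, p) \<in> snd (cot_chart A c) ` (fst (cot_chart A c) \<inter> {m. fst m \<in> U})"
    if "x \<in> fst c" "x \<in> U" for x p
    by (rule image_eqI[of _ _ "cov c x p"]) (use that assms cov_in_cotangent in auto)
  then show ?thesis by auto
qed

lemma cot_chart_image: "c \<in> A \<Longrightarrow> snd (cot_chart A c) ` fst (cot_chart A c) = (snd c ` fst c) \<times> UNIV"
  using cot_chart_image_Int[of c UNIV] by simp

text \<open>Replaces the abstract inverse of a cotangent chart by \<open>cov\<close>, which displays
  the coordinates in all charts at once; this is what reading a function defined in one chart from
  another chart requires.\<close>

lemma param_cot_chart:
  assumes "c \<in> A" "z \<in> snd c ` fst c"
  shows "param (cot_chart A c) (z, p) = cov c (param c z) p"
  by (rule inv_into_f_eq)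
    (use assms in \<open>simp_all add: inj_on_cot_chart cov_in_cotangent param_in_chart chart_param\<close>)

lemma cot_chart_overlap_open: "c \<in> A \<Longrightarrow> open U \<Longrightarrow> open ((snd c ` (fst c \<inter> U)) \<times> (UNIV :: complex set))"
  by (intro open_Times open_chart_map open_UNIV)

text \<open>The cotangent lift of the change of coordinate T: the base point moves by T and the
  fibre coordinate is divided by the derivative of T, so that p dz is preserved.\<close>

definition cot_trans :: "'a cchart \<Rightarrow> 'a cchart \<Rightarrow> complex \<times> complex \<Rightarrow> complex \<times> complex" where
  "cot_trans c d q = ((snd d \<circ> param c) (fst q), snd q * inverse (deriv (snd d \<circ> param c) (fst q)))"

lemma cot_trans_eq:
  assumes "c \<in> A" "d \<in> A" "m \<in> cotangent A" "fst m \<in> fst c" "fst m \<in> fst d"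
  shows "cot_trans c d (snd (cot_chart A c) m) = snd (cot_chart A d) m"
proof -
  have "snd m d = trans_deriv d c (fst m) * snd m c"
    using cotangent_eq_cov[of m c] assms by (metis snd_cov)
  then show ?thesis
    using trans_deriv_inverse[of c d "fst m"] assms
    by (simp add: cot_trans_def trans_deriv_def[symmetric])
qed

lemma deriv_transition_nonzero:
  assumes "c \<in> A" "d \<in> A" "z \<in> snd c ` (fst c \<inter> fst d)"
  shows "deriv (snd d \<circ> param c) z \<noteq> 0"
  using assms trans_deriv_inverse(2)[of c d "param c z"] by (auto simp: trans_deriv_def)

lemma smooth_on_cot_trans:
  assumes "c \<in> A" "d \<in> A"
  shows "smooth_on ((snd c ` (fst c \<inter> fst d)) \<times> UNIV) (cot_trans c d)"
proof -
  let ?S = "snd c ` (fst c \<inter> fst d)"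
  have S: "open ?S" "open (?S \<times> (UNIV::complex set))"
    using open_overlap[OF assms] by (auto intro: open_Times)
  have base: "smooth_on (?S \<times> UNIV) (\<lambda>q::complex \<times> complex. f (fst q))" if "f holomorphic_on ?S" for f :: "complex \<Rightarrow> complex"
    by (rule smooth_on_compose[where f = fst and g = f, OF S(2) smooth_on_linear[OF bounded_linear_fst S(2)]
          smooth_on_holomorphic[OF S(1) that]]) auto
  have "smooth_on (?S \<times> UNIV) (\<lambda>q. ((snd d \<circ> param c) (fst q), snd q * inverse (deriv (snd d \<circ> param c) (fst q))))"
    by (intro smooth_on_Pair smooth_on_mult base S smooth_on_linear bounded_linear_snd transition_holomorphic
        assms holomorphic_on_inverse holomorphic_deriv deriv_transition_nonzero)
  then show ?thesis unfolding cot_trans_def[abs_def] .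
qed

lemma cot_chart_overlap:
  "d \<in> A \<Longrightarrow> fst (cot_chart A c) \<inter> (\<lambda>x. x) -` fst (cot_chart A d) = fst (cot_chart A c) \<inter> {m. fst m \<in> fst d}"
  by auto

lemma smooth_map_cot_ident: "smooth_map (cot_atlas A) (cot_atlas A) (\<lambda>x. x)"
  unfolding smooth_map_def Let_def
proof (intro conjI ballI)
  fix C D assume "C \<in> cot_atlas A" "D \<in> cot_atlas A"
  then obtain c d where cd: "c \<in> A" "d \<in> A" and C: "C = cot_chart A c" and D: "D = cot_chart A d"
    by (auto simp: cot_atlas_def)
  have eq: "snd C ` (fst C \<inter> (\<lambda>x. x) -` fst D) = (snd c ` (fst c \<inter> fst d)) \<times> UNIV"
    unfolding C D cot_chart_overlap[OF cd(2)] by (rule cot_chart_image_Int[OF cd(1)])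
  show op: "open (snd C ` (fst C \<inter> (\<lambda>x. x) -` fst D))"
    unfolding eq by (intro cot_chart_overlap_open cd open_chart)
  show "smooth_on (snd C ` (fst C \<inter> (\<lambda>x. x) -` fst D)) (snd D \<circ> (\<lambda>x. x) \<circ> param C)"
    unfolding eq
  proof (rule smooth_on_cong[OF _ _ smooth_on_cot_trans[OF cd]])
    fix q :: "complex \<times> complex" assume q: "q \<in> snd c ` (fst c \<inter> fst d) \<times> UNIV"
    then have "q \<in> snd C ` (fst C \<inter> (\<lambda>x. x) -` fst D)" by (simp only: eq)
    then obtain m where m: "q = snd C m" "m \<in> fst C" "m \<in> fst D" by blast
    have "param C q = m"
      unfolding m(1) C by (rule inv_into_f_f[OF inj_on_cot_chart[OF cd(1)]]) (use m C in simp)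
    then show "cot_trans c d q = (snd D \<circ> (\<lambda>x. x) \<circ> param C) q"
      using m cot_trans_eq[OF cd, of m] by (simp add: C D)
  qed (use op eq in auto)
qed simp

definition zero_cov :: "'a \<Rightarrow> 'a covector" where
  "zero_cov x = (x, \<lambda>c. 0)"

lemma fst_zero_cov [simp]: "fst (zero_cov x) = x" and snd_zero_cov [simp]: "snd (zero_cov x) = (\<lambda>c. 0)"
  by (simp_all add: zero_cov_def)

lemma zero_cov_in [simp]: "zero_cov x \<in> cotangent A"
  by (simp add: zero_cov_def cotangent_def)

lemma zero_section_eq: "zero_section A = range zero_cov"
  using zero_cov_in by (auto simp: zero_section_def zero_cov_def)

lemma smooth_map_zero_cov: "smooth_map A (cot_atlas A) zero_cov"
  unfolding smooth_map_def Let_def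
proof (intro conjI ballI)
  fix c D assume c: "c \<in> A" and "D \<in> cot_atlas A"
  then obtain d where d: "d \<in> A" and D: "D = cot_chart A d"
    by (auto simp: cot_atlas_def)
  have eq: "fst c \<inter> zero_cov -` fst D = fst c \<inter> fst d"
    by (auto simp: D zero_cov_def cotangent_def)
  show op: "open (snd c ` (fst c \<inter> zero_cov -` fst D))"
    unfolding eq by (rule open_overlap[OF c d])
  have "smooth_on (snd c ` (fst c \<inter> fst d)) (\<lambda>z. ((snd d \<circ> param c) z, 0))"
    by (intro smooth_on_Pair open_overlap c d smooth_on_const smooth_on_holomorphic transition_holomorphic)
  then show "smooth_on (snd c ` (fst c \<inter> zero_cov -` fst D)) (snd D \<circ> zero_cov \<circ> param c)"
    unfolding eq by (rule smooth_on_cong[OF open_overlap[OF c d], rotated]) (simp add: D)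
qed auto

lemma smooth_map_cot_fst: "smooth_map (cot_atlas A) A fst"
  unfolding smooth_map_def Let_def
proof (intro conjI ballI)
  fix C d assume "C \<in> cot_atlas A" and d: "d \<in> A"
  then obtain c where c: "c \<in> A" and C: "C = cot_chart A c"
    by (auto simp: cot_atlas_def)
  have "fst C \<inter> fst -` fst d = fst C \<inter> {m. fst m \<in> fst d}" by auto
  then have eq: "snd C ` (fst C \<inter> fst -` fst d) = (snd c ` (fst c \<inter> fst d)) \<times> UNIV"
    unfolding C by (metis cot_chart_image_Int[OF c])
  have op: "open ((snd c ` (fst c \<inter> fst d)) \<times> (UNIV :: complex set))"
    by (intro cot_chart_overlap_open c d open_chart)
  then show "open (snd C ` (fst C \<inter> fst -` fst d))" by (simp add: eq)
  have "smooth_on ((snd c ` (fst c \<inter> fst d)) \<times> UNIV) (\<lambda>q::complex \<times> complex. (snd d \<circ> param c) (fst q))"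
    by (rule smooth_on_compose[OF op smooth_on_linear[OF bounded_linear_fst op]
          smooth_on_holomorphic[OF open_overlap[OF c d] transition_holomorphic[OF c d]]]) auto
  then show "smooth_on (snd C ` (fst C \<inter> fst -` fst d)) (snd d \<circ> fst \<circ> param C)"
    unfolding eq
  proof (rule smooth_on_cong[OF op, rotated])
    fix q :: "complex \<times> complex" assume "q \<in> snd c ` (fst c \<inter> fst d) \<times> UNIV"
    then have "fst q \<in> snd c ` fst c" by auto
    then show "(snd d \<circ> param c) (fst q) = (snd d \<circ> fst \<circ> param C) q"
      using param_cot_chart[OF c, of "fst q" "snd q"] by (simp add: C)
  qed
qed simp

end

section \<open>The Teichmueller relation\<close>

lemma time_slice_open:
  assumes f: "smooth_map (time_atlas M) N f" and c: "c \<in> M" and d: "d \<in> N"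
  shows "open (snd (time_chart c) ` (fst (time_chart c) \<inter> f -` fst d))"
  using smooth_map_open[OF f time_chart_in[OF c] d] .

lemma time_slice_smooth_on:
  assumes f: "smooth_map (time_atlas M) N f" and c: "c \<in> M" and d: "d \<in> N"
  shows "smooth_on (snd (time_chart c) ` (fst (time_chart c) \<inter> f -` fst d)) (snd d \<circ> f \<circ> param (time_chart c))"
  using smooth_map_smooth_on[OF f time_chart_in[OF c] d] .

lemma mem_time_slice:
  assumes "x \<in> fst c" "f (t, x) \<in> fst d"
  shows "(t, snd c x) \<in> snd (time_chart c) ` (fst (time_chart c) \<inter> f -` fst d)"
  using assms by (intro image_eqI[of _ _ "(t, x)"]) auto

lemma time_slice_eq:
  assumes inj: "inj_charts M" and c: "c \<in> M"
    and "(t, z) \<in> snd (time_chart c) ` (fst (time_chart c) \<inter> f -` fst d)"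
  shows "(snd d \<circ> f \<circ> param (time_chart c)) (t, z) = snd d (f (t, param c z))"
proof -
  have "z \<in> snd c ` fst c" using assms(3) by auto
  then show ?thesis using param_time_chart[OF inj_chartsD[OF inj c], of z t] by simp
qed

text \<open>The derivative of a slice is the joint derivative restricted to vectors without time
  component. Since the joint derivative varies smoothly with (t, z), the derivative of the slice
  varies smoothly with time.\<close>

lemma time_slice_has_derivative:
  fixes M :: "('m, 'd::real_normed_vector) chart set"
  assumes inj: "inj_charts M" and f: "smooth_map (time_atlas M) N f" and c: "c \<in> M" and d: "d \<in> N"
    and z: "(t, z) \<in> snd (time_chart c) ` (fst (time_chart c) \<inter> f -` fst d)"
  shows "((snd d \<circ> (\<lambda>x. f (t, x)) \<circ> param c) has_derivative
      (\<lambda>w. frechet_derivative (snd d \<circ> f \<circ> param (time_chart c)) (at (t, z)) (0, w))) (at z)"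
proof -
  let ?W = "snd (time_chart c) ` (fst (time_chart c) \<inter> f -` fst d)"
  let ?L = "snd d \<circ> f \<circ> param (time_chart c)"
  have D: "(?L has_derivative frechet_derivative ?L (at (t, z))) (at (t, z))"
    by (rule smooth_on_imp_has_derivative[OF time_slice_smooth_on[OF f c d] z])
  have "((\<lambda>y. ?L (t, y)) has_derivative (\<lambda>w. frechet_derivative ?L (at (t, z)) (0, w))) (at z)"
    by (rule has_derivative_compose[where f = "\<lambda>y. (t, y)", OF _ D]) (auto intro!: derivative_eq_intros)
  then show ?thesis
  proof (rule has_derivative_transform_within_open)
    show "open (Pair t -` ?W)"
      by (rule open_vimage[OF time_slice_open[OF f c d]]) (intro continuous_intros)
    show "?L (t, y) = (snd d \<circ> (\<lambda>x. f (t, x)) \<circ> param c) y" if "y \<in> Pair t -` ?W" for y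
      using time_slice_eq[OF inj c, of t y f d] that by simp
  qed (use z in simp)
qed

section \<open>Real-linear maps of the complex plane\<close>

lemma linear_complex_eq:
  assumes "linear L"
  shows "L w = (L 1 - \<i> * L \<i>) / 2 * w + (L 1 + \<i> * L \<i>) / 2 * cnj w"
proof -
  have "L w = L (Re w *\<^sub>R 1 + Im w *\<^sub>R \<i>)"
    by (rule arg_cong[of _ _ L]) (simp add: complex_eq_iff)
  also have "\<dots> = Re w *\<^sub>R L 1 + Im w *\<^sub>R L \<i>"
    using assms by (simp add: linear_add linear_cmul)
  also have "\<dots> = (L 1 - \<i> * L \<i>) / 2 * w + (L 1 + \<i> * L \<i>) / 2 * cnj w"
    by (simp add: complex_eq_iff field_simps)
  finally show ?thesis .
qed

lemma has_derivative_wirt: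
  assumes "F differentiable (at z)"
  shows "(F has_derivative (\<lambda>w. wirt (\<lambda>w. w) F z * w + wirt_bar (\<lambda>w. w) F z * cnj w)) (at z)"
proof -
  have D: "(F has_derivative frechet_derivative F (at z)) (at z)"
    using assms frechet_derivative_works by blast
  have "frechet_derivative F (at z) = (\<lambda>w. wirt (\<lambda>w. w) F z * w + wirt_bar (\<lambda>w. w) F z * cnj w)"
    unfolding wirt_def wirt_bar_def by (rule ext, rule linear_complex_eq[OF has_derivative_linear[OF D]])
  with D show ?thesis by simp
qed

lemma wirt_eqI:
  assumes "(F has_derivative (\<lambda>w. a * w + b * cnj w)) (at z)"
  shows "wirt (\<lambda>w. w) F z = a" "wirt_bar (\<lambda>w. w) F z = b"
  unfolding wirt_def wirt_bar_def frechet_derivative_at[OF assms, symmetric]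
  by (simp_all add: algebra_simps)

text \<open>Pullback by w \<mapsto> a w + b cnj w acts on m by a fractional linear formula, and this
  is its composition law. Numerator and denominator are multiplied by the inner denominator, which
  is nonzero; if the outer one vanishes, both sides are 0 by the convention on division.\<close>

lemma beltrami_compose_formula:
  fixes a b m a' b' :: complex
  assumes "a + m * cnj b \<noteq> 0"
  defines "n \<equiv> (b + m * cnj a) / (a + m * cnj b)"
  shows "(b' + n * cnj a') / (a' + n * cnj b')
    = ((a * b' + b * cnj a') + m * cnj (a * a' + b * cnj b'))
      / ((a * a' + b * cnj b') + m * cnj (a * b' + b * cnj a'))"
proof -
  let ?D = "a + m * cnj b"
  have n: "?D * n = b + m * cnj a" using assms(1) by (simp add: n_def)
  have "(b' + n * cnj a') / (a' + n * cnj b') = (?D * (b' + n * cnj a')) / (?D * (a' + n * cnj b'))"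
    using assms(1) by simp
  also have "?D * (b' + n * cnj a') = ?D * b' + (?D * n) * cnj a'" by (simp add: algebra_simps)
  also have "\<dots> = (a * b' + b * cnj a') + m * cnj (a * a' + b * cnj b')"
    unfolding n by (simp add: algebra_simps)
  also have "?D * (a' + n * cnj b') = ?D * a' + (?D * n) * cnj b'" by (simp add: algebra_simps)
  also have "\<dots> = (a * a' + b * cnj b') + m * cnj (a * b' + b * cnj a')"
    unfolding n by (simp add: algebra_simps)
  finally show ?thesis .
qed

text \<open>Orientation enters here: \<open>cmod b < cmod a\<close> says that w \<mapsto> a w + b
  cnj w has positive determinant, and then m cnj b is too short to cancel a.\<close>

lemma beltrami_denominator_nonzero:
  fixes a b m :: complex
  assumes "cmod m < 1" "cmod b < cmod a"
  shows "a + m * cnj b \<noteq> 0"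
proof
  assume "a + m * cnj b = 0"
  then have "a = - (m * cnj b)" by (simp add: eq_neg_iff_add_eq_0)
  then have "cmod a = cmod m * cmod b" by (metis complex_mod_cnj norm_minus_cancel norm_mult)
  also have "\<dots> \<le> cmod b" using assms(1) by (simp add: mult_left_le_one_le)
  finally show False using assms(2) by simp
qed

context atlas_surface
begin

section \<open>Wirtinger derivatives and orientation in charts\<close>

definition wz :: "('a \<Rightarrow> 'a) \<Rightarrow> 'a cchart \<Rightarrow> 'a cchart \<Rightarrow> 'a \<Rightarrow> complex" where
  "wz f c d x = wirt (\<lambda>w. w) (snd d \<circ> f \<circ> param c) (snd c x)"

definition wzb :: "('a \<Rightarrow> 'a) \<Rightarrow> 'a cchart \<Rightarrow> 'a cchart \<Rightarrow> 'a \<Rightarrow> complex" where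
  "wzb f c d x = wirt_bar (\<lambda>w. w) (snd d \<circ> f \<circ> param c) (snd c x)"

lemma local_has_derivative:
  assumes f: "smooth_map A A f" and "c \<in> A" "d \<in> A" "x \<in> fst c" "f x \<in> fst d"
  shows "((snd d \<circ> f \<circ> param c) has_derivative (\<lambda>w. wz f c d x * w + wzb f c d x * cnj w)) (at (snd c x))"
  unfolding wz_def wzb_def
  by (intro has_derivative_wirt smooth_on_imp_differentiable[OF smooth_map_smooth_on[OF f]])
    (use assms in auto)

lemma wz_compose:
  assumes f: "smooth_map A A f" and g: "smooth_map A A g"
    and c: "c \<in> A" "d \<in> A" "e \<in> A" "x \<in> fst c" "f x \<in> fst d" "g (f x) \<in> fst e"
  shows "wz (\<lambda>x. g (f x)) c e x = wz g d e (f x) * wz f c d x + wzb g d e (f x) * cnj (wzb f c d x)"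
    and "wzb (\<lambda>x. g (f x)) c e x = wz g d e (f x) * wzb f c d x + wzb g d e (f x) * cnj (wz f c d x)"
proof -
  let ?F = "snd d \<circ> f \<circ> param c" and ?G = "snd e \<circ> g \<circ> param d"
  have G: "(?G has_derivative (\<lambda>w. wz g d e (f x) * w + wzb g d e (f x) * cnj w)) (at (?F (snd c x)))"
    using local_has_derivative[OF g c(2,3,5,6)] c by simp
  have "((\<lambda>z. ?G (?F z)) has_derivative (\<lambda>w. (wz g d e (f x) * wz f c d x + wzb g d e (f x) * cnj (wzb f c d x)) * w
      + (wz g d e (f x) * wzb f c d x + wzb g d e (f x) * cnj (wz f c d x)) * cnj w)) (at (snd c x))"
    using has_derivative_compose[OF local_has_derivative[OF f c(1,2,4,5)] G]
    by (rule has_derivative_eq_rhs) (simp add: fun_eq_iff algebra_simps)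
  then have *: "((snd e \<circ> (\<lambda>x. g (f x)) \<circ> param c) has_derivative (\<lambda>w. (wz g d e (f x) * wz f c d x + wzb g d e (f x) * cnj (wzb f c d x)) * w
      + (wz g d e (f x) * wzb f c d x + wzb g d e (f x) * cnj (wz f c d x)) * cnj w)) (at (snd c x))"
    by (rule has_derivative_transform_within_open[OF _ smooth_map_open[OF f c(1,2)]]) (use c in auto)
  show "wz (\<lambda>x. g (f x)) c e x = wz g d e (f x) * wz f c d x + wzb g d e (f x) * cnj (wzb f c d x)"
    and "wzb (\<lambda>x. g (f x)) c e x = wz g d e (f x) * wzb f c d x + wzb g d e (f x) * cnj (wz f c d x)"
    unfolding wz_def[of "\<lambda>x. g (f x)"] wzb_def[of "\<lambda>x. g (f x)"] by (rule wirt_eqI[OF *])+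
qed

lemma wz_ident:
  assumes "c \<in> A" "d \<in> A" "x \<in> fst c" "x \<in> fst d"
  shows "wz (\<lambda>x. x) c d x = trans_deriv c d x" "wzb (\<lambda>x. x) c d x = 0"
proof -
  have eq: "snd d \<circ> (\<lambda>x. x) \<circ> param c = snd d \<circ> param c" by auto
  have *: "((snd d \<circ> (\<lambda>x. x) \<circ> param c) has_derivative (\<lambda>w. trans_deriv c d x * w + 0 * cnj w)) (at (snd c x))"
    using trans_deriv_has_derivative[OF assms] unfolding eq has_field_derivative_def by simp
  show "wz (\<lambda>x. x) c d x = trans_deriv c d x" "wzb (\<lambda>x. x) c d x = 0"
    unfolding wz_def wzb_def by (rule wirt_eqI[OF *])+
qed

text \<open>The Jacobian determinant of the local expression, regarded as a map of the real
  plane.\<close>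

definition jac :: "('a \<Rightarrow> 'a) \<Rightarrow> 'a cchart \<Rightarrow> 'a cchart \<Rightarrow> 'a \<Rightarrow> real" where
  "jac f c d x = (cmod (wz f c d x))\<^sup>2 - (cmod (wzb f c d x))\<^sup>2"

lemma norm_diff_mult_formula:
  fixes a b c d :: complex
  shows "(cmod (a * c + b * cnj d))\<^sup>2 - (cmod (a * d + b * cnj c))\<^sup>2
     = ((cmod a)\<^sup>2 - (cmod b)\<^sup>2) * ((cmod c)\<^sup>2 - (cmod d)\<^sup>2)"
  by (simp only: cmod_power2) (simp add: power2_eq_square algebra_simps)

lemma jac_compose:
  assumes "smooth_map A A f" "smooth_map A A g"
    and "c \<in> A" "d \<in> A" "e \<in> A" "x \<in> fst c" "f x \<in> fst d" "g (f x) \<in> fst e"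
  shows "jac (\<lambda>x. g (f x)) c e x = jac g d e (f x) * jac f c d x"
  unfolding jac_def wz_compose[OF assms] norm_diff_mult_formula ..

text \<open>Transitions are holomorphic, so their determinant is the squared modulus of a
  nonvanishing complex derivative: all charts agree on the orientation.\<close>

lemma jac_ident:
  assumes "c \<in> A" "d \<in> A" "x \<in> fst c" "x \<in> fst d"
  shows "jac (\<lambda>x. x) c d x > 0"
  using trans_deriv_inverse(2)[OF assms] by (simp add: jac_def wz_ident[OF assms])

lemma diffeomorphism_inverse_eq:
  assumes "diffeomorphism A f"
  shows "inv_into UNIV f (f x) = x" "f (inv_into UNIV f x) = x"
  using diffeomorphism_bij[OF assms] by (auto simp: bij_betw_def surj_f_inv_f)

text \<open>By the chain rule the determinants of f and of its inverse multiply to the determinant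
  of the identity, which is positive.\<close>

lemma jac_nonzero:
  assumes f: "diffeomorphism A f" and "c \<in> A" "d \<in> A" "x \<in> fst c" "f x \<in> fst d"
  shows "jac f c d x \<noteq> 0"
proof -
  let ?h = "inv_into UNIV f"
  have "smooth_map A A f" "smooth_map A A ?h" using f by (auto simp: diffeomorphism_def)
  from jac_compose[OF this assms(2,3,2,4,5)] assms(4) diffeomorphism_inverse_eq[OF f]
  have "jac (\<lambda>x. x) c c x = jac ?h d c (f x) * jac f c d x" by simp
  with jac_ident[OF assms(2,2,4,4)] show ?thesis by auto
qed

lemma jac_target_chart:
  assumes f: "smooth_map A A f" and "c \<in> A" "d \<in> A" "e \<in> A" "x \<in> fst c" "f x \<in> fst d" "f x \<in> fst e"
  shows "jac f c e x > 0 \<longleftrightarrow> jac f c d x > 0"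
proof -
  have "jac f c e x = jac (\<lambda>x. x) d e (f x) * jac f c d x"
    using jac_compose[OF f smooth_map_A_ident assms(2-)] by simp
  with jac_ident[OF assms(3,4,6,7)] show ?thesis by (simp add: zero_less_mult_iff)
qed

text \<open>At a fixed point the determinant depends continuously on time and never vanishes, so its
  sign is locally constant; the real line is connected, and at time 0 the sign is that of the
  identity.\<close>

lemma isotopy_jac_pos:
  assumes \<Phi>: "isotopy A \<Phi>" and c: "c \<in> A" "x \<in> fst c" and d: "d \<in> A" "\<Phi> t x \<in> fst d"
  shows "jac (\<Phi> t) c d x > 0"
proof -
  \<comment> \<open>No single target chart contains the whole path of x. Quantifying over all of
    them makes P a property of time alone, and \<open>Piff\<close> allows it to be tested in any one
    admissible chart.\<close>
  define P where "P t \<longleftrightarrow> (\<forall>d\<in>A. \<Phi> t x \<in> fst d \<longrightarrow> jac (\<Phi> t) c d x > 0)" for t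
  have sm: "smooth_map A A (\<Phi> t)" for t
    using isotopy_diffeomorphism[OF \<Phi>] by (simp add: diffeomorphism_def)
  have Piff: "P t \<longleftrightarrow> jac (\<Phi> t) c d x > 0" if "d \<in> A" "\<Phi> t x \<in> fst d" for t d
    using jac_target_chart[OF sm c(1) that(1) _ c(2) that(2)] that unfolding P_def by blast
  define f where "f p = \<Phi> (fst p) (snd p)" for p
  have f: "smooth_map (time_atlas A) A f"
    using isotopy_smooth[OF \<Phi>] by (simp add: f_def[abs_def])
  have ev: "\<forall>\<^sub>F t in at t0. P t0 = P t" for t0
  proof -
    obtain d where d: "d \<in> A" "\<Phi> t0 x \<in> fst d" by (rule chart_around)
    let ?W = "snd (time_chart c) ` (fst (time_chart c) \<inter> f -` fst d)"
    let ?L = "snd d \<circ> f \<circ> param (time_chart c)" and ?z = "snd c x"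
    let ?D = "\<lambda>t. frechet_derivative ?L (at (t, ?z))"
    let ?a = "\<lambda>t. (?D t (0, 1) - \<i> * ?D t (0, \<i>)) / 2" and ?b = "\<lambda>t. (?D t (0, 1) + \<i> * ?D t (0, \<i>)) / 2"
    let ?j = "\<lambda>t. (cmod (?a t))\<^sup>2 - (cmod (?b t))\<^sup>2"
    define V where "V = (\<lambda>t. (t, ?z)) -` ?W"
    have V: "open V" unfolding V_def
      by (rule open_vimage[OF time_slice_open[OF f c(1) d(1)]]) (intro continuous_intros)
    have t0: "t0 \<in> V" using d c mem_time_slice[of x c f t0 d] by (simp add: V_def f_def)
    have contD: "continuous_on V (\<lambda>t. ?D t w)" for w
      by (rule continuous_on_compose2[OF smooth_on_imp_continuous_on[OF smooth_on_frechet_derivative[OF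
            time_slice_smooth_on[OF f c(1) d(1)]], of w]])
        (auto simp: V_def intro!: continuous_intros)
    have jac: "jac (\<Phi> t) c d x = ?j t" "\<Phi> t x \<in> fst d" if "t \<in> V" for t
    proof -
      have "(t, ?z) \<in> ?W" using that by (simp add: V_def)
      from time_slice_has_derivative[OF inj_charts_A f c(1) d(1) this]
      have *: "((snd d \<circ> \<Phi> t \<circ> param c) has_derivative (\<lambda>w. ?D t (0, w))) (at ?z)"
        by (simp add: f_def[abs_def])
      show "jac (\<Phi> t) c d x = ?j t"
        unfolding jac_def wz_def wzb_def wirt_def wirt_bar_def frechet_derivative_at[OF *, symmetric] ..
      from \<open>(t, ?z) \<in> ?W\<close> obtain x' where "x' \<in> fst c" "snd c x' = snd c x" "\<Phi> t x' \<in> fst d"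
        by (auto simp: f_def)
      with c show "\<Phi> t x \<in> fst d" using inj_chartsD[OF inj_charts_A c(1)] by (auto dest: inj_onD)
    qed
    have "continuous_on V ?j" by (intro continuous_intros contD) auto
    then have lim: "(?j \<longlongrightarrow> ?j t0) (at t0)"
      using V t0 by (simp add: continuous_on_eq_continuous_at isCont_def)
    have inV: "\<forall>\<^sub>F t in at t0. t \<in> V" using V t0 eventually_at_in_open' by blast
    have "?j t0 \<noteq> 0"
      using jac_nonzero[OF isotopy_diffeomorphism[OF \<Phi>, of t0] c(1) d(1) c(2) d(2)] jac(1)[OF t0] by simp
    then consider "?j t0 > 0" | "?j t0 < 0" by linarith
    then show ?thesis
    proof cases
      case 1
      have "\<forall>\<^sub>F t in at t0. ?j t > 0" by (rule order_tendstoD(1)[OF lim 1])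
      then show ?thesis using inV
        by eventually_elim (use jac t0 1 Piff[OF d(1)] in simp)
    next
      case 2
      have "\<forall>\<^sub>F t in at t0. ?j t < 0" by (rule order_tendstoD(2)[OF lim 2])
      then show ?thesis using inV
        by eventually_elim (use jac t0 2 Piff[OF d(1)] in simp)
    qed
  qed
  have "P 0 = P t"
    by (rule connected_local_const[of UNIV]) (use ev in auto)
  moreover have "P 0"
  proof -
    have "\<Phi> 0 = (\<lambda>x. x)" using isotopy_0[OF \<Phi>] by auto
    then show ?thesis using jac_ident[OF c(1) _ c(2)] by (simp add: P_def)
  qed
  ultimately show ?thesis using d by (simp add: P_def)
qed

lemma isotopic_to_id_jac_pos:
  "f \<in> diffeos_isotopic_to_id A \<Longrightarrow> c \<in> A \<Longrightarrow> x \<in> fst c \<Longrightarrow> d \<in> A \<Longrightarrow> f x \<in> fst d \<Longrightarrow> jac f c d x > 0"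
  by (auto simp: diffeos_isotopic_to_id_def intro: isotopy_jac_pos)

lemma isotopic_to_id_diffeomorphism: "f \<in> diffeos_isotopic_to_id A \<Longrightarrow> diffeomorphism A f"
  by (auto simp: diffeos_isotopic_to_id_def intro: isotopy_diffeomorphism)

lemma isotopic_to_id_compose:
  assumes "f \<in> diffeos_isotopic_to_id A" "g \<in> diffeos_isotopic_to_id A"
  shows "(\<lambda>x. g (f x)) \<in> diffeos_isotopic_to_id A"
proof -
  obtain \<Phi> \<Psi> where "isotopy A \<Phi>" "f = \<Phi> 1" "isotopy A \<Psi>" "g = \<Psi> 1"
    using assms by (auto simp: diffeos_isotopic_to_id_def)
  then show ?thesis
    using isotopy_compose[OF inj_charts_A, of \<Psi> \<Phi>] unfolding diffeos_isotopic_to_id_def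
    by (intro CollectI exI[of _ "\<lambda>t x. \<Psi> t (\<Phi> t x)"]) simp
qed

lemma isotopic_to_id_inv:
  assumes "f \<in> diffeos_isotopic_to_id A"
  shows "inv_into UNIV f \<in> diffeos_isotopic_to_id A"
proof -
  obtain \<Phi> where \<Phi>: "isotopy A \<Phi>" "f = \<Phi> 1" using assms by (auto simp: diffeos_isotopic_to_id_def)
  let ?\<Psi> = "\<lambda>t x. \<Phi> (1 - t) (inv_into UNIV (\<Phi> 1) x)"
  have "inv_into UNIV f = ?\<Psi> 1"
    using isotopy_0[OF \<Phi>(1)] \<Phi>(2) by auto
  moreover have "isotopy A ?\<Psi>"
    using isotopy_inv[OF inj_charts_A \<Phi>(1)] by simp
  ultimately show ?thesis unfolding diffeos_isotopic_to_id_def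
    by (intro CollectI exI[of _ ?\<Psi>]) simp
qed

section \<open>Pullback of Beltrami differentials\<close>

lemma beltrami_pullback_eq:
  "beltrami_pullback A f \<mu> \<nu> \<longleftrightarrow> (\<forall>c\<in>A. \<forall>d\<in>A. \<forall>x\<in>fst c. f x \<in> fst d \<longrightarrow>
    \<nu> c x = (wzb f c d x + \<mu> d (f x) * cnj (wz f c d x)) / (wz f c d x + \<mu> d (f x) * cnj (wzb f c d x)))"
  unfolding beltrami_pullback_def wz_def wzb_def Let_def ..

lemma beltrami_norm_less: "\<mu> \<in> beltrami_differentials A \<Longrightarrow> c \<in> A \<Longrightarrow> x \<in> fst c \<Longrightarrow> cmod (\<mu> c x) < 1"
  unfolding beltrami_differentials_def by blast

text \<open>The common core of transitivity and symmetry: for the former g is the second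
  diffeomorphism, for the latter it is the inverse of f. Positivity of the determinant of f makes
  the inner denominator nonzero.\<close>

lemma beltrami_pullback_compose_formula:
  assumes f: "f \<in> diffeos_isotopic_to_id A" and g: "smooth_map A A g" and \<mu>: "\<mu> \<in> beltrami_differentials A"
    and fp: "beltrami_pullback A f \<mu> \<nu>"
    and c: "c \<in> A" "d \<in> A" "e \<in> A" "x \<in> fst c" "g x \<in> fst d" "f (g x) \<in> fst e"
  shows "(wzb g c d x + \<nu> d (g x) * cnj (wz g c d x)) / (wz g c d x + \<nu> d (g x) * cnj (wzb g c d x))
    = (wzb (\<lambda>x. f (g x)) c e x + \<mu> e (f (g x)) * cnj (wz (\<lambda>x. f (g x)) c e x))
      / (wz (\<lambda>x. f (g x)) c e x + \<mu> e (f (g x)) * cnj (wzb (\<lambda>x. f (g x)) c e x))"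
proof -
  let ?m = "\<mu> e (f (g x))" and ?a = "wz f d e (g x)" and ?b = "wzb f d e (g x)"
  have "cmod ?b < cmod ?a"
    using isotopic_to_id_jac_pos[OF f c(2,5,3,6)] by (simp add: jac_def power_less_imp_less_base)
  then have "?a + ?m * cnj ?b \<noteq> 0"
    by (intro beltrami_denominator_nonzero beltrami_norm_less[OF \<mu> c(3,6)])
  moreover have "\<nu> d (g x) = (?b + ?m * cnj ?a) / (?a + ?m * cnj ?b)"
    using fp c unfolding beltrami_pullback_eq by blast
  moreover have sf: "smooth_map A A f"
    using isotopic_to_id_diffeomorphism[OF f] by (simp add: diffeomorphism_def)
  ultimately show ?thesis
    using beltrami_compose_formula[of ?a ?m ?b "wzb g c d x" "wz g c d x"]
      wz_compose[where f = g and g = f, OF g sf c] by simp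
qed

lemma trans_teichmueller_rel: "trans (teichmueller_rel A)"
proof (rule transI)
  fix \<mu> \<nu> \<kappa> assume "(\<mu>, \<nu>) \<in> teichmueller_rel A" "(\<nu>, \<kappa>) \<in> teichmueller_rel A"
  then obtain f g where b: "\<mu> \<in> beltrami_differentials A" "\<nu> \<in> beltrami_differentials A" "\<kappa> \<in> beltrami_differentials A"
    and f: "f \<in> diffeos_isotopic_to_id A" "beltrami_pullback A f \<mu> \<nu>"
    and g: "g \<in> diffeos_isotopic_to_id A" "beltrami_pullback A g \<nu> \<kappa>"
    by (auto simp: teichmueller_rel_def)
  have sg: "smooth_map A A g"
    using isotopic_to_id_diffeomorphism[OF g(1)] by (simp add: diffeomorphism_def)
  have "beltrami_pullback A (\<lambda>x. f (g x)) \<mu> \<kappa>"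
    unfolding beltrami_pullback_eq
  proof (intro ballI impI)
    fix c e x assume c: "c \<in> A" "e \<in> A" "x \<in> fst c" "f (g x) \<in> fst e"
    obtain d where d: "d \<in> A" "g x \<in> fst d" by (rule chart_around)
    have "\<kappa> c x = (wzb g c d x + \<nu> d (g x) * cnj (wz g c d x)) / (wz g c d x + \<nu> d (g x) * cnj (wzb g c d x))"
      using g(2) c d unfolding beltrami_pullback_eq by blast
    then show "\<kappa> c x = (wzb (\<lambda>x. f (g x)) c e x + \<mu> e (f (g x)) * cnj (wz (\<lambda>x. f (g x)) c e x))
      / (wz (\<lambda>x. f (g x)) c e x + \<mu> e (f (g x)) * cnj (wzb (\<lambda>x. f (g x)) c e x))"
      using beltrami_pullback_compose_formula[OF f(1) sg b(1) f(2) c(1) d(1) c(2,3) d(2) c(4)] by simp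
  qed
  then show "(\<mu>, \<kappa>) \<in> teichmueller_rel A"
    unfolding teichmueller_rel_def using b isotopic_to_id_compose[OF g(1) f(1)] by auto
qed

lemma sym_teichmueller_rel: "sym (teichmueller_rel A)"
proof (rule symI)
  fix \<mu> \<nu> assume "(\<mu>, \<nu>) \<in> teichmueller_rel A"
  then obtain f where b: "\<mu> \<in> beltrami_differentials A" "\<nu> \<in> beltrami_differentials A"
    and f: "f \<in> diffeos_isotopic_to_id A" "beltrami_pullback A f \<mu> \<nu>"
    by (auto simp: teichmueller_rel_def)
  let ?g = "inv_into UNIV f"
  note df = isotopic_to_id_diffeomorphism[OF f(1)]
  have sg: "smooth_map A A ?g"
    using df by (simp add: diffeomorphism_def)
  note fg = diffeomorphism_inverse_eq(2)[OF df]
  have "beltrami_pullback A ?g \<nu> \<mu>"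
    unfolding beltrami_pullback_eq
  proof (intro ballI impI)
    fix c d x assume c: "c \<in> A" "d \<in> A" "x \<in> fst c" "?g x \<in> fst d"
    \<comment> \<open>As f undoes \<open>?g\<close>, the chart c itself can serve as target chart of
      the composite. There the derivatives of the identity are 1 and 0, and the pulled back
      coefficient reduces to \<open>\<mu> c x\<close>.\<close>
    have "f (?g x) \<in> fst c" using c fg by simp
    from beltrami_pullback_compose_formula[OF f(1) sg b(1) f(2) c(1,2,1,3,4) this]
    show "\<mu> c x = (wzb ?g c d x + \<nu> d (?g x) * cnj (wz ?g c d x)) / (wz ?g c d x + \<nu> d (?g x) * cnj (wzb ?g c d x))"
      using wz_ident[OF c(1,1,3,3)] c by (simp add: fg)
  qed
  then show "(\<nu>, \<mu>) \<in> teichmueller_rel A"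
    unfolding teichmueller_rel_def using b isotopic_to_id_inv[OF f(1)] by auto
qed

end

section \<open>Hamiltonian flows\<close>

text \<open>The canonical symplectic form, up to a constant factor.\<close>

definition sform :: "complex \<times> complex \<Rightarrow> complex \<times> complex \<Rightarrow> real" where
  "sform X Y = Re (snd X * fst Y - fst X * snd Y)"

lemma sform_antisym: "sform X Y = - sform Y X"
  by (simp add: sform_def algebra_simps)

lemma bounded_linear_sform_left: "bounded_linear (\<lambda>X. sform X Y)"
  unfolding sform_def
  by (intro bounded_linear_compose[OF bounded_linear_Re] bounded_linear_sub
      bounded_linear_compose[OF bounded_linear_mult_left] bounded_linear_fst bounded_linear_snd)

lemma has_derivative_sform:
  assumes "(X has_vector_derivative X') (at t)" "(Y has_vector_derivative Y') (at t)"
  shows "((\<lambda>t. sform (X t) (Y t)) has_vector_derivative (sform X' (Y t) + sform (X t) Y')) (at t)"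
proof -
  note b = bounded_linear.has_vector_derivative[OF bounded_linear_fst] bounded_linear.has_vector_derivative[OF bounded_linear_snd]
  have "((\<lambda>t. snd (X t) * fst (Y t) - fst (X t) * snd (Y t)) has_vector_derivative
    (snd (X t) * fst Y' + snd X' * fst (Y t)) - (fst (X t) * snd Y' + fst X' * snd (Y t))) (at t)"
    by (intro has_vector_derivative_diff has_vector_derivative_mult b assms)
  from bounded_linear.has_vector_derivative[OF bounded_linear_Re this] show ?thesis
    by (simp add: sform_def algebra_simps)
qed

text \<open>The Hamiltonian vector field \<open>(\<partial>\<^sub>p k, - \<partial>\<^sub>z k)\<close> of a real function.\<close>

definition hvec :: "(complex \<times> complex \<Rightarrow> real) \<Rightarrow> complex \<times> complex \<Rightarrow> complex \<times> complex" where
  "hvec k q = (let D = frechet_derivative k (at q) in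
     ((complex_of_real (D (0, 1)) - \<i> * complex_of_real (D (0, \<i>))) / 2,
      - ((complex_of_real (D (1, 0)) - \<i> * complex_of_real (D (\<i>, 0))) / 2)))"

text \<open>The conjugate derivatives of the coordinates z and p vanish, so only the unbarred half
  of the bracket survives.\<close>

lemma poisson_coordinates:
  assumes "k differentiable (at q)"
  shows "(poisson (complex_of_real \<circ> k) fst q, poisson (complex_of_real \<circ> k) snd q) = hvec k q"
proof -
  have k: "frechet_derivative (complex_of_real \<circ> k) (at q) v = complex_of_real (frechet_derivative k (at q) v)" for v
    using frechet_derivative_linear_compose[OF bounded_linear_of_real assms] by (simp add: o_def)
  have fs: "frechet_derivative fst (at q) = (fst :: complex \<times> complex \<Rightarrow> complex)"
    "frechet_derivative snd (at q) = (snd :: complex \<times> complex \<Rightarrow> complex)"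
    by (intro frechet_derivative_at[symmetric] bounded_linear_imp_has_derivative
        bounded_linear_fst bounded_linear_snd)+
  show ?thesis
    by (simp add: poisson_def wirt_def wirt_bar_def k fs hvec_def Let_def)
qed

text \<open>The characteristic property of a Hamiltonian field: contracted with the symplectic form
  it gives - dk. The factor 1/2 arises because the differential of p dz + cnj p d(cnj z) is twice
  \<open>sform\<close>.\<close>

lemma sform_hvec:
  assumes "k differentiable (at q)"
  shows "sform (hvec k q) Y = - frechet_derivative k (at q) Y / 2"
proof -
  let ?D = "frechet_derivative k (at q)"
  have lin: "linear ?D" using assms by (rule linear_frechet_derivative)
  have "?D Y = ?D (Re (fst Y) *\<^sub>R (1, 0) + Im (fst Y) *\<^sub>R (\<i>, 0) + Re (snd Y) *\<^sub>R (0, 1) + Im (snd Y) *\<^sub>R (0, \<i>))"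
    by (rule arg_cong[of _ _ ?D]) (simp add: prod_eq_iff complex_eq_iff)
  also have "\<dots> = Re (fst Y) * ?D (1, 0) + Im (fst Y) * ?D (\<i>, 0) + Re (snd Y) * ?D (0, 1) + Im (snd Y) * ?D (0, \<i>)"
    by (simp only: linear_add[OF lin] linear_cmul[OF lin] real_scaleR_def)
  finally show ?thesis
    by (simp add: sform_def hvec_def Let_def field_simps)
qed

lemma smooth_on_hvec:
  assumes S: "open S" and k: "smooth_on S k"
  shows "smooth_on S (hvec k)"
proof -
  have *: "smooth_on S (\<lambda>q. (complex_of_real (frechet_derivative k (at q) v) - \<i> * complex_of_real (frechet_derivative k (at q) w)) / 2)"
    for v w
  proof -
    have "smooth_on S (\<lambda>q. complex_of_real (frechet_derivative k (at q) v) * (1 / 2)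
        + complex_of_real (frechet_derivative k (at q) w) * (- \<i> / 2))"
      by (intro smooth_on_add smooth_on_mult smooth_on_const S
          smooth_on_linear_compose[OF bounded_linear_of_real] smooth_on_frechet_derivative k)
    then show ?thesis
      by (rule smooth_on_cong[OF S, rotated]) (simp add: field_simps)
  qed
  show ?thesis unfolding hvec_def[abs_def] Let_def
    by (intro smooth_on_Pair smooth_on_minus S *)
qed

text \<open>Differentiating \<open>sform_hvec\<close> shows that \<open>sform (D X) Y\<close> is
  -1/2 times the Hessian of k at (X, Y). The Hessian is symmetric and \<open>sform\<close>
  antisymmetric, so the two terms cancel: the field is infinitesimally symplectic.\<close>

lemma hvec_derivative_symmetric:
  assumes S: "open S" "q \<in> S" and k: "smooth_on S k"
  defines "D \<equiv> frechet_derivative (hvec k) (at q)"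
  shows "sform (D X) Y + sform X (D Y) = 0"
proof -
  have *: "sform (D X) Y = - frechet_derivative (\<lambda>q. frechet_derivative k (at q) Y) (at q) X / 2" for X Y
  proof -
    have 1: "((\<lambda>q. sform (hvec k q) Y) has_derivative (\<lambda>X. sform (D X) Y)) (at q)"
      unfolding D_def
      by (rule bounded_linear.has_derivative[OF bounded_linear_sform_left
            smooth_on_imp_has_derivative[OF smooth_on_hvec[OF S(1) k] S(2)]])
    have "((\<lambda>q. frechet_derivative k (at q) Y) has_derivative
        frechet_derivative (\<lambda>q. frechet_derivative k (at q) Y) (at q)) (at q)"
      by (rule smooth_on_imp_has_derivative[OF smooth_on_frechet_derivative[OF k] S(2)])
    from bounded_linear.has_derivative[OF bounded_linear_mult_right[of "-1/2"] this]
    have "((\<lambda>q. sform (hvec k q) Y) has_derivative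
        (\<lambda>X. -1/2 * frechet_derivative (\<lambda>q. frechet_derivative k (at q) Y) (at q) X)) (at q)"
      by (rule has_derivative_transform_within_open[OF _ S])
        (simp add: sform_hvec[OF smooth_on_imp_differentiable[OF k]])
    from fun_cong[OF has_derivative_unique[OF 1 this], of X] show ?thesis by simp
  qed
  have "sform X (D Y) = - sform (D Y) X" by (rule sform_antisym)
  then show ?thesis
    by (simp add: * smooth_on_mixed_derivative_real[OF S k, of Y X])
qed

text \<open>The variational equation; it follows from the symmetry of mixed second derivatives.\<close>

lemma flow_derivative_evolution:
  fixes L :: "real \<times> 'e::euclidean_space \<Rightarrow> 'f::euclidean_space" and V :: "'f \<Rightarrow> 'f"
  assumes W: "open W" "smooth_on W L" "(t, q) \<in> W" and V: "V differentiable (at (L (t, q)))"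
    and flow: "\<And>q'. (t, q') \<in> W \<Longrightarrow> frechet_derivative L (at (t, q')) (1, 0) = V (L (t, q'))"
  shows "((\<lambda>s. frechet_derivative L (at (s, q)) (0, u)) has_vector_derivative
    frechet_derivative V (at (L (t, q))) (frechet_derivative L (at (t, q)) (0, u))) (at t)"
proof -
  let ?DL = "\<lambda>w p. frechet_derivative L (at p) w"
  have D: "(?DL w has_derivative frechet_derivative (?DL w) (at (t, q))) (at (t, q))" for w
    by (rule smooth_on_imp_has_derivative[OF smooth_on_frechet_derivative[OF W(2)] W(3)])
  have 1: "((\<lambda>s. ?DL (0, u) (s, q)) has_derivative (\<lambda>r. frechet_derivative (?DL (0, u)) (at (t, q)) (r, 0))) (at t)"
    by (rule has_derivative_compose[where f = "\<lambda>s. (s, q)", OF _ D]) (auto intro!: derivative_eq_intros)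
  have 2: "frechet_derivative (?DL (0, u)) (at (t, q)) (r, 0)
      = r *\<^sub>R frechet_derivative (?DL (0, u)) (at (t, q)) (1, 0)" for r
    using linear_cmul[OF has_derivative_linear[OF D], of "(0, u)" r "(1, 0)"] by simp
  \<comment> \<open>Facts 3 and 4 differentiate the velocity in the spatial variable in two ways: as
    a second derivative of L, and by the chain rule through V.\<close>
  have 3: "((\<lambda>q'. ?DL (1, 0) (t, q')) has_derivative (\<lambda>u. frechet_derivative (?DL (1, 0)) (at (t, q)) (0, u))) (at q)"
    by (rule has_derivative_compose[where f = "\<lambda>q'. (t, q')", OF _ D]) (auto intro!: derivative_eq_intros)
  have "((\<lambda>q'. L (t, q')) has_derivative (\<lambda>u. frechet_derivative L (at (t, q)) (0, u))) (at q)"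
    by (rule has_derivative_compose[where f = "\<lambda>q'. (t, q')", OF _ smooth_on_imp_has_derivative[OF W(2,3)]])
      (auto intro!: derivative_eq_intros)
  from has_derivative_compose[OF this V[THEN frechet_derivative_works[THEN iffD1]]]
  have 4: "((\<lambda>q'. ?DL (1, 0) (t, q')) has_derivative
      (\<lambda>u. frechet_derivative V (at (L (t, q))) (?DL (0, u) (t, q)))) (at q)"
  proof (rule has_derivative_transform_within_open)
    show "open (Pair t -` W)" by (rule open_vimage[OF W(1)]) (intro continuous_intros)
  qed (use W(3) flow in auto)
  have "frechet_derivative (?DL (0, u)) (at (t, q)) (1, 0)
      = frechet_derivative (?DL (1, 0)) (at (t, q)) (0, u)"
    by (rule smooth_on_mixed_derivative[OF W(1,3,2)])
  also have "\<dots> = frechet_derivative V (at (L (t, q))) (?DL (0, u) (t, q))"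
    using has_derivative_unique[OF 3 4] by (rule fun_cong)
  finally have 5: "frechet_derivative (?DL (0, u)) (at (t, q)) (1, 0) = \<dots>" .
  have "(\<lambda>r. frechet_derivative (?DL (0, u)) (at (t, q)) (r, 0))
      = (\<lambda>r. r *\<^sub>R frechet_derivative V (at (L (t, q))) (?DL (0, u) (t, q)))"
    by (rule ext, subst 2, subst 5, rule refl)
  with 1 show ?thesis by (simp only: has_vector_derivative_def)
qed

text \<open>By the product rule and the variational equation the derivative is \<open>sform\<close>
  of (D X, Y) plus \<open>sform\<close> of (X, D Y), where D is the derivative of the Hamiltonian
  field; this sum vanishes.\<close>

lemma hamiltonian_flow_sform_derivative:
  fixes L :: "real \<times> complex \<times> complex \<Rightarrow> complex \<times> complex"
  assumes W: "open W" "smooth_on W L" "(t, q) \<in> W" and S: "open S" "smooth_on S k" "L (t, q) \<in> S"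
    and flow: "\<And>q'. (t, q') \<in> W \<Longrightarrow> frechet_derivative L (at (t, q')) (1, 0) = hvec k (L (t, q'))"
  shows "((\<lambda>s. sform (frechet_derivative L (at (s, q)) (0, u)) (frechet_derivative L (at (s, q)) (0, v)))
    has_real_derivative 0) (at t)"
proof -
  have "hvec k differentiable (at (L (t, q)))"
    by (rule smooth_on_imp_differentiable[OF smooth_on_hvec[OF S(1,2)] S(3)])
  from has_derivative_sform[OF flow_derivative_evolution[OF W this flow, of u]
      flow_derivative_evolution[OF W this flow, of v]]
  show ?thesis
    by (simp add: hvec_derivative_symmetric[OF S(1,3,2)] has_real_derivative_iff_has_vector_derivative)
qed

context atlas_surface
begin

section \<open>Invariance of the symplectic form\<close>

definition cotD :: "('a covector \<Rightarrow> 'a covector) \<Rightarrow> 'a cchart \<Rightarrow> 'a cchart \<Rightarrow> 'a covector \<Rightarrow> complex \<times> complex \<Rightarrow> complex \<times> complex" where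
  "cotD \<phi> c d m = frechet_derivative (snd (cot_chart A d) \<circ> \<phi> \<circ> param (cot_chart A c)) (at (snd (cot_chart A c) m))"

lemma param_cot_chart_chart [simp]:
  "c \<in> A \<Longrightarrow> m \<in> cotangent A \<Longrightarrow> fst m \<in> fst c \<Longrightarrow> param (cot_chart A c) (snd c (fst m), snd m c) = m"
  using inv_into_f_f[OF inj_on_cot_chart, of c m] by simp

lemma smooth_cot_has_derivative:
  assumes \<phi>: "smooth_map (cot_atlas A) (cot_atlas A) \<phi>" and c: "c \<in> A" "d \<in> A"
    and m: "m \<in> cotangent A" "fst m \<in> fst c" "fst (\<phi> m) \<in> fst d"
  shows "((snd (cot_chart A d) \<circ> \<phi> \<circ> param (cot_chart A c)) has_derivative cotD \<phi> c d m) (at (snd (cot_chart A c) m))"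
proof -
  have "\<phi> m \<in> cotangent A" using smooth_map_points[OF \<phi>] m by simp
  then show ?thesis unfolding cotD_def
    by (intro smooth_on_imp_has_derivative[OF smooth_map_smooth_on[OF \<phi>]])
      (use c m in \<open>simp_all del: snd_cot_chart\<close>)
qed

text \<open>The factors T' and 1/T' cancel, and the term with the second derivative of T is
  symmetric in the base components of X and Y, so it drops out of the antisymmetric form.\<close>

lemma cot_trans_sform:
  assumes c: "c \<in> A" "d \<in> A" and q: "fst q \<in> snd c ` (fst c \<inter> fst d)"
  shows "\<exists>D. (cot_trans c d has_derivative D) (at q) \<and> (\<forall>X Y. sform (D X) (D Y) = sform X Y)"
proof -
  let ?T = "snd d \<circ> param c"
  let ?T' = "deriv ?T" and ?z = "fst q"
  note hol = transition_holomorphic[OF c] and op = open_overlap[OF c]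
  have T: "(?T has_field_derivative ?T' ?z) (at ?z)"
    by (rule holomorphic_derivI[OF hol op q])
  have T': "(?T' has_field_derivative deriv ?T' ?z) (at ?z)"
    by (rule holomorphic_derivI[OF holomorphic_deriv[OF hol op] op q])
  have nz: "?T' ?z \<noteq> 0" by (rule deriv_transition_nonzero[OF c q])
  have I: "((\<lambda>z. inverse (?T' z)) has_field_derivative - (deriv ?T' ?z / (?T' ?z)\<^sup>2)) (at ?z)"
    using DERIV_inverse_fun[OF T' nz] by (simp add: power2_eq_square divide_inverse mult.commute del: o_apply)
  let ?D = "\<lambda>X::complex \<times> complex. (?T' ?z * fst X, snd q * (- (deriv ?T' ?z / (?T' ?z)\<^sup>2) * fst X) + snd X * inverse (?T' ?z))"
  have f: "((\<lambda>q::complex \<times> complex. fst q) has_derivative fst) (at q)"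
    and s: "((\<lambda>q::complex \<times> complex. snd q) has_derivative snd) (at q)"
    by (intro bounded_linear_imp_has_derivative bounded_linear_fst bounded_linear_snd)+
  have "(cot_trans c d has_derivative ?D) (at q)"
    unfolding cot_trans_def[abs_def]
    by (intro has_derivative_Pair has_derivative_mult s
        has_derivative_compose[OF f T[unfolded has_field_derivative_def]]
        has_derivative_compose[OF f I[unfolded has_field_derivative_def]])
  moreover have "sform (?D X) (?D Y) = sform X Y" for X Y
  proof -
    have "snd (?D X) * fst (?D Y) - fst (?D X) * snd (?D Y) = snd X * fst Y - fst X * snd Y"
      using nz by (simp add: field_simps power2_eq_square)
    then show ?thesis unfolding sform_def by (rule arg_cong)
  qed
  ultimately show ?thesis by blast
qed

lemma sform_cotD_target_chart:
  assumes \<phi>: "smooth_map (cot_atlas A) (cot_atlas A) \<phi>" and c: "c \<in> A" "d \<in> A" "e \<in> A"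
    and m: "m \<in> cotangent A" "fst m \<in> fst c" "fst (\<phi> m) \<in> fst d" "fst (\<phi> m) \<in> fst e"
  shows "sform (cotD \<phi> c e m u) (cotD \<phi> c e m v) = sform (cotD \<phi> c d m u) (cotD \<phi> c d m v)"
proof -
  let ?C = "cot_chart A c" and ?D = "cot_chart A d" and ?E = "cot_chart A e"
  have \<phi>m: "\<phi> m \<in> cotangent A" using smooth_map_points[OF \<phi>] m by simp
  obtain T where T: "(cot_trans d e has_derivative T) (at (snd ?D (\<phi> m)))" and sT: "\<And>X Y. sform (T X) (T Y) = sform X Y"
    using cot_trans_sform[OF c(2,3), of "snd ?D (\<phi> m)"] m by auto
  have eq: "(snd ?D \<circ> \<phi> \<circ> param ?C) (snd ?C m) = snd ?D (\<phi> m)" using c m by simp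
  have "((\<lambda>q. cot_trans d e ((snd ?D \<circ> \<phi> \<circ> param ?C) q)) has_derivative (\<lambda>u. T (cotD \<phi> c d m u))) (at (snd ?C m))"
    by (rule has_derivative_compose[OF smooth_cot_has_derivative[OF \<phi> c(1,2) m(1,2,3)]]) (unfold eq, rule T)
  then have "((snd ?E \<circ> \<phi> \<circ> param ?C) has_derivative (\<lambda>u. T (cotD \<phi> c d m u))) (at (snd ?C m))"
  proof (rule has_derivative_transform_within_open)
    let ?U = "snd ?C ` (fst ?C \<inter> \<phi> -` fst ?D) \<inter> snd ?C ` (fst ?C \<inter> \<phi> -` fst ?E)"
    show "open ?U" by (intro open_Int smooth_map_open[OF \<phi>] cot_chart_in c)
    show "snd ?C m \<in> ?U" using c m \<phi>m by (simp del: snd_cot_chart)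
    fix q assume "q \<in> ?U"
    then obtain m1 m2 where "q = snd ?C m1" "m1 \<in> fst ?C" "\<phi> m1 \<in> fst ?D" "q = snd ?C m2" "m2 \<in> fst ?C" "\<phi> m2 \<in> fst ?E"
      by blast
    moreover from this have "m1 = m2" using inj_on_cot_chart[OF c(1)] by (metis inj_onD)
    ultimately show "cot_trans d e ((snd ?D \<circ> \<phi> \<circ> param ?C) q) = (snd ?E \<circ> \<phi> \<circ> param ?C) q"
      using cot_trans_eq[OF c(2,3), of "\<phi> m1"] c by simp
  qed
  then have "cotD \<phi> c e m = (\<lambda>u. T (cotD \<phi> c d m u))"
    unfolding cotD_def[of _ _ e] by (rule frechet_derivative_at[symmetric])
  then show ?thesis by (simp add: sT)
qed

lemma hamiltonian_isotopy_isotopy: "hamiltonian_isotopy A H \<Phi> \<Longrightarrow> isotopy (cot_atlas A) \<Phi>"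
  by (simp add: hamiltonian_isotopy_def)

lemma hamiltonian_slice_smooth:
  assumes H: "hamiltonian_isotopy A H \<Phi>" and d: "d \<in> A"
  shows "smooth_on (snd (cot_chart A d) ` fst (cot_chart A d)) (\<lambda>q. H t (param (cot_chart A d) q))"
proof -
  let ?R = "(UNIV, id) :: (real, real) chart"
  let ?D = "cot_chart A d" and ?h = "\<lambda>p. H (fst p) (snd p)"
  let ?S = "snd ?D ` fst ?D"
  have S: "open ?S" unfolding cot_chart_image[OF d] by (intro open_Times open_chart_image d open_UNIV)
  have h: "smooth_map (time_atlas (cot_atlas A)) vector_atlas ?h"
    using H by (simp add: hamiltonian_isotopy_def case_prod_unfold)
  have V: "?R \<in> vector_atlas" by (simp add: vector_atlas_def)
  let ?W = "snd (time_chart ?D) ` (fst (time_chart ?D) \<inter> ?h -` fst ?R)"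
  have "smooth_on ?S (\<lambda>q. (snd ?R \<circ> ?h \<circ> param (time_chart ?D)) (t, q))"
  proof (rule smooth_on_compose[where f = "\<lambda>q. (t, q)", OF S smooth_on_Pair[OF S smooth_on_const[OF S] smooth_on_linear[OF bounded_linear_ident S]]
        time_slice_smooth_on[OF h cot_chart_in[OF d] V]])
    show "Pair t ` ?S \<subseteq> ?W" using mem_time_slice[of _ ?D ?h t ?R] by auto
  qed
  then show ?thesis
  proof (rule smooth_on_cong[OF S, rotated])
    fix q assume "q \<in> ?S"
    then have "(t, q) \<in> ?W" using mem_time_slice[of _ ?D ?h t ?R] by auto
    from time_slice_eq[OF inj_charts_cot_atlas cot_chart_in[OF d] this]
    show "(snd ?R \<circ> ?h \<circ> param (time_chart ?D)) (t, q) = H t (param ?D q)" by simp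
  qed
qed

text \<open>With source point and chart fixed, the left-hand side does not depend on the target
  chart and is locally constant in time. It therefore equals its value at time 0, where the flow is
  the identity.\<close>

lemma hamiltonian_isotopy_sform:
  assumes H: "hamiltonian_isotopy A H \<Phi>" and c: "c \<in> A" "m \<in> cotangent A" "fst m \<in> fst c"
    and d: "d \<in> A" "fst (\<Phi> t m) \<in> fst d"
  shows "sform (cotD (\<Phi> t) c d m u) (cotD (\<Phi> t) c d m v) = sform u v"
proof -
  let ?C = "cot_chart A c"
  note iso = hamiltonian_isotopy_isotopy[OF H]
  have sm: "smooth_map (cot_atlas A) (cot_atlas A) (\<Phi> t)" for t
    using isotopy_diffeomorphism[OF iso] by (simp add: diffeomorphism_def)
  have \<Phi>m: "\<Phi> t m \<in> cotangent A" for t using smooth_map_points[OF sm] c by simp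
  \<comment> \<open>An arbitrary target chart for each time makes f a function of time alone. By
    \<open>f_eq\<close> it can be traded, near any given time, for one fixed chart in which
    derivatives are taken.\<close>
  define \<delta> where "\<delta> t = (SOME d. d \<in> A \<and> fst (\<Phi> t m) \<in> fst d)" for t
  have \<delta>: "\<delta> t \<in> A \<and> fst (\<Phi> t m) \<in> fst (\<delta> t)" for t
    unfolding \<delta>_def by (rule someI_ex) (metis chart_around)
  define f where "f t = sform (cotD (\<Phi> t) c (\<delta> t) m u) (cotD (\<Phi> t) c (\<delta> t) m v)" for t
  have f_eq: "f t = sform (cotD (\<Phi> t) c d m u) (cotD (\<Phi> t) c d m v)" if "d \<in> A" "fst (\<Phi> t m) \<in> fst d" for t d
    unfolding f_def using sform_cotD_target_chart[OF sm c(1) that(1)] \<delta> c that by blast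
  define g where "g p = \<Phi> (fst p) (snd p)" for p
  have g: "smooth_map (time_atlas (cot_atlas A)) (cot_atlas A) g"
    using isotopy_smooth[OF iso] by (simp add: g_def[abs_def])
  have ev: "\<forall>\<^sub>F t in at t0. f t0 = f t" for t0
  proof -
    obtain d where d: "d \<in> A" "fst (\<Phi> t0 m) \<in> fst d" by (rule chart_around)
    let ?D = "cot_chart A d"
    let ?W = "snd (time_chart ?C) ` (fst (time_chart ?C) \<inter> g -` fst ?D)"
    let ?L = "snd ?D \<circ> g \<circ> param (time_chart ?C)" and ?q = "snd ?C m"
    let ?DL = "\<lambda>t w. frechet_derivative ?L (at (t, ?q)) (0, w)"
    note C = cot_chart_in[OF c(1)] and D = cot_chart_in[OF d(1)]
    note W = time_slice_open[OF g C D] and L = time_slice_smooth_on[OF g C D]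
    note L_eq = time_slice_eq[OF inj_charts_cot_atlas C]
    let ?S = "snd ?D ` fst ?D"
    have S: "open ?S" unfolding cot_chart_image[OF d(1)] by (intro open_Times open_chart_image d open_UNIV)
    define V where "V = (\<lambda>t. (t, ?q)) -` ?W"
    have V: "open V" unfolding V_def by (rule open_vimage[OF W]) (intro continuous_intros)
    have t0: "t0 \<in> V"
      using d c \<Phi>m mem_time_slice[of m ?C g t0 ?D] by (simp add: V_def g_def)
    \<comment> \<open>The flow is specified pointwise, by the velocity of each trajectory; the
      variational equation needs it as the partial time derivative of the joint local expression
      \<open>?L\<close>. Both describe the velocity of the same curve.\<close>
    have flow: "frechet_derivative ?L (at (t, q)) (1, 0) = hvec (\<lambda>q. H t (param ?D q)) (?L (t, q))"
      "?L (t, q) \<in> ?S" if tq: "(t, q) \<in> ?W" for t q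
    proof -
      obtain m' where m': "m' \<in> fst ?C" "q = snd ?C m'" "\<Phi> t m' \<in> fst ?D"
        using tq by (auto simp: g_def)
      have p: "param ?C q = m'" unfolding m'(2) by (rule inv_into_f_f[OF inj_on_cot_chart[OF c(1)] m'(1)])
      have Lt: "?L (t, q) = snd ?D (\<Phi> t m')" using L_eq[OF tq] by (simp add: p g_def)
      then show LS: "?L (t, q) \<in> ?S" using m'(3) by (simp del: snd_cot_chart)
      have "((\<lambda>s. snd ?D (\<Phi> s m')) has_vector_derivative
          (poisson (complex_of_real \<circ> H t \<circ> param ?D) fst (snd ?D (\<Phi> t m')),
           poisson (complex_of_real \<circ> H t \<circ> param ?D) snd (snd ?D (\<Phi> t m')))) (at t)"
        using H D m' unfolding hamiltonian_isotopy_def Let_def by (metis mem_cot_chart)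
      also have "complex_of_real \<circ> H t \<circ> param ?D = complex_of_real \<circ> (\<lambda>q. H t (param ?D q))" by auto
      finally have 1: "((\<lambda>s. snd ?D (\<Phi> s m')) has_vector_derivative
          hvec (\<lambda>q. H t (param ?D q)) (?L (t, q))) (at t)"
        using poisson_coordinates[OF smooth_on_imp_differentiable[OF hamiltonian_slice_smooth[OF H d(1), of t] LS]]
        by (simp only: Lt)
      have "((\<lambda>s. ?L (s, q)) has_derivative (\<lambda>r. frechet_derivative ?L (at (t, q)) (r, 0))) (at t)"
        by (rule has_derivative_compose[where f = "\<lambda>s. (s, q)", OF _ smooth_on_imp_has_derivative[OF L tq]])
          (auto intro!: derivative_eq_intros)
      moreover have "(\<lambda>r. frechet_derivative ?L (at (t, q)) (r, 0)) = (\<lambda>r. r *\<^sub>R frechet_derivative ?L (at (t, q)) (1, 0))"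
      proof
        show "frechet_derivative ?L (at (t, q)) (r, 0) = r *\<^sub>R frechet_derivative ?L (at (t, q)) (1, 0)" for r
          using linear_cmul[OF has_derivative_linear[OF smooth_on_imp_has_derivative[OF L tq]], of r "(1, 0)"] by simp
      qed
      ultimately have "((\<lambda>s. ?L (s, q)) has_vector_derivative frechet_derivative ?L (at (t, q)) (1, 0)) (at t)"
        by (simp only: has_vector_derivative_def)
      then have 2: "((\<lambda>s. snd ?D (\<Phi> s m')) has_vector_derivative frechet_derivative ?L (at (t, q)) (1, 0)) (at t)"
      proof (rule has_vector_derivative_transform_within_open)
        show "open ((\<lambda>s. (s, q)) -` ?W)" by (rule open_vimage[OF W]) (intro continuous_intros)
        show "?L (s, q) = snd ?D (\<Phi> s m')" if "s \<in> (\<lambda>s. (s, q)) -` ?W" for s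
          using L_eq[of s q g ?D] that by (simp add: p g_def)
      qed (use tq in simp)
      show "frechet_derivative ?L (at (t, q)) (1, 0) = hvec (\<lambda>q. H t (param ?D q)) (?L (t, q))"
        by (rule vector_derivative_unique_at[OF 2 1])
    qed
    have der: "((\<lambda>t. sform (?DL t u) (?DL t v)) has_real_derivative 0) (at t)" if "t \<in> V" for t
    proof -
      have tq: "(t, ?q) \<in> ?W" using that by (simp add: V_def)
      show ?thesis
        by (rule hamiltonian_flow_sform_derivative[OF W L tq S hamiltonian_slice_smooth[OF H d(1)] flow(2)[OF tq] flow(1)])
    qed
    have f_V: "f t = sform (?DL t u) (?DL t v)" if "t \<in> V" for t
    proof -
      have tq: "(t, ?q) \<in> ?W" using that by (simp add: V_def)
      then obtain m' where "m' \<in> fst ?C" "?q = snd ?C m'" "\<Phi> t m' \<in> fst ?D" by (auto simp: g_def)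
      moreover from this have "m' = m" using inj_on_cot_chart[OF c(1)] c by (metis inj_onD mem_cot_chart)
      ultimately have "fst (\<Phi> t m) \<in> fst d" by simp
      moreover have "cotD (\<Phi> t) c d m = ?DL t"
        unfolding cotD_def using time_slice_has_derivative[OF inj_charts_cot_atlas g C D tq]
        by (intro frechet_derivative_at[symmetric]) (simp add: g_def[abs_def])
      ultimately show ?thesis using f_eq[OF d(1)] by simp
    qed
    \<comment> \<open>Zero derivative forces constancy on an interval, whereas V may be
      disconnected.\<close>
    obtain r where r: "r > 0" "ball t0 r \<subseteq> V" using V t0 by (meson open_contains_ball)
    have "\<exists>k. \<forall>t\<in>ball t0 r. sform (?DL t u) (?DL t v) = k"
      by (rule has_field_derivative_zero_constant[OF convex_ball])
        (use der r in \<open>blast intro: has_field_derivative_at_within\<close>)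
    then obtain k where k: "\<And>t. t \<in> ball t0 r \<Longrightarrow> sform (?DL t u) (?DL t v) = k" by blast
    have "f t0 = f t" if "t \<in> ball t0 r" for t
    proof -
      have "t0 \<in> ball t0 r" using r(1) by simp
      with that r(2) show ?thesis using f_V[of t] f_V[of t0] k[of t] k[of t0] by (simp add: subset_iff)
    qed
    then show ?thesis
      using r(1) unfolding eventually_at by (intro exI[of _ r]) (auto simp: dist_commute)
  qed
  have "f 0 = f t"
    by (rule connected_local_const[of UNIV]) (use ev in auto)
  moreover have "f 0 = sform u v"
  proof -
    have 0: "\<Phi> 0 m = m" using isotopy_0[OF iso] c by simp
    have "(snd ?C \<circ> \<Phi> 0 \<circ> param ?C has_derivative (\<lambda>x. x)) (at (snd ?C m))"
    proof (rule has_derivative_transform_within_open[OF has_derivative_ident])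
      show "open (snd ?C ` fst ?C)" unfolding cot_chart_image[OF c(1)] by (intro open_Times open_chart_image c open_UNIV)
      show "snd ?C m \<in> snd ?C ` fst ?C" using c by (simp del: snd_cot_chart)
      fix q assume "q \<in> snd ?C ` fst ?C"
      then have "param ?C q \<in> fst ?C" "snd ?C (param ?C q) = q"
        by (auto simp only: inv_into_into f_inv_into_f)
      then show "q = (snd ?C \<circ> \<Phi> 0 \<circ> param ?C) q" using isotopy_0[OF iso] by simp
    qed
    then have "cotD (\<Phi> 0) c c m = (\<lambda>x. x)" unfolding cotD_def by (rule frechet_derivative_at[symmetric])
    then show ?thesis using f_eq[OF c(1), of 0] c 0 by simp
  qed
  ultimately show ?thesis using f_eq[OF d] by simp
qed

end

section \<open>Higher diffeomorphisms along the zero-section\<close>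

text \<open>The hypothesis says that w \<mapsto> \<alpha> w + \<beta> cnj w is the inverse transpose
  of u \<mapsto> a u + b cnj u for the real pairing Re (w u). Both sides are real-bilinear, so
  testing on 1 and \<i> determines the coefficients.\<close>

lemma sform_adjoint_coefficients:
  fixes a b \<alpha> \<beta> :: complex
  assumes "\<And>u w. Re ((\<alpha> * w + \<beta> * cnj w) * (a * u + b * cnj u)) = Re (w * u)"
  shows "\<alpha> * a + cnj \<beta> * cnj b = 1" "\<alpha> * b + cnj \<beta> * cnj a = 0"
  using assms[of 1 1] assms[of \<i> \<i>] assms[of 1 \<i>] assms[of \<i> 1]
  by (auto simp: complex_eq_iff algebra_simps)

text \<open>Cramer's rule with determinant J = a cnj a - b cnj b expresses \<alpha> J and cnj
  \<beta> J through a and b; multiplying \<open>jet\<close> by J then gives the pullback formula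
  with its denominator cleared.\<close>

lemma beltrami_from_conormal:
  fixes a b \<alpha> \<beta> m \<nu> :: complex
  assumes 1: "\<alpha> * a + cnj \<beta> * cnj b = 1" and 0: "\<alpha> * b + cnj \<beta> * cnj a = 0" and m: "cmod m < 1"
    and jet: "m * \<alpha> - cnj \<beta> + \<nu> * (m * \<beta> - cnj \<alpha>) = 0"
  shows "\<nu> = (b + m * cnj a) / (a + m * cnj b)"
proof -
  define J where "J = a * cnj a - b * cnj b"
  have \<alpha>: "\<alpha> * J = cnj a"
  proof -
    have "\<alpha> * J = cnj a * (\<alpha> * a + cnj \<beta> * cnj b) - cnj b * (\<alpha> * b + cnj \<beta> * cnj a)"
      by (simp add: J_def algebra_simps)
    then show ?thesis by (simp add: 0 1)
  qed
  have \<beta>: "cnj \<beta> * J = - b"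
  proof -
    have "cnj \<beta> * J = a * (\<alpha> * b + cnj \<beta> * cnj a) - b * (\<alpha> * a + cnj \<beta> * cnj b)"
      by (simp add: J_def algebra_simps)
    then show ?thesis by (simp add: 0 1)
  qed
  have J: "cnj J = J" by (simp add: J_def mult.commute)
  have \<alpha>': "cnj \<alpha> * J = a" using arg_cong[OF \<alpha>, of cnj] by (simp add: J)
  have \<beta>': "\<beta> * J = - cnj b" using arg_cong[OF \<beta>, of cnj] by (simp add: J)
  have "(m * \<alpha> - cnj \<beta> + \<nu> * (m * \<beta> - cnj \<alpha>)) * J
      = m * (\<alpha> * J) - cnj \<beta> * J + \<nu> * (m * (\<beta> * J) - cnj \<alpha> * J)"
    by (simp add: algebra_simps)
  also have "\<dots> = (b + m * cnj a) - \<nu> * (a + m * cnj b)"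
    unfolding \<alpha> \<beta> \<alpha>' \<beta>' by (simp add: algebra_simps)
  finally have eq: "b + m * cnj a = \<nu> * (a + m * cnj b)" using jet by simp
  \<comment> \<open>If the denominator vanishes, \<open>eq\<close> makes the numerator vanish too.
    Then each of a and b has cmod m times the modulus of the other, so both are 0, contradicting
    \<open>1\<close>.\<close>
  have "a + m * cnj b \<noteq> 0"
  proof
    assume z: "a + m * cnj b = 0"
    with eq have "b + m * cnj a = 0" by simp
    with z have ab: "a = - (m * cnj b)" "b = - (m * cnj a)" by (simp_all add: eq_neg_iff_add_eq_0)
    have "cmod a = cmod m * cmod b" "cmod b = cmod m * cmod a"
      using arg_cong[OF ab(1), of cmod] arg_cong[OF ab(2), of cmod] by (simp_all add: norm_mult)
    then have "cmod a = 0" "cmod b = 0"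
      using m by (smt (verit) mult_left_le_one_le mult_less_cancel_right2 norm_ge_zero)+
    with 1 show False by simp
  qed
  with eq show ?thesis by (simp add: field_simps)
qed

context atlas_surface
begin

section \<open>Restriction to the zero-section\<close>

definition base_map :: "('a covector \<Rightarrow> 'a covector) \<Rightarrow> 'a \<Rightarrow> 'a" where
  "base_map \<phi> x = fst (\<phi> (zero_cov x))"

lemma base_map_zero_cov:
  assumes "\<phi> ` zero_section A = zero_section A"
  shows "\<phi> (zero_cov x) = zero_cov (base_map \<phi> x)"
proof -
  have "\<phi> (zero_cov x) \<in> range zero_cov" using assms unfolding zero_section_eq by blast
  then show ?thesis by (auto simp: base_map_def)
qed

lemma smooth_base_map:
  assumes "smooth_map (cot_atlas A) (cot_atlas A) \<phi>"
  shows "smooth_map A A (base_map \<phi>)"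
  unfolding base_map_def[abs_def]
  using smooth_map_compose[OF inj_charts_A inj_charts_cot_atlas
      smooth_map_compose[OF inj_charts_A inj_charts_cot_atlas smooth_map_zero_cov assms] smooth_map_cot_fst] .

text \<open>The inverse of \<phi> preserves the zero-section as well, and its base map inverts that
  of \<phi>; both are smooth as composites.\<close>

lemma diffeomorphism_base_map:
  assumes \<phi>: "diffeomorphism (cot_atlas A) \<phi>" and z: "\<phi> ` zero_section A = zero_section A"
  shows "diffeomorphism A (base_map \<phi>)"
proof -
  let ?h = "inv_into (cotangent A) \<phi>"
  have bij: "bij_betw \<phi> (cotangent A) (cotangent A)" using diffeomorphism_bij[OF \<phi>] by simp
  have sub: "zero_section A \<subseteq> cotangent A" by (auto simp: zero_section_eq)
  have hz: "?h ` zero_section A = zero_section A"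
    using inv_into_image_cancel[OF bij_betw_imp_inj_on[OF bij] sub] z by simp
  have h: "?h (\<phi> m) = m" "\<phi> (?h m) = m" if "m \<in> cotangent A" for m
    using bij that by (auto simp: bij_betw_inv_into_left bij_betw_inv_into_right)
  have 1: "base_map ?h (base_map \<phi> x) = x" for x
    unfolding base_map_def[of ?h] base_map_zero_cov[OF z, symmetric] by (simp add: h)
  have 2: "base_map \<phi> (base_map ?h x) = x" for x
    unfolding base_map_def[of \<phi>] base_map_zero_cov[OF hz, symmetric] by (simp add: h)
  have bij': "bij (base_map \<phi>)" using 1 2 by (metis bijI')
  have "inv_into UNIV (base_map \<phi>) = base_map ?h"
    by (rule inv_equality) (use 1 2 in auto)
  with \<phi> bij' show ?thesis
    by (simp add: diffeomorphism_def smooth_base_map)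
qed

lemma isotopy_base_map:
  assumes \<Phi>: "isotopy (cot_atlas A) \<Phi>" and z: "\<And>t. \<Phi> t ` zero_section A = zero_section A"
  shows "isotopy A (\<lambda>t. base_map (\<Phi> t))"
proof (rule isotopyI)
  have "smooth_map (time_atlas A) (cot_atlas A) (\<lambda>p. \<Phi> (fst p) (zero_cov (snd p)))"
    by (rule smooth_map_isotopy_compose[OF inj_charts_A inj_charts_cot_atlas \<Phi>
          smooth_map_snd[OF inj_charts_A smooth_map_zero_cov] smooth_on_ident])
  from smooth_map_compose[OF inj_charts_time_atlas[OF inj_charts_A] inj_charts_cot_atlas this smooth_map_cot_fst]
  show "smooth_map (time_atlas A) A (\<lambda>p. base_map (\<Phi> (fst p)) (snd p))"
    by (simp add: base_map_def)
  show "base_map (\<Phi> 0) x = x" for x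
    using isotopy_0[OF \<Phi>, of "zero_cov x"] by (simp add: base_map_def)
  show "diffeomorphism A (base_map (\<Phi> t))" for t
    by (rule diffeomorphism_base_map[OF isotopy_diffeomorphism[OF \<Phi>] z])
qed

lemma cov_0 [simp]: "cov c x 0 = zero_cov x"
  by (auto simp: cov_def zero_cov_def)

text \<open>Along z \<mapsto> (z, 0) the fibre component of the local expression is constantly 0 and
  the base component is the local expression of the base map. Horizontal vectors therefore stay
  horizontal.\<close>

lemma cotD_zero_section:
  assumes \<phi>: "smooth_map (cot_atlas A) (cot_atlas A) \<phi>" and z: "\<phi> ` zero_section A = zero_section A"
    and c: "c \<in> A" "d \<in> A" "x \<in> fst c" "base_map \<phi> x \<in> fst d"
  shows "cotD \<phi> c d (zero_cov x) (u, 0)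
    = (wz (base_map \<phi>) c d x * u + wzb (base_map \<phi>) c d x * cnj u, 0)"
proof -
  let ?C = "cot_chart A c" and ?D = "cot_chart A d" and ?f = "base_map \<phi>"
  note bz = base_map_zero_cov[OF z] and sf = smooth_base_map[OF \<phi>]
  have G: "((snd ?D \<circ> \<phi> \<circ> param ?C) has_derivative cotD \<phi> c d (zero_cov x)) (at (snd c x, 0))"
    using smooth_cot_has_derivative[OF \<phi> c(1,2), of "zero_cov x"] c by (simp add: bz)
  have "((\<lambda>z. (snd ?D \<circ> \<phi> \<circ> param ?C) (z, 0)) has_derivative (\<lambda>u. cotD \<phi> c d (zero_cov x) (u, 0))) (at (snd c x))"
    by (rule has_derivative_compose[where f = "\<lambda>z. (z, 0)", OF _ G]) (auto intro!: derivative_eq_intros)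
  then have 1: "((\<lambda>z. ((snd d \<circ> ?f \<circ> param c) z, 0)) has_derivative (\<lambda>u. cotD \<phi> c d (zero_cov x) (u, 0))) (at (snd c x))"
  proof (rule has_derivative_transform_within_open[OF _ smooth_map_open[OF sf c(1,2)]])
    fix z assume "z \<in> snd c ` (fst c \<inter> ?f -` fst d)"
    then have "z \<in> snd c ` fst c" by auto
    then show "(snd ?D \<circ> \<phi> \<circ> param ?C) (z, 0) = ((snd d \<circ> ?f \<circ> param c) z, 0)"
      using param_cot_chart[OF c(1), of z 0] by (simp add: bz)
  qed (use c in auto)
  have 2: "((\<lambda>z. ((snd d \<circ> ?f \<circ> param c) z, 0)) has_derivative
      (\<lambda>u. (wz ?f c d x * u + wzb ?f c d x * cnj u, 0))) (at (snd c x))"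
    by (intro has_derivative_Pair local_has_derivative[OF sf c] has_derivative_const)
  show ?thesis using fun_cong[OF has_derivative_unique[OF 1 2]] .
qed

lemma higher_diffeo_base_map:
  assumes "\<phi> \<in> higher_diffeos A"
  shows "base_map \<phi> \<in> diffeos_isotopic_to_id A" "diffeomorphism (cot_atlas A) \<phi>" "\<phi> ` zero_section A = zero_section A"
proof -
  obtain \<Phi> H where \<Phi>: "\<phi> = \<Phi> 1" "hamiltonian_isotopy A H \<Phi>" "\<And>t. \<Phi> t ` zero_section A = zero_section A"
    using assms by (auto simp: higher_diffeos_def)
  note iso = hamiltonian_isotopy_isotopy[OF \<Phi>(2)]
  show "base_map \<phi> \<in> diffeos_isotopic_to_id A"
    unfolding diffeos_isotopic_to_id_def \<Phi>(1)
    using isotopy_base_map[OF iso \<Phi>(3)] by (intro CollectI exI[of _ "\<lambda>t. base_map (\<Phi> t)"]) simp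
  show "diffeomorphism (cot_atlas A) \<phi>" unfolding \<Phi>(1) by (rule isotopy_diffeomorphism[OF iso])
  show "\<phi> ` zero_section A = zero_section A" unfolding \<Phi>(1) by (rule \<Phi>(3))
qed

text \<open>Along the zero-section a higher diffeomorphism is the cotangent lift of its base map to first
  order in the fibre.\<close>

lemma higher_diffeo_fibre_derivative:
  assumes \<phi>: "\<phi> \<in> higher_diffeos A" and c: "c \<in> A" "d \<in> A" "x \<in> fst c" "base_map \<phi> x \<in> fst d"
  obtains \<alpha> \<beta> where
    "\<And>w. snd (cotD \<phi> c d (zero_cov x) (0, w)) = \<alpha> * w + \<beta> * cnj w"
    "\<alpha> * wz (base_map \<phi>) c d x + cnj \<beta> * cnj (wzb (base_map \<phi>) c d x) = 1"
    "\<alpha> * wzb (base_map \<phi>) c d x + cnj \<beta> * cnj (wz (base_map \<phi>) c d x) = 0"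
proof -
  let ?X = "cotD \<phi> c d (zero_cov x)"
  let ?a = "wz (base_map \<phi>) c d x" and ?b = "wzb (base_map \<phi>) c d x"
  obtain \<Phi> H where \<Phi>: "\<phi> = \<Phi> 1" "hamiltonian_isotopy A H \<Phi>"
    using \<phi> by (auto simp: higher_diffeos_def)
  note d\<phi> = higher_diffeo_base_map(2)[OF \<phi>] and z = higher_diffeo_base_map(3)[OF \<phi>]
  have s\<phi>: "smooth_map (cot_atlas A) (cot_atlas A) \<phi>" using d\<phi> by (simp add: diffeomorphism_def)
  have \<phi>z: "fst (\<phi> (zero_cov x)) \<in> fst d" using c by (simp add: base_map_def)
  have "linear (\<lambda>w. snd (?X (0, w)))"
  proof -
    have "bounded_linear ?X"
      using smooth_cot_has_derivative[OF s\<phi> c(1,2) zero_cov_in, of x] c \<phi>z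
      by (simp add: has_derivative_bounded_linear)
    then have "bounded_linear (\<lambda>w. snd (?X (0, w)))"
      by (intro bounded_linear_compose[OF bounded_linear_snd] bounded_linear_compose[where f = ?X and g = p_dir]
          bounded_linear_Pair[OF bounded_linear_zero bounded_linear_ident])
    then show ?thesis by (rule bounded_linear.linear)
  qed
  from linear_complex_eq[OF this] obtain \<alpha> \<beta> where ab: "\<And>w. snd (?X (0, w)) = \<alpha> * w + \<beta> * cnj w"
    by blast
  have "Re ((\<alpha> * w + \<beta> * cnj w) * (?a * u + ?b * cnj u)) = Re (w * u)" for u w
  proof -
    \<comment> \<open>One vertical and one horizontal vector. The image of (u, 0) has no fibre
      component, so the unknown base component of the image of (0, w) drops out of the form.\<close>
    have "sform (?X (0, w)) (?X (u, 0)) = sform (0, w) (u, 0)"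
      unfolding \<Phi>(1) by (rule hamiltonian_isotopy_sform[OF \<Phi>(2) c(1) zero_cov_in _ c(2)])
        (use c \<phi>z \<Phi>(1) in auto)
    then show ?thesis
      unfolding cotD_zero_section[OF s\<phi> z c] sform_def ab by simp
  qed
  from sform_adjoint_coefficients[OF this] that[OF ab] show ?thesis by blast
qed

end

section \<open>The ideal of a Beltrami differential\<close>

lemma module_mult: "Modules.module ((*) :: 'r::comm_ring_1 \<Rightarrow> 'r \<Rightarrow> 'r)"
  by unfold_locales (simp_all add: algebra_simps)

lemma ideal_gen_singleton: "ideal_gen {a} = {k * a | k. True}" for a :: "'r::comm_ring_1"
  by (auto simp: Modules.module.span_singleton[OF module_mult])

lemma ideal_gen_pair: "ideal_gen {a, b} = {k * a + l * b | k l. True}" for a b :: "'r::comm_ring_1"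
proof -
  have "x - k * a \<in> ideal_gen {b} \<longleftrightarrow> (\<exists>l. x = k * a + l * b)" for x k
    by (auto simp: ideal_gen_singleton algebra_simps)
  then show ?thesis by (auto simp: Modules.module.span_insert[OF module_mult])
qed

lemma eval2_add [simp]: "eval2 (f + g) a b = eval2 f a b + eval2 g a b"
  and eval2_diff [simp]: "eval2 (f - g) a b = eval2 f a b - eval2 g a b"
  and eval2_minus [simp]: "eval2 (- f) a b = - eval2 f a b"
  and eval2_mult [simp]: "eval2 (f * g) a b = eval2 f a b * eval2 g a b"
  and eval2_power [simp]: "eval2 (f ^ k) a b = eval2 f a b ^ k"
  and eval2_pvar [simp]: "eval2 pvar a b = a"
  and eval2_pbar [simp]: "eval2 pbar a b = b"
  and eval2_const2 [simp]: "eval2 (const2 c) a b = c"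
  and eval2_0 [simp]: "eval2 0 a b = 0"
  by (simp_all add: eval2_def pvar_def pbar_def const2_def)

lemma eval2_sum [simp]: "eval2 (\<Sum>i\<in>I. f i) a b = (\<Sum>i\<in>I. eval2 (f i) a b)"
  by (induction I rule: infinite_finite_induct) auto

text \<open>If f and g agree everywhere, f - g has infinitely many roots, the constants, in the
  domain of polynomials in p. Identities involving \<open>conj2\<close> and \<open>scale2\<close>
  are thereby checked on values instead of coefficients.\<close>

lemma eval2_eqI:
  assumes "\<And>a b. eval2 f a b = eval2 g a b"
  shows "f = g"
proof -
  have "poly (f - g) [:b:] = 0" for b
    using assms unfolding eval2_def by (simp add: poly_eq_poly_eq_iff[symmetric] fun_eq_iff)
  then have "range (\<lambda>b. [:b:]) \<subseteq> {x. poly (f - g) x = 0}" by auto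
  moreover have "infinite (range (\<lambda>b::complex. [:b:]))"
    by (subst finite_image_iff) (auto simp: inj_on_def infinite_UNIV_char_0)
  ultimately have "infinite {x. poly (f - g) x = 0}" by (metis finite_subset)
  then have "f - g = 0" using poly_roots_finite[of "f - g"] by metis
  then show ?thesis by simp
qed

lemma eval2_altdef:
  "eval2 f x y = (\<Sum>i\<le>Polynomial.degree f. \<Sum>j\<le>Polynomial.degree (Polynomial.coeff f i).
    Polynomial.coeff (Polynomial.coeff f i) j * x ^ j * y ^ i)"
proof -
  have "eval2 f x y = (\<Sum>i\<le>Polynomial.degree f. poly (Polynomial.coeff f i) x * y ^ i)"
    unfolding eval2_def poly_altdef[of f] by (simp add: poly_sum)
  also have "\<dots> = (\<Sum>i\<le>Polynomial.degree f. (\<Sum>j\<le>Polynomial.degree (Polynomial.coeff f i).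
      Polynomial.coeff (Polynomial.coeff f i) j * x ^ j) * y ^ i)"
    unfolding poly_altdef ..
  finally show ?thesis by (simp add: sum_distrib_right)
qed

lemma eval2_conj2: "eval2 (conj2 f) a b = cnj (eval2 f (cnj b) (cnj a))"
  by (simp add: conj2_def eval2_altdef[of f] mult_ac)

lemma conj2_mult: "conj2 (f * g) = conj2 f * conj2 g"
  and conj2_conj2: "conj2 (conj2 f) = f"
  by (rule eval2_eqI; simp add: eval2_conj2)+

lemma eval2_scale2: "eval2 (scale2 a b f) x y = eval2 f (a * x) (b * y)"
proof -
  have "poly (poly (map_poly (\<lambda>q. pcompose q [:0, a:]) f) [:c:]) x = poly (poly f [:c:]) (a * x)" for c
    by (induction f) (simp_all add: map_poly_pCons poly_pcompose mult.commute)
  then show ?thesis by (simp add: scale2_def eval2_def poly_pcompose mult.commute)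
qed

text \<open>Substituting \<open>\<bar>p = m p\<close>.\<close>

definition restrict_line :: "complex \<Rightarrow> complex poly poly \<Rightarrow> complex poly" where
  "restrict_line m f = poly f [:0, m:]"

lemma restrict_line_add [simp]: "restrict_line m (f + g) = restrict_line m f + restrict_line m g"
  and restrict_line_diff [simp]: "restrict_line m (f - g) = restrict_line m f - restrict_line m g"
  and restrict_line_mult [simp]: "restrict_line m (f * g) = restrict_line m f * restrict_line m g"
  and restrict_line_sum: "restrict_line m (\<Sum>i\<in>I. h i) = (\<Sum>i\<in>I. restrict_line m (h i))"
  and restrict_line_power [simp]: "restrict_line m (f ^ k) = restrict_line m f ^ k"
  and restrict_line_pvar [simp]: "restrict_line m pvar = [:0, 1:]"
  and restrict_line_pbar [simp]: "restrict_line m pbar = [:0, m:]"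
  and restrict_line_const2 [simp]: "restrict_line m (const2 c) = [:c:]"
  by (simp_all add: restrict_line_def poly_sum pvar_def pbar_def const2_def)

text \<open>Scaling the coordinates by a and b takes the line of slope m to the line of slope b m /
  a, traversed at a times the speed.\<close>

lemma restrict_line_scale2:
  assumes "a \<noteq> 0"
  shows "restrict_line m (scale2 a b f) = pcompose (restrict_line (b * m / a) f) [:0, a:]"
proof (rule poly_eq_poly_eq_iff[THEN iffD1], rule ext)
  fix x
  have e: "poly (restrict_line m f) x = eval2 f x (m * x)" for m f x
  proof -
    have "poly (poly f [:0, m:]) x = poly (poly f [:m * x:]) x"
      by (induction f) (simp_all add: mult.commute)
    then show ?thesis by (simp add: restrict_line_def eval2_def)
  qed
  show "poly (restrict_line m (scale2 a b f)) x = poly (pcompose (restrict_line (b * m / a) f) [:0, a:]) x"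
    using assms by (simp add: e poly_pcompose eval2_scale2 mult_ac)
qed

lemma X_power_dvd_iff: "[:0, 1:] ^ n dvd h \<longleftrightarrow> (\<forall>k<n. Polynomial.coeff h k = 0)" for h :: "complex poly"
  using monom_1_dvd_iff'[of n h] by (simp add: monom_altdef)

section \<open>The ideal at one point\<close>

definition beltrami_ideal :: "nat \<Rightarrow> complex \<Rightarrow> complex poly poly set" where
  "beltrami_ideal n m = ideal_gen {pvar ^ n, - pbar + const2 m * pvar}"

text \<open>Dividing out the second generator amounts to substituting pbar = m p, and what remains
  of the ideal is generated by the n-th power of p. Membership thus becomes the vanishing of the
  first n coefficients on a line.\<close>

lemma beltrami_ideal_iff: "f \<in> beltrami_ideal n m \<longleftrightarrow> [:0, 1:] ^ n dvd restrict_line m f"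
proof
  assume "f \<in> beltrami_ideal n m"
  then obtain k l where f: "f = k * pvar ^ n + l * (- pbar + const2 m * pvar)"
    unfolding beltrami_ideal_def ideal_gen_pair by auto
  have "restrict_line m (- pbar + const2 m * pvar) = 0"
    by (simp add: restrict_line_def pvar_def pbar_def const2_def)
  then show "[:0, 1:] ^ n dvd restrict_line m f" by (simp add: f)
next
  assume "[:0, 1:] ^ n dvd restrict_line m f"
  then obtain h where h: "poly f [:0, m:] = h * [:0, 1:] ^ n" by (auto simp: restrict_line_def elim: dvdE)
  \<comment> \<open>The factor theorem over the ring of polynomials in p, at the point
    \<open>[:0, m:]\<close>: f differs from its restriction by a multiple of pbar - m p.\<close>
  have "[:- [:0, m:], 1:] dvd f - [:poly f [:0, m:]:]"
    by (rule poly_eq_0_iff_dvd[THEN iffD1]) simp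
  then obtain g where g: "f - [:poly f [:0, m:]:] = [:- [:0, m:], 1:] * g" by (elim dvdE)
  have 1: "[:poly f [:0, m:]:] = [:h:] * pvar ^ n"
    unfolding h pvar_def by (simp add: poly_const_pow)
  have 2: "[:- [:0, m:], 1:] = pbar - const2 m * pvar"
    by (simp add: pvar_def pbar_def const2_def)
  have "f = [:h:] * pvar ^ n + (pbar - const2 m * pvar) * g"
    using g unfolding 1 2 by (metis add.commute diff_add_cancel)
  also have "\<dots> = [:h:] * pvar ^ n + (- g) * (- pbar + const2 m * pvar)"
    by (simp add: algebra_simps)
  finally have "f = [:h:] * pvar ^ n + (- g) * (- pbar + const2 m * pvar)" .
  then show "f \<in> beltrami_ideal n m" unfolding beltrami_ideal_def ideal_gen_pair by blast
qed

lemma beltrami_ideal_generator: "- pbar + const2 m * pvar \<in> beltrami_ideal n m"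
  unfolding beltrami_ideal_def by (rule Modules.module.span_base[OF module_mult]) simp

lemma is_ideal_beltrami_ideal: "is_ideal (beltrami_ideal n m)"
  unfolding beltrami_ideal_def by (rule Modules.module.subspace_span[OF module_mult])

text \<open>\<open>codimension\<close> counts the elements of a basis set, so the powers of p have
  to be distinct.\<close>

lemma inj_pvar_power: "inj (\<lambda>i. pvar ^ i)"
proof (rule injI)
  fix i j :: nat assume "pvar ^ i = pvar ^ j"
  then have "(\<lambda>p. restrict_line 0 p) (pvar ^ i) = restrict_line 0 (pvar ^ j)" by simp
  then have "Polynomial.degree ([:0, 1:: complex:] ^ i) = Polynomial.degree ([:0, 1::complex:] ^ j)" by simp
  then show "i = j" by (simp add: degree_power_eq)
qed

lemma codimension_beltrami_ideal: "codimension (beltrami_ideal n m) n"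
  unfolding codimension_def
proof (intro exI[of _ "(\<lambda>i. pvar ^ i) ` {..<n}"] conjI allI)
  let ?B = "(\<lambda>i. pvar ^ i) ` {..<n}"
  have inj: "inj_on (\<lambda>i. pvar ^ i) {..<n}" using inj_pvar_power by (rule inj_on_subset) simp
  show "finite ?B" by simp
  show "card ?B = n" by (simp add: card_image inj)
  fix f
  \<comment> \<open>The powers of p below n form a basis of the quotient, and the coordinates of f
    are the first n coefficients of its restriction to the line.\<close>
  have *: "f - (\<Sum>b\<in>?B. const2 (a b) * b) \<in> beltrami_ideal n m
      \<longleftrightarrow> (\<forall>i<n. a (pvar ^ i) = Polynomial.coeff (restrict_line m f) i)" for a
  proof -
    have "restrict_line m (\<Sum>b\<in>?B. const2 (a b) * b) = (\<Sum>i<n. [:a (pvar ^ i):] * [:0, 1:] ^ i)"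
      by (simp add: restrict_line_sum sum.reindex[OF inj])
    also have "\<dots> = (\<Sum>i<n. Polynomial.monom (a (pvar ^ i)) i)"
      by (simp add: monom_altdef)
    finally have "restrict_line m (f - (\<Sum>b\<in>?B. const2 (a b) * b))
        = restrict_line m f - (\<Sum>i<n. Polynomial.monom (a (pvar ^ i)) i)" by simp
    then show ?thesis
      unfolding beltrami_ideal_iff X_power_dvd_iff by (auto simp: coeff_sum)
  qed
  define a where "a b = (if b \<in> ?B then Polynomial.coeff (restrict_line m f) (inv_into UNIV (\<lambda>i. pvar ^ i) b) else 0)" for b
  show "\<exists>!a. (\<forall>b. b \<notin> ?B \<longrightarrow> a b = 0) \<and> f - (\<Sum>b\<in>?B. const2 (a b) * b) \<in> beltrami_ideal n m"
  proof (rule ex1I[of _ a])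
    show "(\<forall>b. b \<notin> ?B \<longrightarrow> a b = 0) \<and> f - (\<Sum>b\<in>?B. const2 (a b) * b) \<in> beltrami_ideal n m"
      unfolding * by (auto simp: a_def inv_f_f[OF inj_pvar_power])
    fix a' assume "(\<forall>b. b \<notin> ?B \<longrightarrow> a' b = 0) \<and> f - (\<Sum>b\<in>?B. const2 (a' b) * b) \<in> beltrami_ideal n m"
    then show "a' = a"
      unfolding * by (intro ext) (auto simp: a_def inv_f_f[OF inj_pvar_power])
  qed
qed

lemma eval2_beltrami_ideal_origin:
  assumes "f \<in> beltrami_ideal n m" "n > 0"
  shows "eval2 f 0 0 = 0"
  using assms unfolding beltrami_ideal_def ideal_gen_pair by auto

lemma supported_beltrami_ideal:
  assumes "n > 0"
  shows "supported_at_origin (beltrami_ideal n m)"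
proof -
  have "a = 0 \<and> b = 0" if "\<forall>f\<in>beltrami_ideal n m. eval2 f a b = 0" for a b
  proof -
    have "pvar ^ n \<in> beltrami_ideal n m"
      unfolding beltrami_ideal_def by (rule Modules.module.span_base[OF module_mult]) simp
    with that have "eval2 (pvar ^ n) a b = 0" by blast
    then have "a = 0" using assms by simp
    moreover have "eval2 (- pbar + const2 m * pvar) a b = 0"
      using that beltrami_ideal_generator by blast
    ultimately show ?thesis by simp
  qed
  then show ?thesis
    using eval2_beltrami_ideal_origin[OF _ assms] unfolding supported_at_origin_def by blast
qed

lemma beltrami_ideal_hilb0: "n > 0 \<Longrightarrow> beltrami_ideal n m \<in> hilb0 n"
  by (simp add: hilb0_def is_ideal_beltrami_ideal codimension_beltrami_ideal supported_beltrami_ideal)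

lemma maximal_ideal_iff: "f \<in> ideal_gen {pvar, pbar} \<longleftrightarrow> eval2 f 0 0 = 0"
proof
  assume "f \<in> ideal_gen {pvar, pbar}"
  then show "eval2 f 0 0 = 0" unfolding ideal_gen_pair by auto
next
  assume 0: "eval2 f 0 0 = 0"
  obtain c g where f: "f = pCons c g" by (cases f)
  obtain c0 d where c: "c = pCons c0 d" by (cases c)
  have "c0 = 0" using 0 by (simp add: f c eval2_def)
  then have "f = [:d:] * pvar + g * pbar" by (simp add: f c pvar_def pbar_def)
  then show "f \<in> ideal_gen {pvar, pbar}" unfolding ideal_gen_pair by blast
qed

text \<open>The generator -pbar + m p and its conjugate -p + cnj m pbar are independent linear forms
  when cmod m < 1, so together they generate both coordinates. Conversely, all elements of the ideal
  and their conjugates vanish at the origin.\<close>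

lemma beltrami_ideal_conj_sum:
  assumes "n > 0" "cmod m < 1"
  shows "{f + conj2 g | f g. f \<in> beltrami_ideal n m \<and> g \<in> beltrami_ideal n m} = ideal_gen {pvar, pbar}"
proof (intro equalityI subsetI)
  fix h assume "h \<in> {f + conj2 g | f g. f \<in> beltrami_ideal n m \<and> g \<in> beltrami_ideal n m}"
  then show "h \<in> ideal_gen {pvar, pbar}"
    using eval2_beltrami_ideal_origin[OF _ assms(1)] by (auto simp: maximal_ideal_iff eval2_conj2)
next
  fix h assume "h \<in> ideal_gen {pvar, pbar}"
  then obtain k l where h: "h = k * pvar + l * pbar" unfolding ideal_gen_pair by blast
  let ?e = "- pbar + const2 m * pvar"
  \<comment> \<open>The inverse determinant of the two linear forms \<open>?e\<close> and
    \<open>conj2 ?e\<close>; identities 1 and 2 below are Cramer's rule.\<close>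
  define s where "s = 1 / (m * cnj m - 1)"
  have "m * cnj m \<noteq> 1"
    using assms(2) by (metis abs_square_eq_1 complex_mod_mult_cnj less_irrefl norm_ge_zero norm_one abs_of_nonneg)
  then have s: "s * (m * cnj m - 1) = 1" by (simp add: s_def)
  have e: "eval2 (conj2 ?e) a b = - a + cnj m * b" for a b by (simp add: eval2_conj2)
  have 1: "pvar = const2 (s * cnj m) * ?e + const2 s * conj2 ?e"
  proof (rule eval2_eqI)
    fix a b
    have "s * cnj m * (- b + m * a) + s * (- a + cnj m * b) = s * (m * cnj m - 1) * a" by (simp add: algebra_simps)
    then show "eval2 pvar a b = eval2 (const2 (s * cnj m) * ?e + const2 s * conj2 ?e) a b"
      using s e by simp
  qed
  have 2: "pbar = const2 s * ?e + const2 (s * m) * conj2 ?e"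
  proof (rule eval2_eqI)
    fix a b
    have "s * (- b + m * a) + s * m * (- a + cnj m * b) = s * (m * cnj m - 1) * b" by (simp add: algebra_simps)
    then show "eval2 pbar a b = eval2 (const2 s * ?e + const2 (s * m) * conj2 ?e) a b"
      using s e by simp
  qed
  define u v where "u = k * const2 (s * cnj m) + l * const2 s" and "v = k * const2 s + l * const2 (s * m)"
  have "h = k * (const2 (s * cnj m) * ?e + const2 s * conj2 ?e) + l * (const2 s * ?e + const2 (s * m) * conj2 ?e)"
    unfolding h by (simp only: 1[symmetric] 2[symmetric])
  also have "\<dots> = u * ?e + v * conj2 ?e" by (simp add: u_def v_def algebra_simps)
  \<comment> \<open>The second summand must be the conjugate of an element of the ideal; conjugation
    is a multiplicative involution, so v can be moved inside.\<close>
  also have "\<dots> = u * ?e + conj2 (conj2 v * ?e)" by (simp only: conj2_mult conj2_conj2)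
  finally have "h = u * ?e + conj2 (conj2 v * ?e)" .
  moreover have "w * ?e \<in> beltrami_ideal n m" for w
    by (rule Modules.module.subspace_scale[OF module_mult is_ideal_beltrami_ideal beltrami_ideal_generator])
  ultimately show "h \<in> {f + conj2 g | f g. f \<in> beltrami_ideal n m \<and> g \<in> beltrami_ideal n m}" by blast
qed

text \<open>Matches the two transformation laws: with a = t and b = cnj t, the slope changes exactly
  as a Beltrami coefficient does when the fibre coordinate is multiplied by t.\<close>

lemma scale2_beltrami_ideal:
  assumes "a \<noteq> 0" "b \<noteq> 0"
  shows "scale2 a b ` beltrami_ideal n (b * m / a) = beltrami_ideal n m"
proof -
  have iff: "scale2 a b f \<in> beltrami_ideal n m \<longleftrightarrow> f \<in> beltrami_ideal n (b * m / a)" for f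
    unfolding beltrami_ideal_iff restrict_line_scale2[OF assms(1)] X_power_dvd_iff
    by (simp add: coeff_pcompose_linear assms)
  have inv: "scale2 a b (scale2 (1 / a) (1 / b) f) = f" for f
    by (rule eval2_eqI) (simp add: eval2_scale2 assms)
  show ?thesis
  proof (intro equalityI subsetI)
    fix f assume "f \<in> beltrami_ideal n m"
    then have "scale2 (1 / a) (1 / b) f \<in> beltrami_ideal n (b * m / a)" using iff inv by metis
    then show "f \<in> scale2 a b ` beltrami_ideal n (b * m / a)" by (metis image_eqI inv)
  qed (use iff in blast)
qed

context atlas_surface
begin

section \<open>The compatible structure of a Beltrami differential\<close>

definition beltrami_structure :: "nat \<Rightarrow> ('a cchart \<Rightarrow> 'a \<Rightarrow> complex) \<Rightarrow> 'a ideal_field" where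
  "beltrami_structure n \<mu> c x = (if c \<in> A \<and> x \<in> fst c then beltrami_ideal n (\<mu> c x) else {})"

lemma beltrami_transform:
  assumes "\<mu> \<in> beltrami_differentials A" "c \<in> A" "d \<in> A" "x \<in> fst c" "x \<in> fst d"
  shows "\<mu> c x = \<mu> d x * cnj (trans_deriv c d x) / trans_deriv c d x"
  using assms unfolding beltrami_differentials_def by blast

lemma beltrami_structure_compatible:
  assumes n: "n \<ge> 2" and \<mu>: "\<mu> \<in> beltrami_differentials A"
  shows "beltrami_structure n \<mu> \<in> compatible_structures A n"
proof -
  have sec: "beltrami_structure n \<mu> \<in> hilb_sections A n"
    unfolding hilb_sections_def mem_Collect_eq
  proof (intro conjI ballI allI impI)
    show "beltrami_structure n \<mu> c x = {}" if "c \<notin> A \<or> x \<notin> fst c" for c x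
      using that by (auto simp: beltrami_structure_def)
    show "beltrami_structure n \<mu> c x \<in> hilb0 n" if "c \<in> A" "x \<in> fst c" for c x
      using that n by (simp add: beltrami_structure_def beltrami_ideal_hilb0)
    fix c d x assume c: "c \<in> A" "d \<in> A" and x: "x \<in> fst c \<inter> fst d"
    let ?t = "trans_deriv d c x"
    have t: "?t \<noteq> 0" using trans_deriv_inverse(2)[of d c x] c x by auto
    have "\<mu> d x = cnj ?t * \<mu> c x / ?t"
      using beltrami_transform[OF \<mu> c(2,1)] x by (simp add: mult.commute)
    then show "beltrami_structure n \<mu> c x = scale2 ?t (cnj ?t) ` beltrami_structure n \<mu> d x"
      using scale2_beltrami_ideal[of ?t "cnj ?t" n "\<mu> c x"] t c x by (simp add: beltrami_structure_def)
  qed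
  have ncs: "beltrami_structure n \<mu> \<in> n_complex_structures A n"
    unfolding n_complex_structures_def mem_Collect_eq
    using sec n beltrami_ideal_conj_sum beltrami_norm_less[OF \<mu>] by (simp add: beltrami_structure_def)
  show ?thesis
    unfolding compatible_structures_def mem_Collect_eq
  proof (intro conjI ncs ballI)
    fix c assume c: "c \<in> A"
    \<comment> \<open>The coefficient with index k belongs to the power k - 1 of p, so index 2 is
      the linear term; all higher coefficients are chosen to be 0.\<close>
    define M where "M k = (if k = 2 then \<mu> c else (\<lambda>x. 0))" for k :: nat
    have "smooth_coeff c (M k)" for k
    proof (cases "k = 2")
      case True
      then show ?thesis using \<mu> c unfolding beltrami_differentials_def by (simp add: M_def)
    qed (simp add: M_def smooth_coeff_def o_def smooth_on_const open_chart_image[OF c])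
    moreover have "(\<Sum>k=2..n. const2 (M k x) * pvar ^ (k - 1)) = const2 (\<mu> c x) * pvar" for x
    proof -
      have "(\<Sum>k=2..n. const2 (M k x) * pvar ^ (k - 1)) = (\<Sum>k\<in>{2}. const2 (M k x) * pvar ^ (k - 1))"
        using n by (intro sum.mono_neutral_right) (auto simp: M_def const2_def)
      then show ?thesis by (simp add: M_def)
    qed
    ultimately show "\<exists>M. (\<forall>k\<in>{2..n}. smooth_coeff c (M k)) \<and> (\<forall>x\<in>fst c. cmod (M 2 x) < 1 \<and>
        beltrami_structure n \<mu> c x
          = ideal_gen {pvar ^ n, - pbar + (\<Sum>k=2..n. const2 (M k x) * pvar ^ (k - 1))})"
      using beltrami_norm_less[OF \<mu> c] c
      by (intro exI[of _ M]) (simp add: beltrami_structure_def beltrami_ideal_def, simp add: M_def)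
  qed
qed

end

section \<open>The induced action on Beltrami differentials\<close>

definition flat_exp :: "nat \<Rightarrow> real \<Rightarrow> real" where
  "flat_exp k t = (if t > 0 then exp (- inverse t) * inverse t ^ k else 0)"

lemma flat_exp_tendsto_0: "(flat_exp k \<longlongrightarrow> 0) (at 0)"
proof (rule filterlim_split_at)
  have "\<forall>\<^sub>F t in at_left 0. 0 = flat_exp k t"
    by (simp add: flat_exp_def eventually_at_filter)
  then show "(flat_exp k \<longlongrightarrow> 0) (at_left 0)"
    by (rule Lim_transform_eventually[OF tendsto_const])
next
  have "((\<lambda>t. inverse t ^ k / exp (inverse t :: real)) \<longlongrightarrow> 0) (at_right 0)"
    by (rule filterlim_compose[OF tendsto_power_div_exp_0 filterlim_inverse_at_top_right])
  moreover have "\<forall>\<^sub>F t in at_right 0. inverse t ^ k / exp (inverse t) = flat_exp k t"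
    by (simp add: flat_exp_def eventually_at_filter exp_minus divide_inverse mult.commute)
  ultimately show "(flat_exp k \<longlongrightarrow> 0) (at_right 0)"
    by (rule Lim_transform_eventually)
qed

text \<open>The powers of \<open>inverse t\<close> make the family closed under differentiation, so
  smoothness follows for all k by one induction. At 0 the difference quotient is the next member of
  the family, which tends to 0.\<close>

lemma flat_exp_has_derivative:
  "(flat_exp k has_real_derivative flat_exp (k + 2) t - real k * flat_exp (k + 1) t) (at t)"
proof -
  consider "t > 0" | "t < 0" | "t = 0" by linarith
  then show ?thesis
  proof cases
    case 1
    let ?i = "inverse t"
    have i: "(inverse has_real_derivative - (?i * ?i)) (at t)"
      using 1 DERIV_inverse[of t] by (simp add: power2_eq_square)
    have pw: "real k * (- (?i * ?i) * ?i ^ (k - Suc 0)) = - real k * ?i ^ (k + 1)"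
      by (cases k) (simp_all add: algebra_simps)
    have "((\<lambda>t. exp (- inverse t)) has_real_derivative exp (- ?i) * (?i * ?i)) (at t)"
      by (rule DERIV_cong[OF DERIV_fun_exp[OF DERIV_minus[OF i]]]) simp
    from DERIV_mult[OF this DERIV_power[OF i, of k]]
    have "((\<lambda>t. exp (- inverse t) * inverse t ^ k) has_real_derivative
        flat_exp (k + 2) t - real k * flat_exp (k + 1) t) (at t)"
      unfolding pw by (rule DERIV_cong) (use 1 in \<open>simp add: flat_exp_def algebra_simps\<close>)
    then show ?thesis
      by (rule has_field_derivative_transform_within_open[where S = "{0<..}"])
        (use 1 in \<open>auto simp: flat_exp_def\<close>)
  next
    case 2
    have "((\<lambda>t. 0) has_real_derivative flat_exp (k + 2) t - real k * flat_exp (k + 1) t) (at t)"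
      using 2 by (simp add: flat_exp_def)
    then show ?thesis
      by (rule has_field_derivative_transform_within_open[where S = "{..<0}"])
        (use 2 in \<open>auto simp: flat_exp_def\<close>)
  next
    case 3
    have "(\<lambda>h. (flat_exp k (0 + h) - flat_exp k 0) / h) = flat_exp (Suc k)"
      by (auto simp: flat_exp_def fun_eq_iff divide_inverse)
    then show ?thesis
      using flat_exp_tendsto_0[of "Suc k"] unfolding 3 has_field_derivative_def
      by (simp add: DERIV_def[unfolded has_field_derivative_def] flat_exp_def)
  qed
qed

lemma smooth_on_flat_exp: "smooth_on UNIV (flat_exp k)"
  unfolding smooth_on_def
proof
  fix j show "Ck_on j UNIV (flat_exp k)"
  proof (induction j arbitrary: k)
    case 0
    have "isCont (flat_exp k) t" for t
      using flat_exp_has_derivative DERIV_isCont by blast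
    then show ?case by (simp add: continuous_at_imp_continuous_on)
  next
    case (Suc j)
    show ?case
    proof (rule Ck_on_SucI[OF open_UNIV flat_exp_has_derivative[unfolded has_field_derivative_def]])
      fix v :: real
      have "Ck_on j UNIV (\<lambda>t. v * (flat_exp (k + 2) t + (- real k) * flat_exp (k + 1) t))"
        by (intro Ck_on_linear_compose[OF bounded_linear_mult_right] Ck_on_add open_UNIV Suc.IH)
      then show "Ck_on j UNIV (\<lambda>t. (flat_exp (k + 2) t - real k * flat_exp (k + 1) t) * v)"
        by (rule Ck_on_cong[OF open_UNIV, rotated]) (simp add: algebra_simps)
    qed
  qed
qed

lemma smooth_bump:
  fixes z0 :: complex
  assumes "r > 0"
  obtains bump :: "complex \<Rightarrow> real" where "smooth_on UNIV bump" "bump z0 > 0" "\<And>z. r \<le> dist z0 z \<Longrightarrow> bump z = 0"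
proof
  \<comment> \<open>The argument of \<open>flat_exp\<close> is positive exactly in the open disc of
    radius r. It uses the squared distance, which is smooth also at the centre.\<close>
  define bump where "bump z = flat_exp 0 (r\<^sup>2 + - ((z + - z0) \<bullet> (z + - z0)))" for z
  show "smooth_on UNIV bump"
    unfolding bump_def
  proof (rule smooth_on_compose[OF open_UNIV _ smooth_on_flat_exp])
    have "smooth_on UNIV (\<lambda>z::complex. z + - z0)"
      by (intro smooth_on_add smooth_on_const smooth_on_linear bounded_linear_ident open_UNIV)
    note bil = smooth_on_bilinear[OF bounded_bilinear_inner open_UNIV this this]
    show "smooth_on UNIV (\<lambda>z. r\<^sup>2 + - ((z + - z0) \<bullet> (z + - z0)))"
      by (rule smooth_on_add[OF open_UNIV smooth_on_const[OF open_UNIV] smooth_on_minus[OF open_UNIV bil]])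
  qed simp
  show "bump z0 > 0" using assms by (simp add: bump_def flat_exp_def)
  show "bump z = 0" if "r \<le> dist z0 z" for z
  proof -
    have "r\<^sup>2 \<le> (dist z0 z)\<^sup>2" using that assms by (intro power_mono) auto
    then have "r\<^sup>2 \<le> (z - z0) \<bullet> (z - z0)" by (simp add: dist_norm norm_minus_commute dot_square_norm)
    then show ?thesis by (simp add: bump_def flat_exp_def)
  qed
qed

section \<open>Fibre jets at the zero-section\<close>

text \<open>Functions affine along the fibres; both fibre derivatives read off a coefficient, so that the
  iterated ones in the fibre jet can be computed.\<close>

definition fibre_affine ::
    "complex set \<Rightarrow> (complex \<times> complex \<Rightarrow> complex) \<Rightarrow> (complex \<Rightarrow> complex) \<Rightarrow> (complex \<Rightarrow> complex) \<Rightarrow> (complex \<Rightarrow> complex) \<Rightarrow> bool" where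
  "fibre_affine S F a b c \<longleftrightarrow> smooth_on S a \<and> smooth_on S b \<and> smooth_on S c \<and>
     (\<forall>z\<in>S. \<forall>p. F (z, p) = a z + b z * p + c z * cnj p)"

lemma fibre_affine_has_derivative:
  assumes S: "open S" "z \<in> S" and F: "fibre_affine S F a b c"
  shows "\<exists>D. (F has_derivative D) (at (z, p)) \<and> (\<forall>w. D (0, w) = b z * w + c z * cnj w)"
proof -
  have D: "((\<lambda>q::complex \<times> complex. f (fst q)) has_derivative (\<lambda>v. frechet_derivative f (at z) (fst v))) (at (z, p))"
    if "smooth_on S f" for f :: "complex \<Rightarrow> complex"
    by (rule has_derivative_compose[where f = fst])
      (use smooth_on_imp_has_derivative[OF that S(2)] in \<open>auto intro!: derivative_eq_intros\<close>)
  have 0: "frechet_derivative f (at z) 0 = 0" if "smooth_on S f" for f :: "complex \<Rightarrow> complex"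
    using linear_0[OF has_derivative_linear[OF smooth_on_imp_has_derivative[OF that S(2)]]] .
  have abc: "smooth_on S a" "smooth_on S b" "smooth_on S c"
    and eq: "\<And>z p. z \<in> S \<Longrightarrow> F (z, p) = a z + b z * p + c z * cnj p"
    using F by (auto simp: fibre_affine_def)
  have s: "(snd has_derivative snd) (at (z, p))"
    by (intro bounded_linear_imp_has_derivative bounded_linear_snd)
  have cs: "((\<lambda>q. cnj (snd q)) has_derivative (\<lambda>v. cnj (snd v))) (at (z, p))"
    by (rule bounded_linear.has_derivative[OF bounded_linear_cnj s])
  let ?G = "\<lambda>q. a (fst q) + b (fst q) * snd q + c (fst q) * cnj (snd q)"
  let ?D = "\<lambda>v. frechet_derivative a (at z) (fst v)
      + (b (fst (z, p)) * snd v + frechet_derivative b (at z) (fst v) * snd (z, p))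
      + (c (fst (z, p)) * cnj (snd v) + frechet_derivative c (at z) (fst v) * cnj (snd (z, p)))"
  have "(?G has_derivative ?D) (at (z, p))"
    by (intro has_derivative_add has_derivative_mult D abc s cs)
  then have "(F has_derivative ?D) (at (z, p))"
    by (rule has_derivative_transform_within_open[OF _ open_Times[OF S(1) open_UNIV]])
      (use S eq in auto)
  then show ?thesis using 0 abc by (intro exI[of _ ?D]) simp
qed

lemma fibre_affine_wirt:
  assumes S: "open S" and F: "fibre_affine S F a b c"
  shows "fibre_affine S (wirt p_dir F) b (\<lambda>z. 0) (\<lambda>z. 0)"
    and "fibre_affine S (wirt_bar p_dir F) c (\<lambda>z. 0) (\<lambda>z. 0)"
proof -
  have "wirt p_dir F (z, p) = b z" "wirt_bar p_dir F (z, p) = c z" if z: "z \<in> S" for z p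
  proof -
    obtain D where D: "(F has_derivative D) (at (z, p))" "\<And>w. D (0, w) = b z * w + c z * cnj w"
      using fibre_affine_has_derivative[OF S z F] by blast
    show "wirt p_dir F (z, p) = b z" "wirt_bar p_dir F (z, p) = c z"
      unfolding wirt_def wirt_bar_def frechet_derivative_at[OF D(1), symmetric] D(2)
      by (simp_all add: algebra_simps)
  qed
  with F S show "fibre_affine S (wirt p_dir F) b (\<lambda>z. 0) (\<lambda>z. 0)"
    "fibre_affine S (wirt_bar p_dir F) c (\<lambda>z. 0) (\<lambda>z. 0)"
    by (auto simp: fibre_affine_def smooth_on_const)
qed

lemma fibre_affine_wirt_power:
  assumes S: "open S" and F: "fibre_affine S F a b c"
  shows "fibre_affine S ((wirt p_dir ^^ k) F) (if k = 0 then a else if k = 1 then b else (\<lambda>z. 0))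
      (if k = 0 then b else (\<lambda>z. 0)) (if k = 0 then c else (\<lambda>z. 0))"
    and "fibre_affine S ((wirt_bar p_dir ^^ k) F) (if k = 0 then a else if k = 1 then c else (\<lambda>z. 0))
      (if k = 0 then b else (\<lambda>z. 0)) (if k = 0 then c else (\<lambda>z. 0))"
proof (induction k)
  case (Suc k)
  {
    case 1
    from fibre_affine_wirt(1)[OF S Suc.IH(1)] show ?case by (auto split: if_splits)
  next
    case 2
    from fibre_affine_wirt(2)[OF S Suc.IH(2)] show ?case by (auto split: if_splits)
  }
qed (use F in auto)

text \<open>A function that is real-linear on the fibres is its own Taylor polynomial there, and
  \<open>n \<ge> 2\<close> keeps the linear terms within the truncation. The jet is then a multiple
  of the generator of the ideal.\<close>

lemma fibre_jet_conormal:
  assumes n: "n \<ge> 2" and S: "open S" "z \<in> S" and um: "smooth_on S u" "smooth_on S m"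
    and G: "\<And>z p. z \<in> S \<Longrightarrow> G (z, p) = u z * (m z * p - cnj p)"
  shows "fibre_jet n G z = const2 (u z) * (- pbar + const2 (m z) * pvar)"
proof -
  have F: "fibre_affine S G (\<lambda>z. 0) (\<lambda>z. u z * m z) (\<lambda>z. - u z)"
    unfolding fibre_affine_def
    using S um G by (auto intro!: smooth_on_const smooth_on_mult smooth_on_minus simp: algebra_simps)
  define v where "v k l = (wirt p_dir ^^ k) ((wirt_bar p_dir ^^ l) G) (z, 0)" for k l
  have v: "v k l = (if k = 1 \<and> l = 0 then u z * m z else if k = 0 \<and> l = 1 then - u z else 0)" for k l
    using fibre_affine_wirt_power(1)[OF S(1) fibre_affine_wirt_power(2)[OF S(1) F], of k l] S(2)
    unfolding fibre_affine_def v_def by (auto split: if_splits)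
  let ?t = "\<lambda>(k, l). const2 (v k l / (fact k * fact l)) * pvar ^ k * pbar ^ l"
  have fin: "finite {(k, l). k + l < n}"
    by (rule finite_subset[of _ "{..<n} \<times> {..<n}"]) auto
  have "fibre_jet n G z = sum ?t {(k, l). k + l < n}"
    by (simp add: fibre_jet_def v_def)
  also have "\<dots> = sum ?t {(1, 0), (0, 1)}"
    by (rule sum.mono_neutral_right[OF fin]) (use n in \<open>auto simp: v const2_def split: if_splits\<close>)
  also have "\<dots> = const2 (u z * m z) * pvar + const2 (- u z) * pbar"
    by (simp add: v)
  also have "\<dots> = const2 (u z) * (- pbar + const2 (m z) * pvar)"
    by (rule eval2_eqI) (simp add: algebra_simps)
  finally show ?thesis .
qed

text \<open>On the line pbar = m p a monomial of degree k + l becomes a multiple of the power k + l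
  of p, so the linear coefficient involves first derivatives alone. This equation is all that is
  extracted from membership in the ideal.\<close>

lemma coeff_restrict_line_fibre_jet:
  assumes n: "n \<ge> 2"
  shows "Polynomial.coeff (restrict_line m (fibre_jet n G z)) 1 = wirt p_dir G (z, 0) + m * wirt_bar p_dir G (z, 0)"
proof -
  define v where "v k l = (wirt p_dir ^^ k) ((wirt_bar p_dir ^^ l) G) (z, 0)" for k l
  let ?I = "{(k, l). k + l < n}"
  have fin: "finite ?I"
    by (rule finite_subset[of _ "{..<n} \<times> {..<n}"]) auto
  have mono: "[:0, 1:] ^ k = Polynomial.monom (1::complex) k" for k by (simp add: monom_altdef)
  have t: "restrict_line m (const2 c * pvar ^ k * pbar ^ l) = Polynomial.monom (c * m ^ l) (k + l)" for c k l
  proof -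
    have "[:0, m:] = Polynomial.smult m [:0, 1:]" by simp
    then have "restrict_line m (const2 c * pvar ^ k * pbar ^ l) = Polynomial.smult c ([:0, 1:] ^ k * Polynomial.smult (m ^ l) ([:0, 1:] ^ l))"
      by (simp only: restrict_line_mult restrict_line_power restrict_line_pvar restrict_line_pbar restrict_line_const2 smult_power) (simp add: mult.commute)
    then show ?thesis unfolding mono by (simp add: smult_monom mult_monom)
  qed
  have "Polynomial.coeff (restrict_line m (fibre_jet n G z)) 1
      = (\<Sum>(k, l)\<in>?I. if k + l = 1 then v k l / (fact k * fact l) * m ^ l else 0)"
    unfolding fibre_jet_def restrict_line_sum coeff_sum v_def[symmetric]
    by (rule sum.cong[OF refl], clarify) (simp only: prod.case t coeff_monom)
  also have "\<dots> = (\<Sum>(k, l)\<in>{(1, 0), (0, 1)}. if k + l = 1 then v k l / (fact k * fact l) * m ^ l else 0)"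
    by (rule sum.mono_neutral_right[OF fin]) (use n in \<open>auto simp: add_is_1 split: if_splits\<close>)
  also have "\<dots> = v 1 0 + m * v 0 1" by simp
  finally show ?thesis by (simp add: v_def)
qed

context atlas_surface
begin

section \<open>Test functions in the ideal\<close>

lemma smooth_map_scalar:
  assumes "\<And>c. c \<in> A \<Longrightarrow> smooth_on (snd c ` fst c \<times> UNIV) (f \<circ> param (cot_chart A c))"
  shows "smooth_map (cot_atlas A) vector_atlas f"
  unfolding smooth_map_def Let_def
proof (intro conjI ballI)
  fix C and V :: "('b set \<times> ('b \<Rightarrow> 'b))" assume "C \<in> cot_atlas A" "V \<in> vector_atlas"
  then obtain c where c: "c \<in> A" "C = cot_chart A c" and V: "V = (UNIV, id)"
    by (auto simp: cot_atlas_def vector_atlas_def)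
  have eq: "snd C ` (fst C \<inter> f -` fst V) = snd c ` fst c \<times> UNIV"
    using cot_chart_image[OF c(1)] by (simp add: c V)
  show "open (snd C ` (fst C \<inter> f -` fst V))"
    unfolding eq by (intro open_Times open_chart_image c open_UNIV)
  show "smooth_on (snd C ` (fst C \<inter> f -` fst V)) (snd V \<circ> f \<circ> param C)"
    unfolding eq using assms[OF c(1)] by (simp add: c V)
qed simp

text \<open>Makes the abstract action testable at y: a cut-off multiple of the generator in the
  chart d, extended by 0. The transformation law of \<mu> turns it into a multiple of the generator
  in every other chart as well.\<close>

lemma conormal_function_exists:
  assumes n: "n \<ge> 2" and \<mu>: "\<mu> \<in> beltrami_differentials A" and d: "d \<in> A" "y \<in> fst d"
  obtains F u where "F \<in> ideal_functions A n (beltrami_structure n \<mu>)"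
    "smooth_on (snd d ` fst d) u" "u (snd d y) \<noteq> 0"
    "\<And>z p. z \<in> snd d ` fst d \<Longrightarrow> (F \<circ> param (cot_chart A d)) (z, p) = u z * (\<mu> d (param d z) * p - cnj p)"
proof -
  obtain r where r: "r > 0" "cball (snd d y) r \<subseteq> snd d ` fst d"
    using open_chart_image[OF d(1)] d(2) by (meson imageI open_contains_cball)
  obtain bump :: "complex \<Rightarrow> real" where bump: "smooth_on UNIV bump" "bump (snd d y) > 0" "\<And>z. r \<le> dist (snd d y) z \<Longrightarrow> bump z = 0"
    using smooth_bump[OF r(1), of "snd d y"] by blast
  \<comment> \<open>The bump vanishes on \<open>fst d\<close> outside K. As a compact subset of a
    Hausdorff space K is closed, so \<open>fst d\<close> and the complement of K are open sets
    covering the surface, and smoothness can be checked on each.\<close>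
  define K where "K = param d ` cball (snd d y) r"
  have "compact K" unfolding K_def
    by (intro compact_continuous_image compact_cball
        continuous_on_subset[OF homeomorphism_cont2[OF chart_homeomorphism[OF d(1)]] r(2)])
  then have K: "closed K" by (rule compact_imp_closed)
  have bumpK: "bump (snd d x) = 0" if "x \<in> fst d" "x \<notin> K" for x
  proof (rule bump(3))
    show "r \<le> dist (snd d y) (snd d x)"
      using that d(1) unfolding K_def by (metis image_eqI linorder_le_cases mem_cball param_chart)
  qed
  define F where "F m = (if fst m \<in> fst d
      then complex_of_real (bump (snd d (fst m))) * (\<mu> d (fst m) * snd m d - cnj (snd m d)) else 0)" for m :: "'a covector"
  \<comment> \<open>The coefficient of the generator in the chart c. With T the derivative of the
    transition, p in d is p in c divided by T; taking 1 / cnj T out of \<mu> p - cnj p leaves the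
    same expression with \<mu> read in c.\<close>
  define u where "u c z = (if z \<in> snd c ` (fst c \<inter> fst d)
      then complex_of_real (bump ((snd d \<circ> param c) z)) * inverse (cnj (deriv (snd d \<circ> param c) z)) else 0)" for c z
  have su: "smooth_on (snd c ` fst c) (u c)" if c: "c \<in> A" for c
  proof (rule smooth_on_local)
    fix z assume "z \<in> snd c ` fst c"
    then obtain x where x: "z = snd c x" "x \<in> fst c" by blast
    show "\<exists>U. open U \<and> z \<in> U \<and> smooth_on U (u c)"
    proof (cases "x \<in> fst d")
      case True
      let ?U = "snd c ` (fst c \<inter> fst d)"
      note U = open_overlap[OF c d(1)] and hol = transition_holomorphic[OF c d(1)]
      have 1: "smooth_on ?U (\<lambda>z. complex_of_real (bump ((snd d \<circ> param c) z)))"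
        by (intro smooth_on_linear_compose[OF bounded_linear_of_real U]
            smooth_on_compose[OF U smooth_on_holomorphic[OF U hol] bump(1)]) simp
      have 2: "smooth_on ?U (\<lambda>z. cnj (inverse (deriv (snd d \<circ> param c) z)))"
        by (intro smooth_on_linear_compose[OF bounded_linear_cnj U] smooth_on_holomorphic U
            holomorphic_on_inverse holomorphic_deriv hol deriv_transition_nonzero c d)
      have "smooth_on ?U (u c)"
        by (rule smooth_on_cong[OF U _ smooth_on_mult[OF U 1 2]]) (simp add: u_def)
      then show ?thesis using U True x by blast
    next
      case False
      let ?U = "snd c ` (fst c \<inter> - K)"
      have U: "open ?U" by (intro open_chart_map c open_Compl K)
      have "K \<subseteq> fst d"
        unfolding K_def by (rule image_subsetI) (rule param_in_chart[OF subsetD[OF r(2)]])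
      then have "z \<in> ?U" using False x by blast
      moreover have "smooth_on ?U (u c)"
      proof (rule smooth_on_cong[OF U _ smooth_on_const[OF U, of 0]])
        fix z assume "z \<in> ?U"
        then obtain x where "z = snd c x" "x \<in> fst c" "x \<notin> K" by blast
        then show "0 = u c z" using bumpK[of x] c inj_chartsD[OF inj_charts_A c] by (auto simp: u_def dest: inj_onD)
      qed
      ultimately show ?thesis using U by blast
    qed
  qed
  have Fc: "(F \<circ> param (cot_chart A c)) (z, p) = u c z * (\<mu> c (param c z) * p - cnj p)"
    if c: "c \<in> A" and z: "z \<in> snd c ` fst c" for c z p
  proof -
    obtain x where x: "z = snd c x" "x \<in> fst c" using z by blast
    have m: "param (cot_chart A c) (z, p) = cov c x p" using param_cot_chart[OF c z] x c by simp
    show ?thesis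
    proof (cases "x \<in> fst d")
      case True
      let ?T = "trans_deriv c d x"
      note T = trans_deriv_inverse[OF c d(1) x(2) True]
      have s: "snd (cov c x p) d = inverse ?T * p" using snd_cov[OF d(1) True, of c p] T by simp
      have "z \<in> snd c ` (fst c \<inter> fst d)" using x True by blast
      then have u: "u c z = complex_of_real (bump (snd d x)) * inverse (cnj ?T)"
        using x c unfolding u_def trans_deriv_def by simp
      have F: "F (cov c x p) = complex_of_real (bump (snd d x)) * (\<mu> d x * (inverse ?T * p) - cnj (inverse ?T * p))"
        by (simp only: F_def fst_cov s True if_True)
      have "\<mu> c (param c z) = \<mu> d x * cnj ?T / ?T"
        using beltrami_transform[OF \<mu> c d(1) x(2) True] x c by simp
      then show ?thesis
        unfolding o_apply m F u using T(2) by (simp add: field_simps)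
    next
      case False
      then have "z \<notin> snd c ` (fst c \<inter> fst d)"
        using x inj_chartsD[OF inj_charts_A c] by (auto dest: inj_onD)
      then show ?thesis using False by (simp add: m F_def u_def)
    qed
  qed
  have sm: "smooth_on (snd c ` fst c) (\<lambda>z. \<mu> c (param c z))" if "c \<in> A" for c
    using \<mu> that unfolding beltrami_differentials_def by (simp add: smooth_coeff_def o_def)
  have "smooth_map (cot_atlas A) vector_atlas F"
  proof (rule smooth_map_scalar)
    fix c assume c: "c \<in> A"
    let ?S = "snd c ` fst c"
    have S: "open ?S" and SU: "open (?S \<times> (UNIV :: complex set))" using open_chart_image[OF c] by (auto intro: open_Times)
    have base: "smooth_on (?S \<times> UNIV) (\<lambda>q::complex \<times> complex. f (fst q))" if "smooth_on ?S f" for f :: "complex \<Rightarrow> complex"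
      by (rule smooth_on_compose[where f = fst and g = f, OF SU smooth_on_linear[OF bounded_linear_fst SU] that]) auto
    have "smooth_on (?S \<times> UNIV) (\<lambda>q. u c (fst q) * (\<mu> c (param c (fst q)) * snd q + - cnj (snd q)))"
      by (intro smooth_on_mult smooth_on_add smooth_on_minus SU base su sm c smooth_on_linear[OF bounded_linear_snd]
          smooth_on_linear_compose[OF bounded_linear_cnj])
    then show "smooth_on (?S \<times> UNIV) (F \<circ> param (cot_chart A c))"
      by (rule smooth_on_cong[OF SU, rotated]) (use Fc[OF c] in auto)
  qed
  moreover have "fibre_jet n (F \<circ> param (cot_chart A c)) (snd c x) \<in> beltrami_structure n \<mu> c x"
    if c: "c \<in> A" "x \<in> fst c" for c x
  proof -
    have "fibre_jet n (F \<circ> param (cot_chart A c)) (snd c x)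
        = const2 (u c (snd c x)) * (- pbar + const2 (\<mu> c (param c (snd c x))) * pvar)"
      by (rule fibre_jet_conormal[OF n open_chart_image[OF c(1)] _ su[OF c(1)] sm[OF c(1)] Fc[OF c(1)]])
        (use c in auto)
    then show ?thesis
      using c Modules.module.subspace_scale[OF module_mult is_ideal_beltrami_ideal beltrami_ideal_generator]
      by (simp add: beltrami_structure_def)
  qed
  ultimately have "F \<in> ideal_functions A n (beltrami_structure n \<mu>)"
    by (simp add: ideal_functions_def)
  moreover have "u d (snd d y) \<noteq> 0"
  proof -
    have "snd d y \<in> snd d ` (fst d \<inter> fst d)" using d by blast
    then show ?thesis using bump(2) trans_deriv_self[OF d] d by (simp add: u_def trans_deriv_def)
  qed
  ultimately show ?thesis using that[of F "u d"] su[OF d(1)] Fc[OF d(1)] by blast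
qed

text \<open>A test function composed with \<phi> lies in the ideal of \<nu>, so its linear
  coefficient on the line of slope \<nu> vanishes. The chain rule writes this in terms of the fibre
  derivative of \<phi>, whose coefficients are tied to the base map by symplecticity.\<close>

lemma acts_to_imp_beltrami_pullback:
  assumes n: "n \<ge> 2" and \<phi>: "\<phi> \<in> higher_diffeos A"
    and \<mu>: "\<mu> \<in> beltrami_differentials A"
    and act: "acts_to A n \<phi> (beltrami_structure n \<mu>) (beltrami_structure n \<nu>)"
  shows "beltrami_pullback A (base_map \<phi>) \<mu> \<nu>"
  unfolding beltrami_pullback_eq
proof (intro ballI impI)
  fix c d x assume c: "c \<in> A" "d \<in> A" "x \<in> fst c" "base_map \<phi> x \<in> fst d"
  let ?y = "base_map \<phi> x" and ?C = "cot_chart A c" and ?D = "cot_chart A d"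
  let ?q = "(snd c x, 0 :: complex)" and ?X = "cotD \<phi> c d (zero_cov x)"
  obtain \<alpha> \<beta> where ab: "\<And>w. snd (?X (0, w)) = \<alpha> * w + \<beta> * cnj w"
    and 1: "\<alpha> * wz (base_map \<phi>) c d x + cnj \<beta> * cnj (wzb (base_map \<phi>) c d x) = 1"
    and 2: "\<alpha> * wzb (base_map \<phi>) c d x + cnj \<beta> * cnj (wz (base_map \<phi>) c d x) = 0"
    using higher_diffeo_fibre_derivative[OF \<phi> c] by blast
  obtain F u where F: "F \<in> ideal_functions A n (beltrami_structure n \<mu>)"
    and u: "smooth_on (snd d ` fst d) u" "u (snd d ?y) \<noteq> 0"
    and Fd: "\<And>z p. z \<in> snd d ` fst d \<Longrightarrow> (F \<circ> param ?D) (z, p) = u z * (\<mu> d (param d z) * p - cnj p)"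
    using conormal_function_exists[OF n \<mu> c(2,4)] by blast
  let ?m = "\<mu> d ?y" and ?U = "u (snd d ?y)"
  note s\<phi> = higher_diffeo_base_map(2)[OF \<phi>, unfolded diffeomorphism_def, THEN conjunct2, THEN conjunct1]
  note bz = base_map_zero_cov[OF higher_diffeo_base_map(3)[OF \<phi>]]
  define G where "G = F \<circ> \<phi> \<circ> param ?C"
  have "F \<circ> \<phi> \<in> ideal_functions A n (beltrami_structure n \<nu>)"
    using act F unfolding acts_to_def ideal_functions_def by blast
  then have "fibre_jet n G (snd c x) \<in> beltrami_structure n \<nu> c x"
    using c by (simp add: ideal_functions_def G_def)
  \<comment> \<open>Membership annihilates the coefficients with index below n, and
    \<open>n \<ge> 2\<close> includes the linear one.\<close>
  then have "Polynomial.coeff (restrict_line (\<nu> c x) (fibre_jet n G (snd c x))) 1 = 0"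
    using n c by (simp add: beltrami_structure_def beltrami_ideal_iff X_power_dvd_iff)
  then have jet: "wirt p_dir G ?q + \<nu> c x * wirt_bar p_dir G ?q = 0"
    unfolding coeff_restrict_line_fibre_jet[OF n] .
  have G: "\<exists>D. (G has_derivative D) (at ?q) \<and> (\<forall>w. D (0, w) = ?U * (?m * snd (?X (0, w)) - cnj (snd (?X (0, w)))))"
  proof -
    have sm: "smooth_on (snd d ` fst d) (\<lambda>z. \<mu> d (param d z))"
      using \<mu> c unfolding beltrami_differentials_def by (simp add: smooth_coeff_def o_def)
    have aff: "fibre_affine (snd d ` fst d) (F \<circ> param ?D) (\<lambda>z. 0) (\<lambda>z. u z * \<mu> d (param d z)) (\<lambda>z. - u z)"
      unfolding fibre_affine_def using open_chart_image[OF c(2)] u(1) sm Fd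
      by (auto intro!: smooth_on_const smooth_on_mult smooth_on_minus simp: algebra_simps)
    have dy: "snd d ?y \<in> snd d ` fst d" using c by blast
    obtain E where E: "((F \<circ> param ?D) has_derivative E) (at (snd d ?y, 0))"
      "\<And>w. E (0, w) = ?U * ?m * w + - ?U * cnj w"
      using fibre_affine_has_derivative[OF open_chart_image[OF c(2)] dy aff, of 0] c by auto
    \<comment> \<open>F vanishes on the zero-section, so its derivative kills horizontal vectors.
      The base component of \<open>?X (0, w)\<close>, about which nothing is known, therefore does
      not contribute.\<close>
    have E1: "E (v, 0) = 0" for v
    proof -
      have "((\<lambda>z. (F \<circ> param ?D) (z, 0)) has_derivative (\<lambda>v. E (v, 0))) (at (snd d ?y))"
        by (rule has_derivative_compose[where f = "\<lambda>z. (z, 0)", OF _ E(1)]) (auto intro!: derivative_eq_intros)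
      moreover have "((\<lambda>z. (F \<circ> param ?D) (z, 0)) has_derivative (\<lambda>v. 0)) (at (snd d ?y))"
        by (rule has_derivative_transform_within_open[OF has_derivative_const open_chart_image[OF c(2)] dy])
          (simp only: Fd, simp)
      ultimately show ?thesis using has_derivative_unique by (metis (no_types, lifting))
    qed
    have E: "E v = ?U * (?m * snd v - cnj (snd v))" for v
    proof -
      have "E v = E (fst v, 0) + E (0, snd v)"
        using linear_add[OF has_derivative_linear[OF E(1)], of "(fst v, 0)" "(0, snd v)"] by simp
      then show ?thesis by (simp add: E1 E(2) algebra_simps)
    qed
    let ?L = "snd ?D \<circ> \<phi> \<circ> param ?C"
    have zc: "fst (zero_cov x) \<in> fst c" "fst (\<phi> (zero_cov x)) \<in> fst d" using c by (auto simp: base_map_def)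
    have L: "(?L has_derivative ?X) (at ?q)"
      using smooth_cot_has_derivative[OF s\<phi> c(1,2) zero_cov_in zc] by simp
    have Lq: "?L ?q = (snd d ?y, 0)"
      using param_cot_chart_chart[OF c(1) zero_cov_in zc(1)] by (simp add: bz)
    have "((\<lambda>q. (F \<circ> param ?D) (?L q)) has_derivative (\<lambda>v. E (?X v))) (at ?q)"
      by (rule has_derivative_compose[OF L]) (unfold Lq, rule \<open>(F \<circ> param ?D has_derivative E) (at (snd d ?y, 0))\<close>)
    then have "(G has_derivative (\<lambda>v. E (?X v))) (at ?q)"
    proof (rule has_derivative_transform_within_open)
      show "open (snd ?C ` (fst ?C \<inter> \<phi> -` fst ?D))"
        by (rule smooth_map_open[OF s\<phi> cot_chart_in[OF c(1)] cot_chart_in[OF c(2)]])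
      show "?q \<in> snd ?C ` (fst ?C \<inter> \<phi> -` fst ?D)"
        by (rule image_eqI[of _ _ "zero_cov x"]) (use zc bz in auto)
      fix q assume "q \<in> snd ?C ` (fst ?C \<inter> \<phi> -` fst ?D)"
      then obtain m where m: "q = snd ?C m" "m \<in> fst ?C" "\<phi> m \<in> fst ?D" by blast
      then have "param ?C q = m" "param ?D (snd ?D (\<phi> m)) = \<phi> m"
        using inv_into_f_f[OF inj_on_cot_chart[OF c(1)]] inv_into_f_f[OF inj_on_cot_chart[OF c(2)]] by auto
      then show "(F \<circ> param ?D) (?L q) = G q" by (simp add: G_def del: snd_cot_chart)
    qed
    then show ?thesis using E by blast
  qed
  then obtain D where D: "(G has_derivative D) (at ?q)"
    "\<And>w. D (0, w) = ?U * (?m * (\<alpha> * w + \<beta> * cnj w) - cnj (\<alpha> * w + \<beta> * cnj w))"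
    unfolding ab by blast
  have w: "wirt p_dir G ?q = ?U * (?m * \<alpha> - cnj \<beta>)" "wirt_bar p_dir G ?q = ?U * (?m * \<beta> - cnj \<alpha>)"
    unfolding wirt_def wirt_bar_def frechet_derivative_at[OF D(1), symmetric] D(2)
    by (simp_all add: field_simps)
  have "?U * (?m * \<alpha> - cnj \<beta> + \<nu> c x * (?m * \<beta> - cnj \<alpha>)) = 0"
    using jet unfolding w by (simp add: algebra_simps)
  then have "?m * \<alpha> - cnj \<beta> + \<nu> c x * (?m * \<beta> - cnj \<alpha>) = 0" using u(2) by simp
  then show "\<nu> c x = (wzb (base_map \<phi>) c d x + ?m * cnj (wz (base_map \<phi>) c d x))
      / (wz (base_map \<phi>) c d x + ?m * cnj (wzb (base_map \<phi>) c d x))"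
    by (rule beltrami_from_conormal[OF 1 2 beltrami_norm_less[OF \<mu> c(2,4)]])
qed

section \<open>The map between the quotients\<close>

lemma ident_higher_diffeo: "(\<lambda>m. m) \<in> higher_diffeos A"
proof -
  let ?\<Phi> = "\<lambda>(t::real) m::'a covector. m" and ?H = "\<lambda>(t::real) m::'a covector. 0 :: real"
  have const: "smooth_map (cot_atlas A) vector_atlas (\<lambda>m. 0 :: real)"
    by (rule smooth_map_scalar)
      (auto simp: o_def intro: smooth_on_const open_Times open_chart_image)
  have "poisson (complex_of_real \<circ> ?H t \<circ> f) g q = 0" for t f g q
    by (simp add: poisson_def wirt_def wirt_bar_def o_def)
  then have "hamiltonian_isotopy A ?H ?\<Phi>"
    unfolding hamiltonian_isotopy_def Let_def
    using isotopy_ident[OF inj_charts_cot_atlas smooth_map_cot_ident] smooth_map_snd[OF inj_charts_cot_atlas const]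
    by (simp add: case_prod_unfold zero_prod_def[symmetric])
  then show ?thesis
    unfolding higher_diffeos_def by (intro CollectI exI[of _ ?\<Phi>]) auto
qed

text \<open>Points of the moduli space are images of single structures under the relation.
  Reflexivity places a structure in its own image, so that equal images yield related
  structures.\<close>

lemma moduli_rel_refl:
  assumes "I \<in> compatible_structures A n"
  shows "(I, I) \<in> moduli_rel A n"
proof -
  have "acts_to A n (\<lambda>m. m) I I" by (simp add: acts_to_def o_def)
  with assms ident_higher_diffeo show ?thesis unfolding moduli_rel_def by blast
qed

lemma moduli_rel_imp_teichmueller_rel:
  assumes n: "n \<ge> 2" and \<mu>: "\<mu> \<in> beltrami_differentials A" and \<nu>: "\<nu> \<in> beltrami_differentials A"
    and rel: "(beltrami_structure n \<mu>, beltrami_structure n \<nu>) \<in> moduli_rel A n"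
  shows "(\<mu>, \<nu>) \<in> teichmueller_rel A"
proof -
  obtain \<phi> where "\<phi> \<in> higher_diffeos A" "acts_to A n \<phi> (beltrami_structure n \<mu>) (beltrami_structure n \<nu>)"
    using rel by (auto simp: moduli_rel_def)
  then have "beltrami_pullback A (base_map \<phi>) \<mu> \<nu>" "base_map \<phi> \<in> diffeos_isotopic_to_id A"
    using acts_to_imp_beltrami_pullback[OF n _ \<mu>] higher_diffeo_base_map(1) by auto
  then show ?thesis using \<mu> \<nu> unfolding teichmueller_rel_def by blast
qed

theorem teichmueller_injection:
  assumes n: "n \<ge> 2"
  shows "\<exists>\<iota>. inj_on \<iota> (teichmueller_space A) \<and> \<iota> ` teichmueller_space A \<subseteq> moduli_space A n"
proof -
  let ?R = "teichmueller_rel A" and ?B = "beltrami_differentials A" and ?I = "beltrami_structure n"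
  define rep where "rep X = (SOME \<mu>. \<mu> \<in> ?B \<and> X = ?R `` {\<mu>})" for X
  have rep: "rep X \<in> ?B \<and> X = ?R `` {rep X}" if "X \<in> teichmueller_space A" for X
  proof -
    have "\<exists>\<mu>. \<mu> \<in> ?B \<and> X = ?R `` {\<mu>}" using that by (auto simp: teichmueller_space_def quotient_def)
    then show ?thesis unfolding rep_def by (rule someI_ex)
  qed
  define \<iota> where "\<iota> X = moduli_rel A n `` {?I (rep X)}" for X
  have comp: "?I (rep X) \<in> compatible_structures A n" if "X \<in> teichmueller_space A" for X
    using rep[OF that] by (intro beltrami_structure_compatible n) blast
  have "inj_on \<iota> (teichmueller_space A)"
  proof (rule inj_onI)
    fix X Y assume X: "X \<in> teichmueller_space A" and Y: "Y \<in> teichmueller_space A" and eq: "\<iota> X = \<iota> Y"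
    have "(?I (rep X), ?I (rep Y)) \<in> moduli_rel A n"
      using moduli_rel_refl[OF comp[OF Y]] eq unfolding \<iota>_def by blast
    then have XY: "(rep X, rep Y) \<in> ?R"
      using rep[OF X] rep[OF Y] by (intro moduli_rel_imp_teichmueller_rel[OF n]) blast+
    then have YX: "(rep Y, rep X) \<in> ?R" using sym_teichmueller_rel by (rule symD[rotated])
    \<comment> \<open>Transitivity along \<open>XY\<close> and along \<open>YX\<close> gives the two
      inclusions.\<close>
    have "?R `` {rep X} = ?R `` {rep Y}"
      using transD[OF trans_teichmueller_rel XY] transD[OF trans_teichmueller_rel YX] by blast
    then show "X = Y" using rep[OF X] rep[OF Y] by metis
  qed
  moreover have "\<iota> ` teichmueller_space A \<subseteq> moduli_space A n"
    unfolding moduli_space_def \<iota>_def using comp by (auto intro: quotientI)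
  ultimately show ?thesis by blast
qed

end

theorem proposition5p10:
  fixes A :: "('a::t2_space) cchart set" and g n :: nat
  assumes "closed_surface A g" and "g \<ge> 2" and "n \<ge> 2"
  shows "\<exists>\<iota>. inj_on \<iota> (teichmueller_space A) \<and> \<iota> ` teichmueller_space A \<subseteq> moduli_space A n"
proof -
  interpret atlas_surface A
    by unfold_locales (use assms(1) in \<open>simp add: closed_surface_def\<close>)
  show ?thesis by (rule teichmueller_injection[OF assms(3)])
qed

end
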